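(* Let $\gamma>1/3$, let $A:\mathbb{R}^3\to\mathbb{R}^3\otimes\mathbb{R}^3$ be a matrix field with $\|\nabla A\|_4<\infty$, let $r>0$ and let $T_0=T_0(r)>0$ be the common existence time described in the context. Then the map $\Gamma$ sending a rough path $\mathbb{X}$ to the lifted solution $\mathbb{Y}=(Y,\mathbb{Y}^2)$ of the vortex filament equation started at $\mathbb{X}$ is Lipschitz from $\mathscr{B}(\Sigma^\gamma;r)$ (with the distance $d$) to $C([0,T_0],\Sigma^\gamma)$ endowed with the uniform distance $\sup_{t\in[0,T_0]}d(\mathbb{Y}(t),\widetilde{\mathbb{Y}}(t))$.
   Context: $\mathscr{C}$ is the set of continuous closed curves $X:[0,1]\to\mathbb{R}^3$, $X_0=X_1$. $\|X\|_\gamma=\sup_{\xi\ne\eta}|X_\xi-X_\eta|/|\xi-\eta|^\gamma$ (also for matrix-valued functions), $\|X\|_\infty=\sup_\xi|X_\xi|$, and $\mathscr{C}^\gamma=\{X\in\mathscr{C}:\|X\|_\infty+\|X\|_\gamma<\infty\}$. For functions of two variables, $\|R\|_{2\gamma}=\sup_{\xi\neq\eta}|R_{\xi\eta}|/|\xi-\eta|^{2\gamma}$. The norm of a tensor is the sum of the absolute values of its components; for a tensor field $\varphi$ on $\mathbb{R}^3$, $\|\varphi\|=\sup_x|\varphi(x)|$ and $\|\varphi\|_n=\sum_{k=0}^n\|\nabla^k\varphi\|$. A $\gamma$-rough path is a couple $\mathbb{X}=(X,\mathbb{X}^2)$ with $X\in\mathscr{C}^\gamma$, $\mathbb{X}^2\in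 C([0,1]^2,\mathbb{R}^3\otimes\mathbb{R}^3)$, $\|\mathbb{X}^2\|_{2\gamma}<\infty$ and $$\mathbb{X}^{2,ij}_{\xi\rho}-\mathbb{X}^{2,ij}_{\xi\eta}-\mathbb{X}^{2,ij}_{\eta\rho}=(X^i_\xi-X^i_\eta)(X^j_\eta-X^j_\rho),\qquad \xi,\eta,\rho\in[0,1].$$ $\Sigma^\gamma$ is the set of $\gamma$-rough paths, with $d(\mathbb{X},\widetilde{\mathbb{X}})=\|X-\widetilde X\|_\gamma+\|\mathbb{X}^2-\widetilde{\mathbb{X}}^2\|_{2\gamma}$. $\mathscr{B}(\Sigma^\gamma;r)$ is the open ball of radius $r$ centered at the trivial rough path $(0,0)$. $\mathscr{D}_X$ (paths weakly controlled by $X$) is the Banach space of paths $Y\in\mathscr{C}$, together with $Y'\in C^\gamma([0,1],\mathbb{R}^3\otimes\mathbb{R}^3)$, such that $Y_\xi-Y_\eta=Y'_\eta(X_\xi-X_\eta)+R^Y_{\eta\xi}$ with $\|R^Y\|_{2\gamma}<\infty$; an element is understood as the pair $(Y,Y')$. Norms: $\|Y\|_D=\|Y'\|_\gamma+\|R^Y\|_{2\gamma}+\|Y'\|_\infty$, $\|Y\|_D^*=\|Y\|_D+\|Y\|_\infty$. $\mathbf{D}_{X,T}=C([0,T],\mathscr{D}_X)$ has norm $\sup_{t\in[0,T]}\|Y(t)\|_D^*$. If $Y,Z$ are (real-valued) controlled paths, i.e. $Z_\xi-Z_\eta=\sum_aZ'^{\,a}_\eta(X^a_\xi-X^a_\eta)+R^Z_{\eta\xi}$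 with $Z'$ $\gamma$-Hölder and $\|R^Z\|_{2\gamma}<\infty$ (and similarly for $Y$), the rough integral $\int_\xi^\eta Y\,dZ$ is the limit, as the mesh of the partition $\xi=\xi_0<\dots<\xi_n=\eta$ goes to $0$, of $\sum_{k}\big[Y_{\xi_k}(Z_{\xi_{k+1}}-Z_{\xi_k})+\sum_{a,c}Y'^{\,a}_{\xi_k}Z'^{\,c}_{\xi_k}\mathbb{X}^{2,ac}_{\xi_k\xi_{k+1}}\big]$ (extended by $\int_\xi^\eta=-\int_\eta^\xi$ when $\eta<\xi$). For $Y\in\mathscr{D}_X$, $V^Y(x)=\int_0^1A(x-Y_\eta)\,dY_\eta$, i.e. $V^Y(x)^i=\sum_j\int_0^1A^{ij}(x-Y_\eta)\,dY^j_\eta$, where $A^{ij}(x-Y_\cdot)$ has derivative $-\sum_b\partial_bA^{ij}(x-Y_\eta)(Y'_\eta)^{ba}$ with respect to $X^a$. The solution starting at $\mathbb{X}$ on $[0,T]$ is the unique $Y\in\mathbf{D}_{X,T}$ with $Y(t)_\xi=X_\xi+\int_0^tV^{Y(s)}(Y(s)_\xi)\,ds$ and $Y(t)'_\xi=\mathrm{Id}+\int_0^t\nabla V^{Y(s)}(Y(s)_\xi)Y(s)'_\xi\,ds$, where $(\nabla V)^{ik}=\partial_kV^i$. $T_0(r)>0$ is a common existence time supplied by the paper's local existence theorem for initial data in $\mathscr{B}(\Sigma^\gamma;r)$: for every $\mathbb{X}\in\mathscr{B}(\Sigma^\gamma;r)$ the solution $Y$ exists and is unique on $[0,T_0(r)]$,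 and $\|Y(t)\|_D\le B$ for $t\in[0,T_0(r)]$ with a constant $B$ independent of $\mathbb{X}\in\mathscr{B}(\Sigma^\gamma;r)$. The map $\Gamma:\mathscr{B}(\Sigma^\gamma;r)\to C([0,T_0],\Sigma^\gamma)$ is $\Gamma(\mathbb{X})=\mathbb{Y}=(Y,\mathbb{Y}^2)$, where $Y$ is this solution and $$[\mathbb{Y}^2(t)]^{ij}_{\rho\xi}=\int_\rho^\xi(Y(t)^i_\eta-Y(t)^i_\rho)\,dY(t)^j_\eta,$$ a rough integral of controlled paths. *)

theory Defs
  imports "HOL-Analysis.Analysis"
begin

text \<open>
  Curves, controlled paths and two-parameter functions are total functions of which only the
  values at parameters in \<open>{0..1}\<close> (and times in \<open>{0..T}\<close>) matter; every notion below depends on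
  those values only. Suprema of norms are taken in \<^typ>\<open>ennreal\<close>, so that a finite norm is
  literally a norm \<open>< \<infinity>\<close>.
\<close>

type_synonym vec3 = "real^3"
type_synonym mat3 = "real^3^3"
type_synonym curve = "real \<Rightarrow> vec3"
type_synonym rpath = "curve \<times> (real \<Rightarrow> real \<Rightarrow> mat3)"
type_synonym cpath = "curve \<times> (real \<Rightarrow> mat3)"


subsection \<open>Norms\<close>

text \<open>On \<^typ>\<open>vec3\<close> and \<^typ>\<open>mat3\<close> the coordinates along \<^const>\<open>Basis\<close> are the tensor components.\<close>

definition tensor_norm :: "'a::euclidean_space \<Rightarrow> real" where
  "tensor_norm v = (\<Sum>b\<in>Basis. \<bar>v \<bullet> b\<bar>)"

definition sup_norm :: "(real \<Rightarrow> 'a::euclidean_space) \<Rightarrow> ennreal" where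
  "sup_norm f = (SUP \<xi>\<in>{0..1}. ennreal (tensor_norm (f \<xi>)))"

definition holder2_norm :: "real \<Rightarrow> (real \<Rightarrow> real \<Rightarrow> 'a::euclidean_space) \<Rightarrow> ennreal" where
  "holder2_norm \<alpha> R =
     (SUP (\<xi>, \<eta>)\<in>{(\<xi>, \<eta>). \<xi> \<in> {0..1} \<and> \<eta> \<in> {0..1} \<and> \<xi> \<noteq> \<eta>}.
        ennreal (tensor_norm (R \<xi> \<eta>) / \<bar>\<xi> - \<eta>\<bar> powr \<alpha>))"

definition holder_norm :: "real \<Rightarrow> (real \<Rightarrow> 'a::euclidean_space) \<Rightarrow> ennreal" where
  "holder_norm \<alpha> f = holder2_norm \<alpha> (\<lambda>\<xi> \<eta>. f \<xi> - f \<eta>)"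


subsection \<open>Tensor fields\<close>

definition partial_deriv :: "3 \<Rightarrow> (vec3 \<Rightarrow> real) \<Rightarrow> vec3 \<Rightarrow> real" where
  "partial_deriv k f x = frechet_derivative f (at x) (axis k 1)"

fun partial_derivs :: "3 list \<Rightarrow> (vec3 \<Rightarrow> real) \<Rightarrow> vec3 \<Rightarrow> real" where
  "partial_derivs [] f = f"
| "partial_derivs (k # ks) f = partial_deriv k (partial_derivs ks f)"

text \<open>
  A tensor field is given by its family of components, indexed by a finite type. The components
  of \<open>\<nabla>\<^sup>k \<phi>\<close> are the derivatives of the components of \<open>\<phi>\<close> along all index words of length \<open>k\<close>.
\<close>

type_synonym 'c field = "'c \<Rightarrow> vec3 \<Rightarrow> real"

definition field_of :: "(vec3 \<Rightarrow> mat3) \<Rightarrow> (3 \<times> 3) field" where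
  "field_of A = (\<lambda>(i, j) x. A x $ i $ j)"

definition field_grad :: "'c field \<Rightarrow> ('c \<times> 3) field" where
  "field_grad \<phi> = (\<lambda>(c, k). partial_deriv k (\<phi> c))"

definition times_differentiable :: "nat \<Rightarrow> 'c field \<Rightarrow> bool" where
  "times_differentiable n \<phi> \<longleftrightarrow>
     (\<forall>c ks x. length ks < n \<longrightarrow> partial_derivs ks (\<phi> c) differentiable at x)"

definition Cn_norm :: "nat \<Rightarrow> 'c::finite field \<Rightarrow> ennreal" where
  "Cn_norm n \<phi> =
     (\<Sum>k\<le>n. SUP x. ennreal (\<Sum>c\<in>UNIV. \<Sum>ks\<in>{ks. length ks = k}. \<bar>partial_derivs ks (\<phi> c) x\<bar>))"


subsection \<open>Rough paths\<close>

definition closed_curves :: "curve set" where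
  "closed_curves = {X. continuous_on {0..1} X \<and> X 0 = X 1}"

definition holder_curves :: "real \<Rightarrow> curve set" where
  "holder_curves \<gamma> = {X \<in> closed_curves. sup_norm X + holder_norm \<gamma> X < \<infinity>}"

definition rough_paths :: "real \<Rightarrow> rpath set" where
  "rough_paths \<gamma> = {(X, X2).
     X \<in> holder_curves \<gamma> \<and>
     continuous_on ({0..1} \<times> {0..1}) (\<lambda>(\<xi>, \<eta>). X2 \<xi> \<eta>) \<and>
     holder2_norm (2 * \<gamma>) X2 < \<infinity> \<and>
     (\<forall>\<xi>\<in>{0..1}. \<forall>\<eta>\<in>{0..1}. \<forall>\<rho>\<in>{0..1}. \<forall>i j.
        X2 \<xi> \<rho> $ i $ j - X2 \<xi> \<eta> $ i $ j - X2 \<eta> \<rho> $ i $ j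
          = (X \<xi> $ i - X \<eta> $ i) * (X \<eta> $ j - X \<rho> $ j))}"

text \<open>This is a pseudo-distance: it does not see translations of the underlying curve.\<close>

definition rough_dist :: "real \<Rightarrow> rpath \<Rightarrow> rpath \<Rightarrow> ennreal" where
  "rough_dist \<gamma> = (\<lambda>(X, X2) (Z, Z2).
     holder_norm \<gamma> (\<lambda>\<xi>. X \<xi> - Z \<xi>) + holder2_norm (2 * \<gamma>) (\<lambda>\<xi> \<eta>. X2 \<xi> \<eta> - Z2 \<xi> \<eta>))"

definition rough_ball :: "real \<Rightarrow> real \<Rightarrow> rpath set" where
  "rough_ball \<gamma> r =
     {XX \<in> rough_paths \<gamma>. rough_dist \<gamma> XX (\<lambda>_. 0, \<lambda>_ _. 0) < ennreal r}"

definition cont_rough_paths :: "real \<Rightarrow> real \<Rightarrow> (real \<Rightarrow> rpath) set" where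
  "cont_rough_paths \<gamma> T = {YY.
     (\<forall>t\<in>{0..T}. YY t \<in> rough_paths \<gamma>) \<and>
     (\<forall>t\<in>{0..T}. ((\<lambda>s. rough_dist \<gamma> (YY s) (YY t)) \<longlongrightarrow> 0) (at t within {0..T}))}"

definition unif_rough_dist ::
    "real \<Rightarrow> real \<Rightarrow> (real \<Rightarrow> rpath) \<Rightarrow> (real \<Rightarrow> rpath) \<Rightarrow> ennreal" where
  "unif_rough_dist \<gamma> T YY ZZ = (SUP t\<in>{0..T}. rough_dist \<gamma> (YY t) (ZZ t))"


subsection \<open>Controlled paths\<close>

text \<open>The remainder \<open>R\<^sub>\<eta>\<^sub>\<xi>\<close>, base point first.\<close>

definition remainder :: "curve \<Rightarrow> cpath \<Rightarrow> real \<Rightarrow> real \<Rightarrow> vec3" where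
  "remainder X = (\<lambda>(Y, Y') \<eta> \<xi>. Y \<xi> - Y \<eta> - Y' \<eta> *v (X \<xi> - X \<eta>))"

definition D_norm :: "real \<Rightarrow> curve \<Rightarrow> cpath \<Rightarrow> ennreal" where
  "D_norm \<gamma> X Y =
     holder_norm \<gamma> (snd Y) + holder2_norm (2 * \<gamma>) (remainder X Y) + sup_norm (snd Y)"

definition D_star_norm :: "real \<Rightarrow> curve \<Rightarrow> cpath \<Rightarrow> ennreal" where
  "D_star_norm \<gamma> X Y = D_norm \<gamma> X Y + sup_norm (fst Y)"

definition controlled_paths :: "real \<Rightarrow> curve \<Rightarrow> cpath set" where
  "controlled_paths \<gamma> X = {(Y, Y').
     Y \<in> closed_curves \<and>
     sup_norm Y' + holder_norm \<gamma> Y' < \<infinity> \<and>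
     holder2_norm (2 * \<gamma>) (remainder X (Y, Y')) < \<infinity>}"

definition cpath_diff :: "cpath \<Rightarrow> cpath \<Rightarrow> cpath" where
  "cpath_diff Y Z = (\<lambda>\<xi>. fst Y \<xi> - fst Z \<xi>, \<lambda>\<xi>. snd Y \<xi> - snd Z \<xi>)"

definition cont_controlled_paths :: "real \<Rightarrow> curve \<Rightarrow> real \<Rightarrow> (real \<Rightarrow> cpath) set" where
  "cont_controlled_paths \<gamma> X T = {Y.
     (\<forall>t\<in>{0..T}. Y t \<in> controlled_paths \<gamma> X) \<and>
     (\<forall>t\<in>{0..T}.
        ((\<lambda>s. D_star_norm \<gamma> X (cpath_diff (Y s) (Y t))) \<longlongrightarrow> 0) (at t within {0..T}))}"


subsection \<open>The rough integral\<close>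

definition partitions :: "real \<Rightarrow> real \<Rightarrow> real list set" where
  "partitions \<xi> \<eta> = {p. p \<noteq> [] \<and> sorted_wrt (<) p \<and> hd p = \<xi> \<and> last p = \<eta>}"

definition mesh_to_0 :: "real \<Rightarrow> real \<Rightarrow> real list filter" where
  "mesh_to_0 \<xi> \<eta> = (INF \<delta>\<in>{0<..}. principal
     {p \<in> partitions \<xi> \<eta>. \<forall>k. Suc k < length p \<longrightarrow> p ! Suc k - p ! k < \<delta>})"

definition rough_sum ::
    "(real \<Rightarrow> real \<Rightarrow> mat3) \<Rightarrow> (real \<Rightarrow> real) \<Rightarrow> (real \<Rightarrow> vec3) \<Rightarrow> (real \<Rightarrow> real) \<Rightarrow> (real \<Rightarrow> vec3)
      \<Rightarrow> real list \<Rightarrow> real" where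
  "rough_sum X2 Y Y' Z Z' p = (\<Sum>k<length p - 1.
     Y (p ! k) * (Z (p ! Suc k) - Z (p ! k)) +
     (\<Sum>a\<in>UNIV. \<Sum>c\<in>UNIV. Y' (p ! k) $ a * Z' (p ! k) $ c * X2 (p ! k) (p ! Suc k) $ a $ c))"

definition rough_integral ::
    "(real \<Rightarrow> real \<Rightarrow> mat3) \<Rightarrow> (real \<Rightarrow> real) \<Rightarrow> (real \<Rightarrow> vec3) \<Rightarrow> (real \<Rightarrow> real) \<Rightarrow> (real \<Rightarrow> vec3)
      \<Rightarrow> real \<Rightarrow> real \<Rightarrow> real" where
  "rough_integral X2 Y Y' Z Z' \<xi> \<eta> =
     (if \<xi> \<le> \<eta> then Lim (mesh_to_0 \<xi> \<eta>) (rough_sum X2 Y Y' Z Z')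
      else - Lim (mesh_to_0 \<eta> \<xi>) (rough_sum X2 Y Y' Z Z'))"


subsection \<open>The vortex filament equation\<close>

definition velocity ::
    "(vec3 \<Rightarrow> mat3) \<Rightarrow> (real \<Rightarrow> real \<Rightarrow> mat3) \<Rightarrow> cpath \<Rightarrow> vec3 \<Rightarrow> vec3" where
  "velocity A X2 = (\<lambda>(Y, Y') x. \<chi> i. \<Sum>j\<in>UNIV.
     rough_integral X2
       (\<lambda>\<eta>. A (x - Y \<eta>) $ i $ j)
       (\<lambda>\<eta>. \<chi> a. - (\<Sum>b\<in>UNIV. partial_deriv b (\<lambda>z. A z $ i $ j) (x - Y \<eta>) * Y' \<eta> $ b $ a))
       (\<lambda>\<eta>. Y \<eta> $ j)
       (\<lambda>\<eta>. Y' \<eta> $ j)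
       0 1)"

definition grad :: "(vec3 \<Rightarrow> vec3) \<Rightarrow> vec3 \<Rightarrow> mat3" where
  "grad V x = (\<chi> i k. partial_deriv k (\<lambda>z. V z $ i) x)"

text \<open>
  The two integral equations, including the existence of the time integrals. The argument \<open>Y\<close>
  is the family of pairs \<open>(Y(t), Y(t)')\<close>.
\<close>

definition is_solution ::
    "real \<Rightarrow> (vec3 \<Rightarrow> mat3) \<Rightarrow> rpath \<Rightarrow> real \<Rightarrow> (real \<Rightarrow> cpath) \<Rightarrow> bool" where
  "is_solution \<gamma> A = (\<lambda>(X, X2) T Y.
     Y \<in> cont_controlled_paths \<gamma> X T \<and>
     (\<forall>t\<in>{0..T}. \<forall>\<xi>\<in>{0..1}.
        ((\<lambda>s. velocity A X2 (Y s) (fst (Y s) \<xi>)) has_integral (fst (Y t) \<xi> - X \<xi>)) {0..t} \<and>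
        ((\<lambda>s. grad (velocity A X2 (Y s)) (fst (Y s) \<xi>) ** snd (Y s) \<xi>)
           has_integral (snd (Y t) \<xi> - mat 1)) {0..t}))"

definition common_existence_time :: "real \<Rightarrow> (vec3 \<Rightarrow> mat3) \<Rightarrow> real \<Rightarrow> real \<Rightarrow> bool" where
  "common_existence_time \<gamma> A r T \<longleftrightarrow>
     0 < T \<and>
     (\<forall>XX\<in>rough_ball \<gamma> r.
        (\<exists>Y. is_solution \<gamma> A XX T Y) \<and>
        (\<forall>Y Z. is_solution \<gamma> A XX T Y \<and> is_solution \<gamma> A XX T Z \<longrightarrow>
           (\<forall>t\<in>{0..T}. \<forall>\<xi>\<in>{0..1}. fst (Y t) \<xi> = fst (Z t) \<xi> \<and> snd (Y t) \<xi> = snd (Z t) \<xi>))) \<and>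
     (\<exists>B::real. \<forall>XX\<in>rough_ball \<gamma> r. \<forall>Y. is_solution \<gamma> A XX T Y \<longrightarrow>
        (\<forall>t\<in>{0..T}. D_norm \<gamma> (fst XX) (Y t) \<le> ennreal B))"

text \<open>
  The choice only fixes the irrelevant values outside \<open>{0..T} \<times> {0..1}\<close>, since the solution is
  unique on this set whenever \<open>T\<close> is a common existence time.
\<close>

definition solution ::
    "real \<Rightarrow> (vec3 \<Rightarrow> mat3) \<Rightarrow> real \<Rightarrow> rpath \<Rightarrow> real \<Rightarrow> cpath" where
  "solution \<gamma> A T XX = (SOME Y. is_solution \<gamma> A XX T Y)"

definition lift_cpath :: "(real \<Rightarrow> real \<Rightarrow> mat3) \<Rightarrow> cpath \<Rightarrow> rpath" where
  "lift_cpath X2 = (\<lambda>(Y, Y'). (Y, \<lambda>\<rho> \<xi>. \<chi> i j.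
     rough_integral X2
       (\<lambda>\<eta>. Y \<eta> $ i - Y \<rho> $ i) (\<lambda>\<eta>. Y' \<eta> $ i)
       (\<lambda>\<eta>. Y \<eta> $ j) (\<lambda>\<eta>. Y' \<eta> $ j) \<rho> \<xi>))"

definition Gamma_map ::
    "real \<Rightarrow> (vec3 \<Rightarrow> mat3) \<Rightarrow> real \<Rightarrow> rpath \<Rightarrow> real \<Rightarrow> rpath" where
  "Gamma_map \<gamma> A T XX t = lift_cpath (snd XX) (solution \<gamma> A T XX t)"

end

theory Submission
  imports Defs
begin

text \<open>
  Every map in the construction of \<open>\<Gamma>\<close> (composition of a controlled path with a smooth function,
  rough integration, the velocity along a controlled path, the lift) is Lipschitz on bounded sets,
  with respect to the rough path and the controlled path together. Since the equations for \<open>Y\<close> and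
  \<open>Y'\<close> are integral equations in time, a Gronwall argument transports this to the flow.

  Boundedness and Lipschitz continuity are carried by one relation: \<open>near M e x y\<close> says that \<open>x\<close> and
  \<open>y\<close> are at most \<open>M\<close> and differ by at most \<open>M * e\<close>. It survives sums, products and limits, so each
  estimate is proved once, for a pair of systems at distance \<open>e\<close>; the constants never depend on \<open>e\<close>.
  The two systems are written \<open>(X, W, Y)\<close> and \<open>(X', W', Y')\<close>, or \<open>(X, W, Y)\<close> and \<open>(U, V, Z)\<close>: a
  path, its second-order process and a controlled path.

  Rough integration is sewing. The germ \<open>F\<^sub>a (Z\<^sub>b - Z\<^sub>a) + F'\<^sub>a Z'\<^sub>a W\<^sub>a\<^sub>b\<close> fails to be additive only by
  terms of order \<open>3\<gamma> > 1\<close> (\<open>germ_defect\<close>), and sums of such a germ over a partition stay close to the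
  germ itself (\<open>sewing_estimate\<close>), whence convergence and, by linearity, the comparison of two
  integrals (\<open>sewing_near\<close>).

  Along a solution the velocity is \<open>\<Sum>\<^sub>j \<integral> A\<^sup>i\<^sup>j(p\<^sub>\<xi> + (Y\<^sub>0 - Y\<^sub>\<eta>)) dY\<^sup>j\<^sub>\<eta>\<close> with \<open>p\<^sub>\<xi> = Y\<^sub>\<xi> - Y\<^sub>0\<close>. Only increments
  of \<open>Y\<close> occur; this is why a distance that ignores translations of the curve controls everything. A
  constant integrates to \<open>0\<close> over a closed curve, so only derivatives of \<open>A\<close> enter. As the integral is
  linear in the integrated field, increments and Taylor remainders of the velocity are integrals of
  increments and Taylor remainders of \<open>A\<close>. A Taylor remainder costs two derivatives, its comparison
  between the two systems a third, and integration along one curve two more: the five derivatives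
  bounded by \<open>\<parallel>\<nabla>A\<parallel>\<^sub>4\<close>. The outcome (\<open>near_velocity\<close>) is that the velocity along \<open>Y\<close> is again
  controlled, with derivative \<open>\<nabla>V(Y) Y'\<close>, and depends on the data in a Lipschitz way.

  For Gronwall, let \<open>\<delta>\<close> bound the distance of the initial rough paths. If the solutions differ by at
  most \<open>c e\<^sup>\<mu>\<^sup>t\<close> for some \<open>c \<ge> \<delta>\<close> and a large \<open>\<mu>\<close>, integrating the velocity estimate improves \<open>c\<close> to
  \<open>c / 2\<close> (\<open>solutions_near_improve\<close>); the a priori bound on \<open>\<parallel>Y\<parallel>\<^sub>D\<close> starts the iteration, which
  ends at \<open>\<delta>\<close>. The lift preserves closeness (\<open>near_lift\<close>). The same lemma, applied to
  one solution at two times, gives continuity in time.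
\<close>

section \<open>Bounding two quantities together with their difference\<close>

text \<open>The parameter \<open>e\<close> is the distance between the systems that \<open>x\<close> and \<open>y\<close> come from. Measuring the
  difference in units of the bound \<open>M\<close> lets one constant serve for both through long products.\<close>

definition near :: "real \<Rightarrow> real \<Rightarrow> real \<Rightarrow> real \<Rightarrow> bool" where
  "near M e x y \<longleftrightarrow> \<bar>x\<bar> \<le> M \<and> \<bar>y\<bar> \<le> M \<and> \<bar>x - y\<bar> \<le> M * e"

lemma near_bound_nonneg: "near M e x y \<Longrightarrow> 0 \<le> M"
  unfolding near_def by linarith

lemma near_zero [simp]: "0 \<le> M \<Longrightarrow> 0 \<le> e \<Longrightarrow> near M e 0 0"
  by (simp add: near_def)

lemma near_sym: "near M e x y \<Longrightarrow> near M e y x"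
  unfolding near_def by (simp add: abs_minus_commute)

lemma near_self: "near M e x y \<Longrightarrow> near M 0 x x"
  unfolding near_def by simp

lemma near_larger: "near M d x y \<Longrightarrow> d \<le> e \<Longrightarrow> near M e x y"
  using near_bound_nonneg[of M d x y] mult_left_mono[of d e M] by (auto simp: near_def)

lemma near_weaken:
  assumes "near M e x y" "M \<le> N" "0 \<le> e"
  shows "near N e x y"
  using assms mult_right_mono[of M N e] by (auto simp: near_def)

lemma near_add: "near M e x y \<Longrightarrow> near N e x' y' \<Longrightarrow> near (M + N) e (x + x') (y + y')"
  unfolding near_def by (simp add: algebra_simps) linarith

lemma near_uminus: "near M e x y \<Longrightarrow> near M e (- x) (- y)"
  unfolding near_def by linarith

lemma near_diff: "near M e x y \<Longrightarrow> near N e x' y' \<Longrightarrow> near (M + N) e (x - x') (y - y')"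
  using near_add[OF _ near_uminus] by fastforce

text \<open>The factor \<open>2\<close> pays for the two terms of the product rule.\<close>

lemma near_mult:
  assumes "near M e x y" "near N e x' y'"
  shows "near (2 * M * N) e (x * x') (y * y')"
proof -
  have 1: "\<bar>x * x'\<bar> \<le> M * N" "\<bar>y * y'\<bar> \<le> M * N"
    using assms by (auto simp: near_def abs_mult intro!: mult_mono)
  have "x * x' - y * y' = x * (x' - y') + (x - y) * y'" by (simp add: algebra_simps)
  then have "\<bar>x * x' - y * y'\<bar> \<le> \<bar>x\<bar> * \<bar>x' - y'\<bar> + \<bar>x - y\<bar> * \<bar>y'\<bar>"
    by (metis abs_mult abs_triangle_ineq)
  also have "\<dots> \<le> M * (N * e) + (M * e) * N"
    using assms by (intro add_mono mult_mono) (auto simp: near_def)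
  finally have "\<bar>x * x' - y * y'\<bar> \<le> 2 * M * N * e" by (simp add: algebra_simps)
  moreover have "0 \<le> M * N"
    using assms by (blast intro: mult_nonneg_nonneg near_bound_nonneg)
  then have "M * N \<le> 2 * M * N" by simp
  ultimately show ?thesis using 1 unfolding near_def by linarith
qed

lemma near_sum:
  assumes "\<And>i. i \<in> I \<Longrightarrow> near M e (f i) (g i)"
  shows "near (real (card I) * M) e (\<Sum>i\<in>I. f i) (\<Sum>i\<in>I. g i)"
proof -
  have "\<bar>\<Sum>i\<in>I. h i\<bar> \<le> real (card I) * c" if "\<And>i. i \<in> I \<Longrightarrow> \<bar>h i\<bar> \<le> c" for h :: "_ \<Rightarrow> real" and c :: real
    using sum_abs[of h I] sum_bounded_above[of I "\<lambda>i. \<bar>h i\<bar>" c] that by (meson order_trans)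
  from this[of f M] this[of g M] this[of "\<lambda>i. f i - g i" "M * e"] show ?thesis
    using assms by (simp add: near_def sum_subtractf)
qed

lemma near_sum3:
  fixes f g :: "3 \<Rightarrow> real"
  assumes "\<And>i. near M e (f i) (g i)"
  shows "near (3 * M) e (\<Sum>i\<in>UNIV. f i) (\<Sum>i\<in>UNIV. g i)"
  using near_sum[of UNIV M e f g] assms by simp

lemma near_tendsto:
  assumes "(f \<longlongrightarrow> x) F" "(g \<longlongrightarrow> y) F" "F \<noteq> bot" "\<forall>\<^sub>F p in F. near M e (f p) (g p)"
  shows "near M e x y"
proof -
  have 1: "\<bar>x\<bar> \<le> M"
    by (rule tendsto_upperbound[OF tendsto_rabs[OF assms(1)] _ assms(3)])
       (use assms(4) in \<open>auto simp: near_def elim: eventually_mono\<close>)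
  have 2: "\<bar>y\<bar> \<le> M"
    by (rule tendsto_upperbound[OF tendsto_rabs[OF assms(2)] _ assms(3)])
       (use assms(4) in \<open>auto simp: near_def elim: eventually_mono\<close>)
  have 3: "\<bar>x - y\<bar> \<le> M * e"
    by (rule tendsto_upperbound[OF tendsto_rabs[OF tendsto_diff[OF assms(1,2)]] _ assms(3)])
       (use assms(4) in \<open>auto simp: near_def elim: eventually_mono\<close>)
  show ?thesis using 1 2 3 by (simp add: near_def)
qed

section \<open>Sewing\<close>

definition chain_sum :: "(real \<Rightarrow> real \<Rightarrow> real) \<Rightarrow> real list \<Rightarrow> real" where
  "chain_sum \<Xi> p = (\<Sum>k<length p - 1. \<Xi> (p ! k) (p ! Suc k))"

definition finer_than :: "real \<Rightarrow> real list \<Rightarrow> bool" where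
  "finer_than \<delta> p \<longleftrightarrow> (\<forall>k. Suc k < length p \<longrightarrow> p ! Suc k - p ! k < \<delta>)"

lemma chain_sum_single [simp]: "chain_sum \<Xi> [a] = 0"
  by (simp add: chain_sum_def)

lemma chain_sum_Cons_Cons [simp]:
  "chain_sum \<Xi> (a # b # p) = \<Xi> a b + chain_sum \<Xi> (b # p)"
  by (simp add: chain_sum_def sum.lessThan_Suc_shift del: sum.lessThan_Suc)

lemma chain_sum_append:
  assumes "p \<noteq> []" "q \<noteq> []"
  shows "chain_sum \<Xi> (p @ q) = chain_sum \<Xi> p + \<Xi> (last p) (hd q) + chain_sum \<Xi> q"
  using assms(1)
proof (induction p rule: induct_list012)
  case (2 x)
  then show ?case using assms(2) by (cases q) auto
qed auto

lemma chain_sum_glue: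
  "chain_sum \<Xi> (p @ c # q) = chain_sum \<Xi> (p @ [c]) + chain_sum \<Xi> (c # q)"
proof (cases "p = []")
  case False
  then show ?thesis using chain_sum_append[of p "c # q" \<Xi>] chain_sum_append[of p "[c]" \<Xi>] by simp
qed simp

lemma finer_than_Cons_Cons [simp]:
  "finer_than \<delta> (a # b # p) \<longleftrightarrow> b - a < \<delta> \<and> finer_than \<delta> (b # p)"
  unfolding finer_than_def by (auto simp: nth_Cons split: nat.splits)

lemma finer_than_single [simp]: "finer_than \<delta> [a]"
  by (simp add: finer_than_def)

lemma finer_than_glue:
  "finer_than \<delta> (p @ [c]) \<Longrightarrow> finer_than \<delta> (c # q) \<Longrightarrow> finer_than \<delta> (p @ c # q)"
  by (induction p rule: induct_list012) auto

lemma partitions_le: "p \<in> partitions a b \<Longrightarrow> x \<in> set p \<Longrightarrow> a \<le> x \<and> x \<le> b"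
proof -
  have "sorted_wrt (<) p \<Longrightarrow> x \<in> set p \<Longrightarrow> hd p \<le> x \<and> x \<le> last p" for p :: "real list"
  proof (induction p)
    case (Cons y p)
    then show ?case by (cases "p = []") (auto intro: less_imp_le)
  qed simp
  then show "p \<in> partitions a b \<Longrightarrow> x \<in> set p \<Longrightarrow> a \<le> x \<and> x \<le> b"
    by (auto simp: partitions_def)
qed

lemma partitions_Cons_Cons:
  "a # c # p \<in> partitions a b \<Longrightarrow> a < c \<and> c # p \<in> partitions c b"
  by (auto simp: partitions_def)

lemma partitions_trivial: "p \<in> partitions a a \<Longrightarrow> p = [a]"
proof -
  assume p: "p \<in> partitions a a"
  then obtain q where q: "p = a # q" by (cases p) (auto simp: partitions_def)
  have "q = []"
  proof (rule ccontr)
    assume "q \<noteq> []"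
    then have "last q \<in> set q" "last q = a" using p q by (auto simp: partitions_def)
    then show False using p q by (auto simp: partitions_def)
  qed
  then show ?thesis using q by simp
qed

lemma partitions_split:
  assumes "p @ c # q \<in> partitions a b"
  shows "p @ [c] \<in> partitions a c" "c # q \<in> partitions c b"
  using assms by (auto simp: partitions_def sorted_wrt_append hd_append split: if_splits)

lemma partitions_glue:
  assumes "p @ [c] \<in> partitions a c" "c # q \<in> partitions c b"
  shows "p @ c # q \<in> partitions a b"
proof -
  have "x < y" if "x \<in> set p" "y \<in> set q" for x y
  proof -
    have "x < c" using assms(1) that by (auto simp: partitions_def sorted_wrt_append)
    moreover have "c < y" using assms(2) that by (auto simp: partitions_def)
    ultimately show ?thesis by simp
  qed
  then show ?thesis using assms
    by (auto simp: partitions_def sorted_wrt_append hd_append split: if_splits)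
qed

text \<open>The fixed point of the recursion \<open>C = 2 * C * (1/2) powr \<theta> + 2\<close> that the bisection in
  \<open>sewing_estimate\<close> leads to; it exists because \<open>\<theta> > 1\<close>.\<close>

definition sewing_const :: "real \<Rightarrow> real" where
  "sewing_const \<theta> = 2 / (1 - 2 powr (1 - \<theta>))"

lemma sewing_const_fixpoint:
  assumes "\<theta> > 1"
  shows "0 < sewing_const \<theta>" "2 * sewing_const \<theta> * (1/2) powr \<theta> + 2 = sewing_const \<theta>"
proof -
  have lt: "(2::real) powr (1 - \<theta>) < 1" using assms powr_less_one[of 2 "1-\<theta>"] by simp
  then show "0 < sewing_const \<theta>" by (simp add: sewing_const_def)
  have ne: "1 - 2 powr (1 - \<theta>) \<noteq> (0::real)" using lt by linarith
  have "2 * (1/2) powr \<theta> = (2::real) powr (1 - \<theta>)"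
    by (simp add: powr_diff powr_divide)
  then have "2 * sewing_const \<theta> * (1/2) powr \<theta> = sewing_const \<theta> * 2 powr (1 - \<theta>)"
    by (simp add: mult_ac)
  also have "\<dots> = sewing_const \<theta> - 2"
    using ne by (simp add: sewing_const_def divide_simps)
  finally show "2 * sewing_const \<theta> * (1/2) powr \<theta> + 2 = sewing_const \<theta>" by simp
qed

definition defect_bound :: "real \<Rightarrow> real \<Rightarrow> (real \<Rightarrow> real \<Rightarrow> real) \<Rightarrow> bool" where
  "defect_bound \<theta> K \<Xi> \<longleftrightarrow> (\<forall>a u b. 0 \<le> a \<and> a \<le> u \<and> u \<le> b \<and> b \<le> 1 \<longrightarrow>
     \<bar>\<Xi> a b - \<Xi> a u - \<Xi> u b\<bar> \<le> K * (b - a) powr \<theta>)"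

lemma defect_bound_diagonal:
  assumes "defect_bound \<theta> K \<Xi>" "0 \<le> a" "a \<le> 1"
  shows "\<Xi> a a = 0"
proof -
  have "\<bar>\<Xi> a a - \<Xi> a a - \<Xi> a a\<bar> \<le> K * (a - a) powr \<theta>"
    using assms unfolding defect_bound_def by blast
  then show ?thesis by simp
qed

text \<open>Cut the partition after its last point in the left half of the interval. Both remaining pieces
  have at most half the length, so the induction hypothesis contributes \<open>2 * C * (1/2) powr \<theta>\<close>, and
  reassembling the three pieces takes two additivity defects.\<close>

lemma sewing_estimate:
  assumes \<Xi>: "defect_bound \<theta> K \<Xi>" and "\<theta> > 1" "0 \<le> K"
    and "p \<in> partitions a b" "0 \<le> a" "b \<le> 1"
  shows "\<bar>chain_sum \<Xi> p - \<Xi> a b\<bar> \<le> sewing_const \<theta> * K * (b - a) powr \<theta>"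
  using assms(4-6)
proof (induction "length p" arbitrary: p a b rule: less_induct)
  case less
  let ?C = "sewing_const \<theta>"
  note C = sewing_const_fixpoint[OF \<open>\<theta> > 1\<close>]
  have ab: "a \<le> b" using less.prems partitions_le[of p a b a] by (auto simp: partitions_def)
  show ?case
  proof (cases "a = b")
    case True
    then have "p = [a]" using less.prems partitions_trivial by blast
    then show ?thesis using True less.prems defect_bound_diagonal[OF \<Xi>, of a] by simp
  next
    case False
    let ?P = "\<lambda>t. t - a \<le> (b - a) / 2"
    define q where "q = takeWhile ?P p"
    define s where "s = dropWhile ?P p"
    have pqs: "p = q @ s" by (simp add: q_def s_def)
    have hdp: "hd p = a" "last p = b" "p \<noteq> []" "sorted_wrt (<) p"
      using less.prems by (auto simp: partitions_def)
    have q: "q \<noteq> []" using hdp ab by (cases p) (auto simp: q_def)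
    have "b \<in> set p" using hdp by (metis last_in_set)
    moreover have "\<not> ?P b" using False ab by simp
    ultimately have s: "s \<noteq> []" unfolding s_def using dropWhile_eq_Nil_conv[of ?P p] by blast
    then have hds: "\<not> ?P (hd s)" unfolding s_def using hd_dropWhile[of ?P p] by simp
    have lq: "?P (last q)" using q last_in_set[OF q] set_takeWhileD[of "last q" ?P p] by (simp add: q_def)
    have qp: "q \<in> partitions a (last q)" "s \<in> partitions (hd s) b"
      using hdp q s pqs by (auto simp: partitions_def sorted_wrt_append)
    have m: "a \<le> last q" "last q < hd s" "hd s \<le> b"
      using partitions_le[OF less.prems(1)] last_in_set[OF q] hd_in_set[OF s] pqs hdp(4)
      by (auto simp: sorted_wrt_append)
    have half: "x powr \<theta> \<le> (1/2) powr \<theta> * (b - a) powr \<theta>" if "0 \<le> x" "x \<le> (b - a) / 2" for x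
    proof -
      have "x powr \<theta> \<le> ((1/2) * (b - a)) powr \<theta>"
        using that \<open>\<theta> > 1\<close> by (intro powr_mono2) auto
      also have "\<dots> = (1/2) powr \<theta> * (b - a) powr \<theta>"
        by (rule powr_mult)
      finally show ?thesis .
    qed
    have CK: "0 \<le> ?C * K" using C assms by simp
    have "\<bar>chain_sum \<Xi> q - \<Xi> a (last q)\<bar> \<le> ?C * K * (last q - a) powr \<theta>"
      by (rule less.hyps) (use qp s pqs less.prems m in auto)
    also have "\<dots> \<le> ?C * K * ((1/2) powr \<theta> * (b - a) powr \<theta>)"
      using CK lq m by (intro mult_left_mono half) auto
    finally have 1: "\<bar>chain_sum \<Xi> q - \<Xi> a (last q)\<bar> \<le> ?C * K * ((1/2) powr \<theta> * (b - a) powr \<theta>)" .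
    have "\<bar>chain_sum \<Xi> s - \<Xi> (hd s) b\<bar> \<le> ?C * K * (b - hd s) powr \<theta>"
      by (rule less.hyps) (use qp q pqs less.prems m in auto)
    also have "\<dots> \<le> ?C * K * ((1/2) powr \<theta> * (b - a) powr \<theta>)"
      using CK hds m by (intro mult_left_mono half) auto
    finally have 2: "\<bar>chain_sum \<Xi> s - \<Xi> (hd s) b\<bar> \<le> ?C * K * ((1/2) powr \<theta> * (b - a) powr \<theta>)" .
    have 3: "\<bar>\<Xi> a b - \<Xi> a (last q) - \<Xi> (last q) b\<bar> \<le> K * (b - a) powr \<theta>"
      using \<Xi> m less.prems unfolding defect_bound_def by auto
    have "\<bar>\<Xi> (last q) b - \<Xi> (last q) (hd s) - \<Xi> (hd s) b\<bar> \<le> K * (b - last q) powr \<theta>"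
      using \<Xi> m less.prems unfolding defect_bound_def by auto
    also have "\<dots> \<le> K * (b - a) powr \<theta>"
      using m assms by (intro mult_left_mono powr_mono2) auto
    finally have 4: "\<bar>\<Xi> (last q) b - \<Xi> (last q) (hd s) - \<Xi> (hd s) b\<bar> \<le> K * (b - a) powr \<theta>" .
    have 5: "chain_sum \<Xi> p = chain_sum \<Xi> q + \<Xi> (last q) (hd s) + chain_sum \<Xi> s"
      unfolding pqs by (rule chain_sum_append[OF q s])
    have "\<bar>chain_sum \<Xi> p - \<Xi> a b\<bar> \<le> 2 * (?C * K * ((1/2) powr \<theta> * (b - a) powr \<theta>)) + 2 * (K * (b - a) powr \<theta>)"
      unfolding 5 using 1 2 3 4 by linarith
    also have "\<dots> = (2 * ?C * (1/2) powr \<theta> + 2) * K * (b - a) powr \<theta>"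
      by (simp add: algebra_simps)
    finally show ?thesis unfolding C(2) .
  qed
qed

text \<open>Apply the estimate on each interval of the coarse partition: a factor \<open>\<theta> - 1\<close> of the exponent is
  absorbed by the mesh, and the remaining lengths add up.\<close>

lemma sewing_refinement:
  assumes \<Xi>: "defect_bound \<theta> K \<Xi>" and "\<theta> > 1" "0 \<le> K" "0 < \<delta>"
    and "p \<in> partitions a b" "q \<in> partitions a b" "set p \<subseteq> set q" "finer_than \<delta> p" "0 \<le> a" "b \<le> 1"
  shows "\<bar>chain_sum \<Xi> q - chain_sum \<Xi> p\<bar> \<le> sewing_const \<theta> * K * \<delta> powr (\<theta> - 1) * (b - a)"
  using assms(5-10)
proof (induction p arbitrary: a q rule: induct_list012)
  case 1
  then show ?case by (simp add: partitions_def)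
next
  case (2 x)
  then have "x = a" "a = b" by (auto simp: partitions_def)
  then show ?case using 2 partitions_trivial[of q a] by auto
next
  case (3 a' c l)
  let ?C = "sewing_const \<theta>"
  have [simp]: "a' = a" using "3.prems" by (simp add: partitions_def)
  have l: "a < c" "c # l \<in> partitions c b"
    using partitions_Cons_Cons[of a c l b] "3.prems"(1) by simp_all
  obtain q1 q2 where q: "q = q1 @ c # q2"
    using "3.prems"(3) by (auto simp: in_set_conv_decomp)
  note qs = partitions_split[OF "3.prems"(2)[unfolded q]]
  have "set (c # l) \<subseteq> set (c # q2)"
  proof
    fix x assume x: "x \<in> set (c # l)"
    then have "x \<ge> c" using partitions_le[OF l(2)] by blast
    moreover have "x \<in> set q" using x "3.prems"(3) by auto
    moreover have "y < c" if "y \<in> set q1" for y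
      using qs(1) that by (auto simp: partitions_def sorted_wrt_append)
    ultimately show "x \<in> set (c # q2)" unfolding q by force
  qed
  then have IH: "\<bar>chain_sum \<Xi> (c # q2) - chain_sum \<Xi> (c # l)\<bar> \<le> ?C * K * \<delta> powr (\<theta> - 1) * (b - c)"
    using "3.IH"(2)[OF l(2) qs(2)] "3.prems" l(1) by simp
  have cb: "c \<le> b" using partitions_le[OF l(2), of c] by simp
  have "\<bar>chain_sum \<Xi> (q1 @ [c]) - \<Xi> a c\<bar> \<le> ?C * K * (c - a) powr \<theta>"
    by (rule sewing_estimate[OF \<Xi>]) (use assms qs "3.prems" cb in auto)
  also have "(c - a) powr \<theta> = (c - a) powr (\<theta> - 1) * (c - a)"
    using l(1) by (simp add: powr_diff)
  also have "?C * K * ((c - a) powr (\<theta> - 1) * (c - a)) \<le> ?C * K * (\<delta> powr (\<theta> - 1) * (c - a))"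
    using l(1) "3.prems"(4) assms sewing_const_fixpoint[of \<theta>]
    by (intro mult_left_mono mult_right_mono powr_mono2) auto
  finally have "\<bar>chain_sum \<Xi> (q1 @ [c]) - \<Xi> a c\<bar> \<le> ?C * K * \<delta> powr (\<theta> - 1) * (c - a)"
    by (simp add: mult.assoc)
  moreover have "?C * K * \<delta> powr (\<theta> - 1) * (b - a)
      = ?C * K * \<delta> powr (\<theta> - 1) * (b - c) + ?C * K * \<delta> powr (\<theta> - 1) * (c - a)"
    by (simp add: algebra_simps)
  ultimately show ?case
    using IH unfolding q chain_sum_glue[of \<Xi> q1 c q2] by simp
qed

lemma eventually_mesh_to_0:
  "eventually P (mesh_to_0 a b) \<longleftrightarrow> (\<exists>\<delta>>0. \<forall>p\<in>partitions a b. finer_than \<delta> p \<longrightarrow> P p)"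
proof -
  have "eventually P (mesh_to_0 a b) \<longleftrightarrow> (\<exists>\<delta>\<in>{0<..}. eventually P (principal
     {p \<in> partitions a b. \<forall>k. Suc k < length p \<longrightarrow> p ! Suc k - p ! k < \<delta>}))"
    unfolding mesh_to_0_def
  proof (rule eventually_INF_base)
    fix d e :: real assume "d \<in> {0<..}" "e \<in> {0<..}"
    then show "\<exists>x\<in>{0<..}. principal {p \<in> partitions a b. \<forall>k. Suc k < length p \<longrightarrow> p ! Suc k - p ! k < x}
        \<le> inf (principal {p \<in> partitions a b. \<forall>k. Suc k < length p \<longrightarrow> p ! Suc k - p ! k < d})
            (principal {p \<in> partitions a b. \<forall>k. Suc k < length p \<longrightarrow> p ! Suc k - p ! k < e})"
      by (intro bexI[of _ "min d e"]) auto
  qed auto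
  then show ?thesis unfolding eventually_principal finer_than_def by (simp add: Bex_def imp_conjL Ball_def)
qed

lemma filterlim_mesh_to_0:
  "filterlim p (mesh_to_0 a b) F \<longleftrightarrow>
     (\<forall>\<delta>>0. \<forall>\<^sub>F n in F. p n \<in> partitions a b \<and> finer_than \<delta> (p n))"
  unfolding mesh_to_0_def filterlim_INF filterlim_principal finer_than_def by auto

lemma fine_partition_exists:
  assumes "a \<le> b" "0 < \<delta>"
  shows "\<exists>p\<in>partitions a b. finer_than \<delta> p"
proof (cases "a = b")
  case True
  then show ?thesis by (intro bexI[of _ "[a]"]) (auto simp: partitions_def)
next
  case False
  obtain n :: nat where n: "(b - a) / \<delta> < real n" using reals_Archimedean2 by blast
  have n0: "0 < n" using n False assms by (metis diff_gt_0_iff_gt divide_pos_pos gr0I less_eq_real_def of_nat_0 order_less_asym)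
  define p where "p = map (\<lambda>k. a + real k * ((b - a) / real n)) [0..<Suc n]"
  have "p \<in> partitions a b"
    unfolding partitions_def p_def using n0 False assms
    by (auto simp: sorted_wrt_map sorted_wrt_iff_nth_less hd_map last_map divide_strict_right_mono simp del: upt_Suc)
  moreover have "finer_than \<delta> p"
  proof -
    have "(b - a) / real n < \<delta>" using n n0 assms(2) by (simp add: field_simps)
    then show ?thesis unfolding p_def finer_than_def by (auto simp: distrib_right diff_divide_distrib add_divide_distrib simp del: upt_Suc)
  qed
  ultimately show ?thesis by blast
qed

lemma mesh_to_0_neq_bot: "a \<le> b \<Longrightarrow> mesh_to_0 a b \<noteq> bot"
  unfolding trivial_limit_def eventually_mesh_to_0 using fine_partition_exists[of a b] by blast

lemma fine_partition_sequence:
  assumes "a \<le> b"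
  obtains p where "\<And>n. p n \<in> partitions a b" "\<And>n. finer_than (1 / real (Suc n)) (p n)"
    "filterlim p (mesh_to_0 a b) sequentially"
proof -
  have "\<exists>p. \<forall>n. p n \<in> partitions a b \<and> finer_than (1 / real (Suc n)) (p n)"
    using fine_partition_exists[OF assms] by (intro choice allI) (metis of_nat_0_less_iff zero_less_Suc zero_less_divide_1_iff)
  then obtain p where p: "p n \<in> partitions a b" "finer_than (1 / real (Suc n)) (p n)" for n
    by blast
  moreover have "filterlim p (mesh_to_0 a b) sequentially"
    unfolding filterlim_mesh_to_0
  proof (intro allI impI)
    fix \<delta> :: real assume "\<delta> > 0"
    then have "\<forall>\<^sub>F n in sequentially. 1 / real (Suc n) < \<delta>"
      using LIMSEQ_inverse_real_of_nat order_tendstoD(2) by (fastforce simp: inverse_eq_divide)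
    then show "\<forall>\<^sub>F n in sequentially. p n \<in> partitions a b \<and> finer_than \<delta> (p n)"
      using p by (auto simp: finer_than_def elim!: eventually_mono intro: less_trans)
  qed
  ultimately show ?thesis using that by blast
qed

text \<open>Any two fine partitions have a common refinement, so their sums are close to each other.\<close>

lemma sewing_converges:
  assumes \<Xi>: "defect_bound \<theta> K \<Xi>" and "\<theta> > 1" "0 \<le> K" "0 \<le> a" "a \<le> b" "b \<le> 1"
  shows "(chain_sum \<Xi> \<longlongrightarrow> Lim (mesh_to_0 a b) (chain_sum \<Xi>)) (mesh_to_0 a b)"
proof -
  let ?C = "sewing_const \<theta>"
  define B where "B \<delta> = 2 * (?C * K * \<delta> powr (\<theta> - 1) * (b - a))" for \<delta>
  have B: "(B \<longlongrightarrow> 0) (at_right 0)"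
  proof -
    have "((\<lambda>\<delta>::real. \<delta> powr (\<theta> - 1)) \<longlongrightarrow> 0 powr (\<theta> - 1)) (at_right 0)"
      by (rule tendsto_powr2[OF tendsto_ident_at tendsto_const])
         (use assms in \<open>simp_all add: eventually_at_filter\<close>)
    then have "(B \<longlongrightarrow> 2 * (?C * K * 0 powr (\<theta> - 1) * (b - a))) (at_right 0)"
      unfolding B_def by (intro tendsto_mult tendsto_const)
    then show ?thesis by simp
  qed
  have close: "\<bar>chain_sum \<Xi> p - chain_sum \<Xi> q\<bar> \<le> B \<delta>"
    if p: "p \<in> partitions a b" "finer_than \<delta> p" and q: "q \<in> partitions a b" "finer_than \<delta> q" "\<delta> > 0" for p q \<delta>
  proof -
    define s where "s = sorted_list_of_set (set p \<union> set q)"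
    have sset: "set s = set p \<union> set q" by (simp add: s_def)
    have ne: "p \<noteq> []" using p by (auto simp: partitions_def)
    have sne: "s \<noteq> []" using sset ne by fastforce
    have srt: "sorted_wrt (<) s" unfolding s_def by simp
    have "hd p = a" "last p = b" using p by (simp_all add: partitions_def)
    then have mem: "a \<in> set s" "b \<in> set s" unfolding sset using hd_in_set[OF ne] last_in_set[OF ne] by auto
    have "hd s \<in> set s" "last s \<in> set s" using sne by auto
    then have "a \<le> hd s" "last s \<le> b" using partitions_le p q sset by blast+
    moreover have "s \<in> partitions (hd s) (last s)" using sne srt by (simp add: partitions_def)
    then have "hd s \<le> a" "b \<le> last s" using mem partitions_le by blast+
    ultimately have "s \<in> partitions a b" using sne srt by (simp add: partitions_def)
    then have "\<bar>chain_sum \<Xi> s - chain_sum \<Xi> p\<bar> \<le> ?C * K * \<delta> powr (\<theta> - 1) * (b - a)"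
      "\<bar>chain_sum \<Xi> s - chain_sum \<Xi> q\<bar> \<le> ?C * K * \<delta> powr (\<theta> - 1) * (b - a)"
      using assms p q sset by (auto intro!: sewing_refinement)
    then show ?thesis unfolding B_def by linarith
  qed
  obtain p where p: "\<And>n. p n \<in> partitions a b" "\<And>n. finer_than (1 / real (Suc n)) (p n)"
    "filterlim p (mesh_to_0 a b) sequentially"
    using fine_partition_sequence[OF \<open>a \<le> b\<close>] by metis
  have small: "\<exists>\<delta>>0. B \<delta> < e" if "e > 0" for e
  proof -
    have "\<forall>\<^sub>F \<delta> in at_right 0. B \<delta> < e" using B that order_tendstoD(2) by blast
    then obtain d where "d > 0" "\<And>y. y > 0 \<Longrightarrow> y < d \<Longrightarrow> B y < e" by (auto simp: eventually_at_right_field)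
    then show ?thesis by (intro exI[of _ "d/2"]) auto
  qed
  have ev: "\<forall>\<^sub>F n in sequentially. finer_than \<delta> (p n)" if "\<delta> > 0" for \<delta>
    using p(3) that unfolding filterlim_mesh_to_0 by (auto elim: eventually_mono)
  have "Cauchy (\<lambda>n. chain_sum \<Xi> (p n))"
  proof (rule metric_CauchyI)
    fix e :: real assume "e > 0"
    then obtain \<delta> where \<delta>: "\<delta> > 0" "B \<delta> < e" using small by blast
    then obtain N where "\<And>n. n \<ge> N \<Longrightarrow> finer_than \<delta> (p n)"
      using ev unfolding eventually_sequentially by blast
    then show "\<exists>N. \<forall>m\<ge>N. \<forall>n\<ge>N. dist (chain_sum \<Xi> (p m)) (chain_sum \<Xi> (p n)) < e"
      using close[OF p(1) _ p(1)] \<delta> unfolding dist_real_def by (meson le_less_trans)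
  qed
  then obtain I where I: "(\<lambda>n. chain_sum \<Xi> (p n)) \<longlonglongrightarrow> I"
    using Cauchy_convergent convergent_def by blast
  have "(chain_sum \<Xi> \<longlongrightarrow> I) (mesh_to_0 a b)"
  proof (rule tendstoI)
    fix e :: real assume "e > 0"
    then obtain \<delta> where \<delta>: "\<delta> > 0" "B \<delta> < e" using small by blast
    have "dist (chain_sum \<Xi> q) I < e" if q: "q \<in> partitions a b" "finer_than \<delta> q" for q
    proof -
      have "\<bar>chain_sum \<Xi> q - I\<bar> \<le> B \<delta>"
        by (rule tendsto_upperbound[OF tendsto_rabs[OF tendsto_diff[OF tendsto_const I]]])
           (use ev[OF \<delta>(1)] close[OF q p(1) _ \<delta>(1)] in \<open>auto elim: eventually_mono\<close>)
      then show ?thesis using \<delta> by (simp add: dist_real_def)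
    qed
    then show "\<forall>\<^sub>F q in mesh_to_0 a b. dist (chain_sum \<Xi> q) I < e"
      unfolding eventually_mesh_to_0 using \<delta> by blast
  qed
  then show ?thesis using tendsto_Lim[OF mesh_to_0_neq_bot[OF \<open>a \<le> b\<close>]] by metis
qed

lemma sewing_additive:
  assumes \<Xi>: "defect_bound \<theta> K \<Xi>" and "\<theta> > 1" "0 \<le> K" "0 \<le> a" "a \<le> c" "c \<le> b" "b \<le> 1"
  shows "Lim (mesh_to_0 a b) (chain_sum \<Xi>)
    = Lim (mesh_to_0 a c) (chain_sum \<Xi>) + Lim (mesh_to_0 c b) (chain_sum \<Xi>)"
proof -
  obtain p where p: "\<And>n. p n \<in> partitions a c" "\<And>n. finer_than (1 / real (Suc n)) (p n)"
    "filterlim p (mesh_to_0 a c) sequentially"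
    using fine_partition_sequence[OF \<open>a \<le> c\<close>] by metis
  obtain q where q: "\<And>n. q n \<in> partitions c b" "\<And>n. finer_than (1 / real (Suc n)) (q n)"
    "filterlim q (mesh_to_0 c b) sequentially"
    using fine_partition_sequence[OF \<open>c \<le> b\<close>] by metis
  define s where "s n = butlast (p n) @ q n" for n
  have pe: "p n = butlast (p n) @ [c]" for n
    using p(1)[of n] by (metis (mono_tags, lifting) append_butlast_last_id mem_Collect_eq partitions_def)
  have qe: "q n = c # tl (q n)" for n
    using q(1)[of n] by (cases "q n") (auto simp: partitions_def)
  have "filterlim s (mesh_to_0 a b) sequentially"
    unfolding filterlim_mesh_to_0
  proof (intro allI impI)
    fix \<delta> :: real assume "\<delta> > 0"
    then have "\<forall>\<^sub>F n in sequentially. finer_than \<delta> (p n) \<and> finer_than \<delta> (q n)"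
      using p(3) q(3) unfolding filterlim_mesh_to_0 by (auto simp: eventually_conj_iff)
    then show "\<forall>\<^sub>F n in sequentially. s n \<in> partitions a b \<and> finer_than \<delta> (s n)"
    proof eventually_elim
      case (elim n)
      then show ?case unfolding s_def
        using finer_than_glue[of \<delta> "butlast (p n)" c "tl (q n)"] partitions_glue[of "butlast (p n)" c a "tl (q n)" b]
          pe[of n] qe[of n] p(1)[of n] q(1)[of n] by metis
    qed
  qed
  then have 1: "(\<lambda>n. chain_sum \<Xi> (s n)) \<longlonglongrightarrow> Lim (mesh_to_0 a b) (chain_sum \<Xi>)"
    by (intro filterlim_compose[OF sewing_converges[OF \<Xi>]]) (use assms in auto)
  have 2: "(\<lambda>n. chain_sum \<Xi> (p n)) \<longlonglongrightarrow> Lim (mesh_to_0 a c) (chain_sum \<Xi>)"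
    by (rule filterlim_compose[OF sewing_converges[OF \<Xi>] p(3)]) (use assms in auto)
  have 3: "(\<lambda>n. chain_sum \<Xi> (q n)) \<longlonglongrightarrow> Lim (mesh_to_0 c b) (chain_sum \<Xi>)"
    by (rule filterlim_compose[OF sewing_converges[OF \<Xi>] q(3)]) (use assms in auto)
  have "chain_sum \<Xi> (s n) = chain_sum \<Xi> (p n) + chain_sum \<Xi> (q n)" for n
    unfolding s_def using chain_sum_glue[of \<Xi> "butlast (p n)" c "tl (q n)"] pe[of n] qe[of n] by metis
  then show ?thesis using LIMSEQ_unique[OF 1] tendsto_add[OF 2 3] by simp
qed

text \<open>Sums over partitions are linear in the germ, so the sewing estimate for \<open>\<Xi>\<close>, \<open>\<Xi>'\<close> and
  \<open>\<Xi> - \<Xi>'\<close> compares the two limits.\<close>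

lemma sewing_near:
  assumes "\<theta> > 1" "0 \<le> K" "0 \<le> e" "0 \<le> a" "a \<le> b" "b \<le> 1"
    and near: "\<And>a u b. 0 \<le> a \<Longrightarrow> a \<le> u \<Longrightarrow> u \<le> b \<Longrightarrow> b \<le> 1 \<Longrightarrow>
      near (K * (b - a) powr \<theta>) e (\<Xi> a b - \<Xi> a u - \<Xi> u b) (\<Xi>' a b - \<Xi>' a u - \<Xi>' u b)"
  shows "near (sewing_const \<theta> * K * (b - a) powr \<theta>) e
    (Lim (mesh_to_0 a b) (chain_sum \<Xi>) - \<Xi> a b) (Lim (mesh_to_0 a b) (chain_sum \<Xi>') - \<Xi>' a b)"
proof -
  have d: "defect_bound \<theta> K \<Xi>" "defect_bound \<theta> K \<Xi>'"
    using near unfolding defect_bound_def near_def by blast+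
  have d': "defect_bound \<theta> (K * e) (\<lambda>a b. \<Xi> a b - \<Xi>' a b)"
    unfolding defect_bound_def
  proof (intro allI impI)
    fix a u b :: real assume "0 \<le> a \<and> a \<le> u \<and> u \<le> b \<and> b \<le> 1"
    then have "\<bar>(\<Xi> a b - \<Xi> a u - \<Xi> u b) - (\<Xi>' a b - \<Xi>' a u - \<Xi>' u b)\<bar> \<le> K * (b - a) powr \<theta> * e"
      using near[of a u b] by (auto simp: near_def)
    then show "\<bar>\<Xi> a b - \<Xi>' a b - (\<Xi> a u - \<Xi>' a u) - (\<Xi> u b - \<Xi>' u b)\<bar> \<le> K * e * (b - a) powr \<theta>"
      by (simp add: algebra_simps)
  qed
  have "near (sewing_const \<theta> * K * (b - a) powr \<theta>) e (chain_sum \<Xi> p - \<Xi> a b) (chain_sum \<Xi>' p - \<Xi>' a b)"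
    if p: "p \<in> partitions a b" for p
  proof -
    have "chain_sum (\<lambda>a b. \<Xi> a b - \<Xi>' a b) p = chain_sum \<Xi> p - chain_sum \<Xi>' p"
      by (simp add: chain_sum_def sum_subtractf)
    then show ?thesis
      using sewing_estimate[OF d(1) _ _ p] sewing_estimate[OF d(2) _ _ p] sewing_estimate[OF d' _ _ p] assms
      by (simp add: near_def algebra_simps)
  qed
  then show ?thesis
    by (intro near_tendsto[OF tendsto_diff[OF sewing_converges[OF d(1)] tendsto_const]
          tendsto_diff[OF sewing_converges[OF d(2)] tendsto_const] mesh_to_0_neq_bot])
       (use assms in \<open>auto simp: eventually_mesh_to_0 intro!: exI[of _ 1]\<close>)
qed

section \<open>Tensor fields with bounded derivatives\<close>

text \<open>Order \<open>0\<close> is left out of the bound: the kernel \<open>A\<close> itself may be unbounded.\<close>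

definition derivs_bounded :: "nat \<Rightarrow> real \<Rightarrow> (vec3 \<Rightarrow> real) \<Rightarrow> bool" where
  "derivs_bounded n K f \<longleftrightarrow>
     (\<forall>ks x. length ks < n \<longrightarrow> partial_derivs ks f differentiable at x) \<and>
     (\<forall>ks x. 1 \<le> length ks \<and> length ks \<le> n \<longrightarrow> \<bar>partial_derivs ks f x\<bar> \<le> K)"

lemma partial_derivs_append: "partial_derivs (ks @ ls) f = partial_derivs ks (partial_derivs ls f)"
  by (induction ks) auto

lemma derivs_bounded_partial_derivs:
  assumes "derivs_bounded n K f" "length ls + m \<le> n"
  shows "derivs_bounded m K (partial_derivs ls f)"
  using assms unfolding derivs_bounded_def partial_derivs_append[symmetric] by auto

lemma derivs_bounded_partial_deriv:
  assumes "derivs_bounded (Suc n) K f"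
  shows "derivs_bounded n K (partial_deriv k f)"
  using derivs_bounded_partial_derivs[OF assms, of "[k]" n] by simp

lemma derivs_bounded_mono:
  "derivs_bounded n K f \<Longrightarrow> m \<le> n \<Longrightarrow> K \<le> L \<Longrightarrow> derivs_bounded m L f"
  unfolding derivs_bounded_def by (meson order_trans less_le_trans)

lemma derivs_bounded_differentiable: "derivs_bounded (Suc n) K f \<Longrightarrow> f differentiable at x"
  unfolding derivs_bounded_def by (drule conjunct1, drule spec[of _ "[]"]) simp

lemma derivs_bounded_bound: "derivs_bounded (Suc n) K f \<Longrightarrow> \<bar>partial_deriv k f x\<bar> \<le> K"
  unfolding derivs_bounded_def by (drule conjunct2, drule spec[of _ "[k]"]) simp

lemma derivs_bounded_nonneg: "derivs_bounded (Suc n) K f \<Longrightarrow> 0 \<le> K"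
  using derivs_bounded_bound[of n K f undefined undefined] by linarith

lemma has_derivative_partial_deriv:
  assumes "f differentiable at x"
  shows "(f has_derivative (\<lambda>h. \<Sum>k\<in>UNIV. h $ k * partial_deriv k f x)) (at x)"
proof -
  have d: "(f has_derivative frechet_derivative f (at x)) (at x)"
    using assms frechet_derivative_works by blast
  then have lin: "linear (frechet_derivative f (at x))" by (rule has_derivative_linear)
  have "frechet_derivative f (at x) = (\<lambda>h. \<Sum>k\<in>UNIV. h $ k * partial_deriv k f x)"
  proof
    fix h :: vec3
    have "frechet_derivative f (at x) h = frechet_derivative f (at x) (\<Sum>k\<in>UNIV. (h $ k) *\<^sub>R axis k 1)"
      using basis_expansion[of h] by (simp add: scalar_mult_eq_scaleR)
    then show "frechet_derivative f (at x) h = (\<Sum>k\<in>UNIV. h $ k * partial_deriv k f x)"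
      by (simp add: linear_sum[OF lin] linear_cmul[OF lin] partial_deriv_def)
  qed
  then show ?thesis using d by simp
qed

lemma partial_deriv_eqI:
  assumes "(f has_derivative f') (at x)"
  shows "partial_deriv k f x = f' (axis k 1)"
  using frechet_derivative_at[OF assms] by (simp add: partial_deriv_def)

lemma has_real_derivative_along_line:
  assumes "f differentiable at (p + s *\<^sub>R v)"
  shows "((\<lambda>s. f (p + s *\<^sub>R v)) has_real_derivative (\<Sum>k\<in>UNIV. v $ k * partial_deriv k f (p + s *\<^sub>R v))) (at s)"
proof -
  have 1: "((\<lambda>s. p + s *\<^sub>R v) has_derivative (\<lambda>h. h *\<^sub>R v)) (at s)"
    by (auto intro!: derivative_eq_intros)
  have "((\<lambda>s. f (p + s *\<^sub>R v)) has_derivative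
      (\<lambda>h. \<Sum>k\<in>UNIV. (h *\<^sub>R v) $ k * partial_deriv k f (p + s *\<^sub>R v))) (at s)"
    using diff_chain_at[OF 1 has_derivative_partial_deriv[OF assms]] by (simp add: o_def)
  moreover have "(\<lambda>h. \<Sum>k\<in>UNIV. (h *\<^sub>R v) $ k * partial_deriv k f (p + s *\<^sub>R v))
    = (\<lambda>h. (\<Sum>k\<in>UNIV. v $ k * partial_deriv k f (p + s *\<^sub>R v)) * h)"
    by (auto simp: sum_distrib_left algebra_simps)
  ultimately show ?thesis by (simp add: has_field_derivative_def)
qed

lemma unit_interval_increment_le:
  fixes h :: "real \<Rightarrow> real"
  assumes "\<And>s. (h has_real_derivative h' s) (at s)" "\<And>s. 0 \<le> s \<Longrightarrow> s \<le> 1 \<Longrightarrow> \<bar>h' s\<bar> \<le> c"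
  shows "\<bar>h 1 - h 0\<bar> \<le> c"
proof -
  obtain z where "0 < z" "z < 1" "h 1 - h 0 = (1 - 0) * h' z"
    using MVT2[of 0 1 h h'] assms(1) by auto
  then show ?thesis using assms(2)[of z] by auto
qed

lemma abs_sum3_le:
  fixes f :: "3 \<Rightarrow> real"
  assumes "\<And>k. \<bar>f k\<bar> \<le> c"
  shows "\<bar>\<Sum>k\<in>UNIV. f k\<bar> \<le> 3 * c"
  using order_trans[OF sum_abs[of f UNIV] sum_bounded_above[of UNIV "\<lambda>k. \<bar>f k\<bar>" c]] assms by simp

lemma abs_mult_le: "\<bar>x::real\<bar> \<le> a \<Longrightarrow> \<bar>y\<bar> \<le> b \<Longrightarrow> \<bar>x * y\<bar> \<le> a * b"
  unfolding abs_mult by (intro mult_mono) auto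

lemma abs_convex_comb_le:
  assumes "0 \<le> s" "s \<le> 1" "\<bar>x\<bar> \<le> c" "\<bar>y\<bar> \<le> (c::real)"
  shows "\<bar>x + s * (y - x)\<bar> \<le> c"
proof -
  have "x + s * (y - x) = (1 - s) * x + s * y" by (simp add: algebra_simps)
  then have "\<bar>x + s * (y - x)\<bar> \<le> (1 - s) * \<bar>x\<bar> + s * \<bar>y\<bar>"
    using assms by (metis abs_mult abs_of_nonneg abs_triangle_ineq diff_ge_0_iff_ge)
  also have "\<dots> \<le> (1 - s) * c + s * c" using assms by (intro add_mono mult_left_mono) auto
  finally show ?thesis by (simp add: algebra_simps)
qed

definition taylor_rem :: "(vec3 \<Rightarrow> real) \<Rightarrow> vec3 \<Rightarrow> vec3 \<Rightarrow> real" where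
  "taylor_rem f a b = f b - f a - (\<Sum>k\<in>UNIV. (b $ k - a $ k) * partial_deriv k f a)"

lemma le_mult_right: "0 \<le> x \<Longrightarrow> 1 \<le> H \<Longrightarrow> (x::real) \<le> x * H"
  using mult_left_mono[of 1 H x] by simp

lemma increment_bound:
  assumes f: "derivs_bounded (Suc n) K f" and d: "\<And>k. \<bar>b $ k - a $ k\<bar> \<le> d"
  shows "\<bar>f b - f a\<bar> \<le> 3 * (d * K)"
proof -
  have "\<bar>f (a + 1 *\<^sub>R (b - a)) - f (a + 0 *\<^sub>R (b - a))\<bar> \<le> 3 * (d * K)"
    by (rule unit_interval_increment_le[OF has_real_derivative_along_line])
       (auto intro!: abs_sum3_le abs_mult_le derivs_bounded_differentiable[OF f] derivs_bounded_bound[OF f] d)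
  then show ?thesis by simp
qed

text \<open>Mean value theorem for \<open>s \<mapsto> f (b\<^sub>s) - f (a\<^sub>s)\<close>, where \<open>(a\<^sub>s, b\<^sub>s)\<close> moves on a straight line
  from \<open>(a', b')\<close> to \<open>(a, b)\<close>.\<close>

lemma four_point_bound:
  assumes f: "derivs_bounded (Suc (Suc n)) K f"
    and h: "\<And>k. \<bar>b $ k - a $ k\<bar> \<le> h" "\<And>k. \<bar>b' $ k - a' $ k\<bar> \<le> h"
    and d: "\<And>k. \<bar>a $ k - a' $ k\<bar> \<le> d"
    and d': "\<And>k. \<bar>(b $ k - a $ k) - (b' $ k - a' $ k)\<bar> \<le> d'"
  shows "\<bar>(f b - f a) - (f b' - f a')\<bar> \<le> 3 * (d' * K) + 9 * (d * h * K)"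
proof -
  let ?g = "\<lambda>k. partial_deriv k f"
  define v where "v = b - b'"
  define w where "w = a - a'"
  note g = derivs_bounded_partial_deriv[OF f]
  have der: "((\<lambda>s. f (b' + s *\<^sub>R v) - f (a' + s *\<^sub>R w)) has_real_derivative
     (\<Sum>k\<in>UNIV. v $ k * ?g k (b' + s *\<^sub>R v)) - (\<Sum>k\<in>UNIV. w $ k * ?g k (a' + s *\<^sub>R w))) (at s)" for s
    by (intro DERIV_diff has_real_derivative_along_line derivs_bounded_differentiable[OF f])
  have "\<bar>(f (b' + 1 *\<^sub>R v) - f (a' + 1 *\<^sub>R w)) - (f (b' + 0 *\<^sub>R v) - f (a' + 0 *\<^sub>R w))\<bar>
      \<le> 3 * (d' * K) + 3 * (d * (3 * (h * K)))"
  proof (rule unit_interval_increment_le[OF der])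
    fix s :: real assume s: "0 \<le> s" "s \<le> 1"
    have eq: "(\<Sum>k\<in>UNIV. v $ k * ?g k (b' + s *\<^sub>R v)) - (\<Sum>k\<in>UNIV. w $ k * ?g k (a' + s *\<^sub>R w))
      = (\<Sum>k\<in>UNIV. (v $ k - w $ k) * ?g k (b' + s *\<^sub>R v))
        + (\<Sum>k\<in>UNIV. w $ k * (?g k (b' + s *\<^sub>R v) - ?g k (a' + s *\<^sub>R w)))"
      by (simp add: sum.distrib[symmetric] sum_subtractf[symmetric] algebra_simps)
    have "\<bar>(b' + s *\<^sub>R v) $ k - (a' + s *\<^sub>R w) $ k\<bar> \<le> h" for k
      using abs_convex_comb_le[OF s h(2)[of k] h(1)[of k]] by (simp add: v_def w_def algebra_simps)
    then have "\<bar>?g k (b' + s *\<^sub>R v) - ?g k (a' + s *\<^sub>R w)\<bar> \<le> 3 * (h * K)" for k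
      by (intro increment_bound[OF g]) auto
    then have "\<bar>\<Sum>k\<in>UNIV. w $ k * (?g k (b' + s *\<^sub>R v) - ?g k (a' + s *\<^sub>R w))\<bar> \<le> 3 * (d * (3 * (h * K)))"
      using d by (intro abs_sum3_le abs_mult_le) (auto simp: w_def)
    moreover have "\<bar>\<Sum>k\<in>UNIV. (v $ k - w $ k) * ?g k (b' + s *\<^sub>R v)\<bar> \<le> 3 * (d' * K)"
      using d' by (intro abs_sum3_le abs_mult_le derivs_bounded_bound[OF f]) (auto simp: v_def w_def algebra_simps)
    ultimately show "\<bar>(\<Sum>k\<in>UNIV. v $ k * ?g k (b' + s *\<^sub>R v)) - (\<Sum>k\<in>UNIV. w $ k * ?g k (a' + s *\<^sub>R w))\<bar>
        \<le> 3 * (d' * K) + 3 * (d * (3 * (h * K)))"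
      unfolding eq by linarith
  qed
  then show ?thesis by (simp add: v_def w_def algebra_simps)
qed

lemma taylor_rem_bound:
  assumes f: "derivs_bounded (Suc (Suc n)) K f" and h: "\<And>k. \<bar>b $ k - a $ k\<bar> \<le> h"
  shows "\<bar>taylor_rem f a b\<bar> \<le> 9 * (h * h * K)"
proof -
  let ?g = "\<lambda>k. partial_deriv k f"
  define v where "v = b - a"
  define c where "c = (\<Sum>k\<in>UNIV. v $ k * ?g k a)"
  note g = derivs_bounded_partial_deriv[OF f]
  have der: "((\<lambda>s. f (a + s *\<^sub>R v) - s * c) has_real_derivative
     (\<Sum>k\<in>UNIV. v $ k * ?g k (a + s *\<^sub>R v)) - c) (at s)" for s
    by (intro DERIV_diff has_real_derivative_along_line derivs_bounded_differentiable[OF f])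
       (auto intro!: derivative_eq_intros)
  have "\<bar>(f (a + 1 *\<^sub>R v) - 1 * c) - (f (a + 0 *\<^sub>R v) - 0 * c)\<bar> \<le> 3 * (h * (3 * (h * K)))"
  proof (rule unit_interval_increment_le[OF der])
    fix s :: real assume s: "0 \<le> s" "s \<le> 1"
    have "\<bar>s * v $ k\<bar> \<le> h" for k
      using abs_mult_le[of s 1 "v $ k" h] s h by (simp add: v_def)
    then have "\<bar>?g k (a + s *\<^sub>R v) - ?g k a\<bar> \<le> 3 * (h * K)" for k
      by (intro increment_bound[OF g]) auto
    then have "\<bar>\<Sum>k\<in>UNIV. v $ k * (?g k (a + s *\<^sub>R v) - ?g k a)\<bar> \<le> 3 * (h * (3 * (h * K)))"
      using h by (intro abs_sum3_le abs_mult_le) (auto simp: v_def)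
    then show "\<bar>(\<Sum>k\<in>UNIV. v $ k * ?g k (a + s *\<^sub>R v)) - c\<bar> \<le> 3 * (h * (3 * (h * K)))"
      by (simp add: c_def sum_subtractf algebra_simps)
  qed
  then show ?thesis by (simp add: v_def c_def taylor_rem_def algebra_simps)
qed

text \<open>The second difference of \<open>f\<close> over a square of side \<open>t\<close> is symmetric in the two directions, and it
  equals \<open>t * t\<close> times either mixed derivative up to \<open>O(t * t * t)\<close>.\<close>

lemma partial_deriv_commute:
  assumes f: "derivs_bounded (Suc (Suc (Suc n))) K f"
  shows "partial_deriv k (partial_deriv l f) x = partial_deriv l (partial_deriv k f) x"
proof -
  define \<Delta> where "\<Delta> t k l = f (x + t *\<^sub>R (axis k 1 + axis l 1)) - f (x + t *\<^sub>R axis k 1)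
    - f (x + t *\<^sub>R axis l 1) + f x" for t :: real and k l
  have sum_axis: "(\<Sum>i\<in>UNIV. axis l 1 $ i * c i) = c l" for l :: 3 and c :: "3 \<Rightarrow> real"
    by (subst sum.cong[OF refl, of UNIV _ "\<lambda>i. if l = i then c i else 0"]) (auto simp: axis_def)
  have second: "\<bar>\<Delta> t k l - t * t * partial_deriv k (partial_deriv l f) x\<bar> \<le> 12 * K * (t * t * t)"
    if t: "0 \<le> t" for t k l
  proof -
    let ?g = "partial_deriv l f"
    note g = derivs_bounded_partial_deriv[OF f, of l]
    note kg = derivs_bounded_partial_deriv[OF g, of k]
    define c where "c = t * t * partial_deriv k ?g x"
    define v where "v = t *\<^sub>R (axis l 1 :: vec3)"
    define y where "y = x + t *\<^sub>R (axis k 1 :: vec3)"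
    have sv: "(\<Sum>i\<in>UNIV. v $ i * d i) = t * d l" for d
      using sum_axis[of l d] by (simp add: v_def sum_distrib_left[symmetric] mult.assoc)
    have der: "((\<lambda>s. f (y + s *\<^sub>R v) - f (x + s *\<^sub>R v) - s * c) has_real_derivative
       (\<Sum>i\<in>UNIV. v $ i * partial_deriv i f (y + s *\<^sub>R v))
       - (\<Sum>i\<in>UNIV. v $ i * partial_deriv i f (x + s *\<^sub>R v)) - c) (at s)" for s
      by (intro DERIV_diff has_real_derivative_along_line derivs_bounded_differentiable[OF f])
         (auto intro!: derivative_eq_intros)
    have "\<bar>(f (y + 1 *\<^sub>R v) - f (x + 1 *\<^sub>R v) - 1 * c) - (f (y + 0 *\<^sub>R v) - f (x + 0 *\<^sub>R v) - 0 * c)\<bar>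
        \<le> t * (9 * (t * t * K)) + t * (t * (3 * (t * K)))"
    proof (rule unit_interval_increment_le[OF der])
      fix s :: real assume s: "0 \<le> s" "s \<le> 1"
      let ?a = "x + s *\<^sub>R v"
      have ya: "y + s *\<^sub>R v = ?a + t *\<^sub>R axis k 1" by (simp add: y_def algebra_simps)
      have "\<bar>taylor_rem ?g ?a (y + s *\<^sub>R v)\<bar> \<le> 9 * (t * t * K)"
        by (rule taylor_rem_bound[OF g]) (use t in \<open>auto simp: ya axis_def\<close>)
      moreover have "taylor_rem ?g ?a (y + s *\<^sub>R v) = ?g (y + s *\<^sub>R v) - ?g ?a - t * partial_deriv k ?g ?a"
        using sum_axis[of k "\<lambda>i. partial_deriv i ?g ?a"]
        by (simp add: taylor_rem_def ya sum_distrib_left[symmetric] mult.assoc)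
      ultimately have 1: "\<bar>?g (y + s *\<^sub>R v) - ?g ?a - t * partial_deriv k ?g ?a\<bar> \<le> 9 * (t * t * K)" by simp
      have 2: "\<bar>partial_deriv k ?g ?a - partial_deriv k ?g x\<bar> \<le> 3 * (t * K)"
      proof (rule increment_bound[OF kg])
        show "\<bar>?a $ i - x $ i\<bar> \<le> t" for i
          using abs_mult_le[of s 1 t t] s t by (auto simp: v_def axis_def)
      qed
      have eq: "t * ?g (y + s *\<^sub>R v) - t * ?g ?a - c
         = t * (?g (y + s *\<^sub>R v) - ?g ?a - t * partial_deriv k ?g ?a)
           + t * (t * (partial_deriv k ?g ?a - partial_deriv k ?g x))"
        by (simp add: c_def algebra_simps)
      show "\<bar>(\<Sum>i\<in>UNIV. v $ i * partial_deriv i f (y + s *\<^sub>R v))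
         - (\<Sum>i\<in>UNIV. v $ i * partial_deriv i f ?a) - c\<bar> \<le> t * (9 * (t * t * K)) + t * (t * (3 * (t * K)))"
        unfolding sv eq
        using t 1 2 by (intro order_trans[OF abs_triangle_ineq] add_mono abs_mult_le) auto
    qed
    moreover have "(f (y + 1 *\<^sub>R v) - f (x + 1 *\<^sub>R v) - 1 * c) - (f (y + 0 *\<^sub>R v) - f (x + 0 *\<^sub>R v) - 0 * c)
        = \<Delta> t k l - c"
      by (simp add: \<Delta>_def y_def v_def algebra_simps)
    ultimately show ?thesis by (simp add: c_def algebra_simps)
  qed
  let ?d = "partial_deriv k (partial_deriv l f) x - partial_deriv l (partial_deriv k f) x"
  have sym: "\<Delta> t k l = \<Delta> t l k" for t by (simp add: \<Delta>_def algebra_simps)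
  have small: "\<bar>?d\<bar> \<le> 24 * K * t" if "t > 0" for t
  proof -
    have "\<bar>t * t * partial_deriv k (partial_deriv l f) x - t * t * partial_deriv l (partial_deriv k f) x\<bar>
        \<le> 24 * K * (t * t * t)"
      using second[of t k l] second[of t l k] that unfolding sym[of t] by linarith
    moreover have "t * t * partial_deriv k (partial_deriv l f) x - t * t * partial_deriv l (partial_deriv k f) x
        = (t * t) * ?d" by (rule right_diff_distrib[symmetric])
    ultimately have "(t * t) * \<bar>?d\<bar> \<le> (t * t) * (24 * K * t)"
      by (simp add: abs_mult mult_ac)
    moreover have "0 < t * t" using that by simp
    ultimately show ?thesis using mult_le_cancel_left_pos by blast
  qed
  have "\<bar>?d\<bar> \<le> e" if "e > 0" for e
  proof -
    have K: "0 \<le> K" using f by (rule derivs_bounded_nonneg)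
    \<comment> \<open>The \<open>+ 1\<close> keeps the denominator positive when \<open>K = 0\<close>.\<close>
    have "\<bar>?d\<bar> \<le> 24 * K * (e / (24 * K + 1))" using that K by (intro small) auto
    also have "\<dots> \<le> e" using that K by (simp add: field_simps)
    finally show ?thesis .
  qed
  then have "\<bar>?d\<bar> \<le> 0" using dense_ge[of 0 "\<bar>?d\<bar>"] by blast
  then show ?thesis by simp
qed

text \<open>Along the straight line from \<open>(a', b')\<close> to \<open>(a, b)\<close>, with velocities \<open>w\<close> and \<open>v\<close> of the two points,
  the derivative of the remainder pairs \<open>v - w\<close> with the increment of the gradient of \<open>f\<close>, and
  \<open>w\<close> with the Taylor remainder of the gradient; the latter needs the symmetry of second derivatives.\<close>

lemma taylor_rem_difference_bound:
  assumes f: "derivs_bounded (Suc (Suc (Suc n))) K f"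
    and h: "\<And>k. \<bar>b $ k - a $ k\<bar> \<le> h" "\<And>k. \<bar>b' $ k - a' $ k\<bar> \<le> h"
    and d: "\<And>k. \<bar>a $ k - a' $ k\<bar> \<le> d"
    and d': "\<And>k. \<bar>(b $ k - a $ k) - (b' $ k - a' $ k)\<bar> \<le> d'"
  shows "\<bar>taylor_rem f a b - taylor_rem f a' b'\<bar> \<le> 9 * (d' * h * K) + 27 * (d * h * h * K)"
proof -
  let ?g = "\<lambda>k. partial_deriv k f"
  let ?gg = "\<lambda>l k. partial_deriv l (partial_deriv k f)"
  define v where "v = b - b'"
  define w where "w = a - a'"
  note g = derivs_bounded_partial_deriv[OF f]
  define D where "D s = (\<Sum>k\<in>UNIV. v $ k * ?g k (b' + s *\<^sub>R v)) - (\<Sum>k\<in>UNIV. w $ k * ?g k (a' + s *\<^sub>R w))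
     - (\<Sum>k\<in>UNIV. (v $ k - w $ k) * ?g k (a' + s *\<^sub>R w)
          + ((b' + s *\<^sub>R v) $ k - (a' + s *\<^sub>R w) $ k) * (\<Sum>l\<in>UNIV. w $ l * ?gg l k (a' + s *\<^sub>R w)))" for s
  have der: "((\<lambda>s. taylor_rem f (a' + s *\<^sub>R w) (b' + s *\<^sub>R v)) has_real_derivative D s) (at s)" for s
    unfolding taylor_rem_def D_def
    apply (intro DERIV_diff has_real_derivative_along_line derivs_bounded_differentiable[OF f] DERIV_sum)
    apply (rule DERIV_cong[OF DERIV_mult[OF _ has_real_derivative_along_line[OF derivs_bounded_differentiable[OF g]]]])
     apply (auto intro!: derivative_eq_intros simp: algebra_simps)
    done
  have eq: "D s = (\<Sum>k\<in>UNIV. (v $ k - w $ k) * (?g k (b' + s *\<^sub>R v) - ?g k (a' + s *\<^sub>R w)))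
      + (\<Sum>k\<in>UNIV. w $ k * taylor_rem (?g k) (a' + s *\<^sub>R w) (b' + s *\<^sub>R v))" (is "_ = ?R") for s
  proof -
    let ?a = "a' + s *\<^sub>R w" and ?b = "b' + s *\<^sub>R v"
    have "(\<Sum>k\<in>UNIV. (?b $ k - ?a $ k) * (\<Sum>l\<in>UNIV. w $ l * ?gg l k ?a))
        = (\<Sum>k\<in>UNIV. \<Sum>l\<in>UNIV. w $ l * ((?b $ k - ?a $ k) * ?gg k l ?a))"
      unfolding sum_distrib_left
      by (intro sum.cong refl) (subst partial_deriv_commute[OF f], simp add: algebra_simps)
    also have "\<dots> = (\<Sum>l\<in>UNIV. w $ l * (\<Sum>k\<in>UNIV. (?b $ k - ?a $ k) * ?gg k l ?a))"
      by (subst sum.swap) (simp add: sum_distrib_left)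
    finally have 1: "(\<Sum>k\<in>UNIV. (?b $ k - ?a $ k) * (\<Sum>l\<in>UNIV. w $ l * ?gg l k ?a))
      = (\<Sum>l\<in>UNIV. w $ l * (\<Sum>k\<in>UNIV. (?b $ k - ?a $ k) * ?gg k l ?a))" .
    show ?thesis
      unfolding D_def taylor_rem_def sum.distrib right_diff_distrib sum_subtractf 1
      by (simp add: algebra_simps sum.distrib sum_subtractf)
  qed
  have "\<bar>taylor_rem f (a' + 1 *\<^sub>R w) (b' + 1 *\<^sub>R v) - taylor_rem f (a' + 0 *\<^sub>R w) (b' + 0 *\<^sub>R v)\<bar>
      \<le> 3 * (d' * (3 * (h * K))) + 3 * (d * (9 * (h * h * K)))"
  proof (rule unit_interval_increment_le[OF der])
    fix s :: real assume s: "0 \<le> s" "s \<le> 1"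
    have "\<bar>(b' + s *\<^sub>R v) $ k - (a' + s *\<^sub>R w) $ k\<bar> \<le> h" for k
      using abs_convex_comb_le[OF s h(2)[of k] h(1)[of k]] by (simp add: v_def w_def algebra_simps)
    then have "\<bar>?g k (b' + s *\<^sub>R v) - ?g k (a' + s *\<^sub>R w)\<bar> \<le> 3 * (h * K)"
      "\<bar>taylor_rem (?g k) (a' + s *\<^sub>R w) (b' + s *\<^sub>R v)\<bar> \<le> 9 * (h * h * K)" for k
      by (intro increment_bound[OF g] taylor_rem_bound[OF g]; auto)+
    then show "\<bar>D s\<bar> \<le> 3 * (d' * (3 * (h * K))) + 3 * (d * (9 * (h * h * K)))"
      unfolding eq using d d'
      by (intro order_trans[OF abs_triangle_ineq] add_mono abs_sum3_le abs_mult_le)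
         (auto simp: v_def w_def algebra_simps)
  qed
  then show ?thesis by (simp add: v_def w_def algebra_simps)
qed

definition gradient_field :: "(vec3 \<Rightarrow> real) \<Rightarrow> (3 \<Rightarrow> vec3 \<Rightarrow> real) \<Rightarrow> bool" where
  "gradient_field f g \<longleftrightarrow> (\<forall>y. (f has_derivative (\<lambda>h. \<Sum>k\<in>UNIV. h $ k * g k y)) (at y))"

lemma gradient_field_partial_deriv:
  assumes "gradient_field f g"
  shows "partial_deriv k f = g k"
proof
  fix y
  have "partial_deriv k f y = (\<Sum>i\<in>UNIV. axis k 1 $ i * g i y)"
    using assms partial_deriv_eqI unfolding gradient_field_def by blast
  also have "\<dots> = (\<Sum>i\<in>UNIV. if k = i then g i y else 0)"
    by (intro sum.cong) (auto simp: axis_def)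
  finally show "partial_deriv k f y = g k y" by simp
qed

lemma gradient_fieldI: "(\<And>y. f differentiable at y) \<Longrightarrow> gradient_field f (\<lambda>k. partial_deriv k f)"
  unfolding gradient_field_def using has_derivative_partial_deriv by blast

lemma gradient_field_shift:
  assumes "gradient_field f g"
  shows "gradient_field (\<lambda>y. f (a + y)) (\<lambda>k y. g k (a + y))"
proof -
  have "((+) a has_derivative (\<lambda>h. h)) (at y)" for y :: vec3
    by (auto intro!: derivative_eq_intros)
  from diff_chain_at[OF this] show ?thesis
    using assms unfolding gradient_field_def o_def by blast
qed

lemma gradient_field_diff:
  assumes "gradient_field f g" "gradient_field f' g'"
  shows "gradient_field (\<lambda>y. f y - f' y) (\<lambda>k y. g k y - g' k y)"
  unfolding gradient_field_def
proof
  fix y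
  show "((\<lambda>y. f y - f' y) has_derivative (\<lambda>h. \<Sum>k\<in>UNIV. h $ k * (g k y - g' k y))) (at y)"
    using has_derivative_diff assms unfolding gradient_field_def right_diff_distrib sum_subtractf by blast
qed

lemma gradient_field_cmult:
  assumes "gradient_field f g"
  shows "gradient_field (\<lambda>y. c * f y) (\<lambda>k y. c * g k y)"
  unfolding gradient_field_def
proof
  fix y
  have "((\<lambda>y. c * f y) has_derivative (\<lambda>h. c * (\<Sum>k\<in>UNIV. h $ k * g k y))) (at y)"
    using assms unfolding gradient_field_def by (intro has_derivative_mult_right) blast
  then show "((\<lambda>y. c * f y) has_derivative (\<lambda>h. \<Sum>k\<in>UNIV. h $ k * (c * g k y))) (at y)"
    by (simp add: sum_distrib_left mult_ac)
qed

lemma gradient_field_sum: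
  assumes "\<And>i. i \<in> I \<Longrightarrow> gradient_field (f i) (g i)"
  shows "gradient_field (\<lambda>y. \<Sum>i\<in>I. f i y) (\<lambda>k y. \<Sum>i\<in>I. g i k y)"
  unfolding gradient_field_def
proof
  fix y
  have "((\<lambda>y. \<Sum>i\<in>I. f i y) has_derivative (\<lambda>h. \<Sum>i\<in>I. \<Sum>k\<in>UNIV. h $ k * g i k y)) (at y)"
    using assms unfolding gradient_field_def by (intro has_derivative_sum) blast
  moreover have "(\<Sum>i\<in>I. \<Sum>k\<in>UNIV. h $ k * g i k y) = (\<Sum>k\<in>UNIV. h $ k * (\<Sum>i\<in>I. g i k y))" for h :: vec3
    by (subst sum.swap) (simp add: sum_distrib_left)
  ultimately show "((\<lambda>y. \<Sum>i\<in>I. f i y) has_derivative (\<lambda>h. \<Sum>k\<in>UNIV. h $ k * (\<Sum>i\<in>I. g i k y))) (at y)"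
    by simp
qed

lemma gradient_field_taylor_rem:
  assumes f: "derivs_bounded (Suc (Suc (Suc n))) K f"
  shows "gradient_field (\<lambda>y. taylor_rem f (a + y) (b + y)) (\<lambda>k y. taylor_rem (partial_deriv k f) (a + y) (b + y))"
proof -
  note g = derivs_bounded_partial_deriv[OF f]
  have "gradient_field (\<lambda>y. f (b + y) - f (a + y) - (\<Sum>l\<in>UNIV. (b $ l - a $ l) * partial_deriv l f (a + y)))
     (\<lambda>k y. partial_deriv k f (b + y) - partial_deriv k f (a + y)
        - (\<Sum>l\<in>UNIV. (b $ l - a $ l) * partial_deriv k (partial_deriv l f) (a + y)))"
    by (intro gradient_field_diff gradient_field_sum gradient_field_cmult)
      (rule gradient_field_shift[OF gradient_fieldI] derivs_bounded_differentiable[OF f] derivs_bounded_differentiable[OF g])+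
  then show ?thesis
    unfolding taylor_rem_def by (simp add: partial_deriv_commute[OF f])
qed

lemma gradient_field_partial_derivs:
  assumes "derivs_bounded n K f" "length ks < n"
  shows "gradient_field (partial_derivs ks f) (\<lambda>k. partial_derivs (k # ks) f)"
  using gradient_fieldI[of "partial_derivs ks f"] assms by (simp add: derivs_bounded_def)

text \<open>Differences of shifts and Taylor remainders of shifts are operators \<open>op\<close> that commute with partial
  derivatives. A pointwise bound on \<open>op\<close>, applied to all derivatives of \<open>f\<close>, therefore bounds all
  derivatives of \<open>op f\<close>.\<close>

lemma derivs_bounded_operator:
  assumes grad: "\<And>ks. length ks < n \<Longrightarrow>
      gradient_field (op (partial_derivs ks f)) (\<lambda>k. op (partial_derivs (k # ks) f))"
    and bound: "\<And>ks y. 1 \<le> length ks \<Longrightarrow> length ks \<le> n \<Longrightarrow> \<bar>op (partial_derivs ks f) y\<bar> \<le> K"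
  shows "derivs_bounded n K (op f)"
proof -
  have "partial_derivs ks (op f) = op (partial_derivs ks f)" if "length ks \<le> n" for ks
    using that
  proof (induction ks)
    case (Cons k ks)
    then show ?case using gradient_field_partial_deriv[OF grad[of ks]] by simp
  qed simp
  moreover have "op (partial_derivs ks f) differentiable at y" if "length ks < n" for ks y
    using grad[OF that] unfolding gradient_field_def differentiable_def by blast
  ultimately show ?thesis using bound unfolding derivs_bounded_def by auto
qed

lemma derivs_bounded_shift:
  assumes f: "derivs_bounded n K f"
  shows "derivs_bounded n K (\<lambda>y. f (a + y))"
proof (rule derivs_bounded_operator[where op = "\<lambda>f y. f (a + y)"])
qed (use f gradient_field_shift[OF gradient_field_partial_derivs[OF f]] in \<open>auto simp: derivs_bounded_def\<close>)

lemma derivs_bounded_diff: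
  assumes f: "derivs_bounded n K f" and g: "derivs_bounded n L g"
  shows "derivs_bounded n (K + L) (\<lambda>y. f y - g y)"
proof -
  have eq: "partial_derivs ks (\<lambda>y. f y - g y) = (\<lambda>y. partial_derivs ks f y - partial_derivs ks g y)"
    if "length ks \<le> n" for ks
    using that
  proof (induction ks)
    case (Cons k ks)
    then show ?case
      using gradient_field_partial_deriv[OF gradient_field_diff[OF gradient_field_partial_derivs[OF f, of ks]
        gradient_field_partial_derivs[OF g, of ks]]] by simp
  qed simp
  have "\<bar>partial_derivs ks f x - partial_derivs ks g x\<bar> \<le> K + L" if "1 \<le> length ks \<and> length ks \<le> n" for ks x
  proof -
    have "\<bar>partial_derivs ks f x\<bar> \<le> K" "\<bar>partial_derivs ks g x\<bar> \<le> L"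
      using f g that unfolding derivs_bounded_def by blast+
    then show ?thesis by linarith
  qed
  then show ?thesis unfolding derivs_bounded_def using f g
    by (auto simp: eq derivs_bounded_def intro!: differentiable_diff)
qed

lemma derivs_bounded_shift_diff:
  assumes f: "derivs_bounded (Suc n) K f" and d: "\<And>k. \<bar>b $ k - a $ k\<bar> \<le> d"
  shows "derivs_bounded n (3 * (d * K)) (\<lambda>y. f (b + y) - f (a + y))"
proof (rule derivs_bounded_operator[where op = "\<lambda>f y. f (b + y) - f (a + y)"])
  fix ks :: "3 list" and y assume "1 \<le> length ks" "length ks \<le> n"
  then have "derivs_bounded (Suc 0) K (partial_derivs ks f)" by (intro derivs_bounded_partial_derivs[OF f]) auto
  then show "\<bar>partial_derivs ks f (b + y) - partial_derivs ks f (a + y)\<bar> \<le> 3 * (d * K)"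
    by (rule increment_bound) (use d in auto)
qed (auto intro!: gradient_field_diff gradient_field_shift gradient_field_partial_derivs[OF f] simp del: partial_derivs.simps)

lemma derivs_bounded_four_point:
  assumes f: "derivs_bounded (Suc (Suc n)) K f"
    and h: "\<And>k. \<bar>b $ k - a $ k\<bar> \<le> h" "\<And>k. \<bar>b' $ k - a' $ k\<bar> \<le> h"
    and d: "\<And>k. \<bar>a $ k - a' $ k\<bar> \<le> d"
    and d': "\<And>k. \<bar>(b $ k - a $ k) - (b' $ k - a' $ k)\<bar> \<le> d'"
  shows "derivs_bounded n (3 * (d' * K) + 9 * (d * h * K))
    (\<lambda>y. (f (b + y) - f (a + y)) - (f (b' + y) - f (a' + y)))"
proof (rule derivs_bounded_operator[where op = "\<lambda>f y. (f (b + y) - f (a + y)) - (f (b' + y) - f (a' + y))"])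
  fix ks :: "3 list" and y assume "1 \<le> length ks" "length ks \<le> n"
  then have "derivs_bounded (Suc (Suc 0)) K (partial_derivs ks f)" by (intro derivs_bounded_partial_derivs[OF f]) auto
  then show "\<bar>(partial_derivs ks f (b + y) - partial_derivs ks f (a + y))
     - (partial_derivs ks f (b' + y) - partial_derivs ks f (a' + y))\<bar> \<le> 3 * (d' * K) + 9 * (d * h * K)"
    by (rule four_point_bound) (use d h d' in auto)
qed (auto intro!: gradient_field_diff gradient_field_shift gradient_field_partial_derivs[OF f] simp del: partial_derivs.simps)

lemma gradient_field_taylor_rem_partial_derivs:
  assumes "derivs_bounded (n + 2) K f" "length ks < n"
  shows "gradient_field (\<lambda>y. taylor_rem (partial_derivs ks f) (a + y) (b + y))
    (\<lambda>k y. taylor_rem (partial_derivs (k # ks) f) (a + y) (b + y))"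
proof -
  have "derivs_bounded (Suc (Suc (Suc 0))) K (partial_derivs ks f)"
    by (rule derivs_bounded_partial_derivs[OF assms(1)]) (use assms(2) in auto)
  from gradient_field_taylor_rem[OF this] show ?thesis by simp
qed

lemma derivs_bounded_taylor_rem:
  assumes f: "derivs_bounded (n + 2) K f" and h: "\<And>k. \<bar>b $ k - a $ k\<bar> \<le> h"
  shows "derivs_bounded n (9 * (h * h * K)) (\<lambda>y. taylor_rem f (a + y) (b + y))"
proof (rule derivs_bounded_operator[where op = "\<lambda>f y. taylor_rem f (a + y) (b + y)"])
  fix ks :: "3 list" and y assume "1 \<le> length ks" "length ks \<le> n"
  then have "derivs_bounded (Suc (Suc 0)) K (partial_derivs ks f)" by (intro derivs_bounded_partial_derivs[OF f]) auto
  then show "\<bar>taylor_rem (partial_derivs ks f) (a + y) (b + y)\<bar> \<le> 9 * (h * h * K)"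
    by (rule taylor_rem_bound) (use h in auto)
qed (rule gradient_field_taylor_rem_partial_derivs[OF f])

lemma derivs_bounded_taylor_rem_diff:
  assumes f: "derivs_bounded (n + 3) K f"
    and h: "\<And>k. \<bar>b $ k - a $ k\<bar> \<le> h" "\<And>k. \<bar>b' $ k - a' $ k\<bar> \<le> h"
    and d: "\<And>k. \<bar>a $ k - a' $ k\<bar> \<le> d"
    and d': "\<And>k. \<bar>(b $ k - a $ k) - (b' $ k - a' $ k)\<bar> \<le> d'"
  shows "derivs_bounded n (9 * (d' * h * K) + 27 * (d * h * h * K))
    (\<lambda>y. taylor_rem f (a + y) (b + y) - taylor_rem f (a' + y) (b' + y))"
proof (rule derivs_bounded_operator[where op = "\<lambda>f y. taylor_rem f (a + y) (b + y) - taylor_rem f (a' + y) (b' + y)"])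
  fix ks :: "3 list" and y assume "1 \<le> length ks" "length ks \<le> n"
  then have "derivs_bounded (Suc (Suc (Suc 0))) K (partial_derivs ks f)"
    by (intro derivs_bounded_partial_derivs[OF f]) auto
  then show "\<bar>taylor_rem (partial_derivs ks f) (a + y) (b + y) - taylor_rem (partial_derivs ks f) (a' + y) (b' + y)\<bar>
      \<le> 9 * (d' * h * K) + 27 * (d * h * h * K)"
    by (rule taylor_rem_difference_bound) (use d h d' in auto)
next
  fix ks :: "3 list" assume "length ks < n"
  moreover have "derivs_bounded (n + 2) K f" by (rule derivs_bounded_mono[OF f]) auto
  ultimately show "gradient_field (\<lambda>y. taylor_rem (partial_derivs ks f) (a + y) (b + y)
        - taylor_rem (partial_derivs ks f) (a' + y) (b' + y))
     (\<lambda>k y. taylor_rem (partial_derivs (k # ks) f) (a + y) (b + y)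
        - taylor_rem (partial_derivs (k # ks) f) (a' + y) (b' + y))"
    by (intro gradient_field_diff gradient_field_taylor_rem_partial_derivs)
qed


text \<open>Three derivatives are what it takes to compare the integrals of one field along two curves, two are
  what it takes to integrate the difference of two fields along one curve.\<close>

definition near_fields :: "real \<Rightarrow> real \<Rightarrow> (vec3 \<Rightarrow> real) \<Rightarrow> (vec3 \<Rightarrow> real) \<Rightarrow> bool" where
  "near_fields K e f f' \<longleftrightarrow>
     derivs_bounded 3 K f \<and> derivs_bounded 3 K f' \<and> derivs_bounded 2 (K * e) (\<lambda>y. f y - f' y)"

text \<open>Two pairs of points, as they arise from two curves at two parameters: the increments have size
  \<open>h\<close> (a power of the parameter distance), and everything differs by \<open>e\<close> in relative terms.\<close>

definition near_points :: "real \<Rightarrow> real \<Rightarrow> real \<Rightarrow> vec3 \<Rightarrow> vec3 \<Rightarrow> vec3 \<Rightarrow> vec3 \<Rightarrow> bool" where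
  "near_points H h e a b a' b' \<longleftrightarrow> 1 \<le> H \<and> 0 \<le> h \<and> 0 \<le> e \<and>
     (\<forall>k. \<bar>a $ k - a' $ k\<bar> \<le> H * e \<and> near (H * h) e (b $ k - a $ k) (b' $ k - a' $ k))"

lemma near_fields_nonneg: "near_fields K e f f' \<Longrightarrow> 0 \<le> K"
  unfolding near_fields_def numeral_3_eq_3 using derivs_bounded_nonneg by blast

lemma near_fieldsD:
  assumes "near_fields K e f f'"
  shows "derivs_bounded (Suc (Suc (Suc 0))) K f" "derivs_bounded (Suc (Suc (Suc 0))) K f'"
    "derivs_bounded (Suc (Suc 0)) (K * e) (\<lambda>y. f y - f' y)"
  using assms by (simp_all add: near_fields_def eval_nat_numeral)

lemma near_fields_partial_deriv_diff:
  assumes "near_fields K e f f'"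
  shows "partial_deriv l (\<lambda>y. f y - f' y) = (\<lambda>y. partial_deriv l f y - partial_deriv l f' y)"
  using near_fieldsD[OF assms]
  by (intro gradient_field_partial_deriv[OF gradient_field_diff] gradient_fieldI derivs_bounded_differentiable)

lemma near_fields_self:
  assumes "derivs_bounded 3 K f"
  shows "near_fields K 0 f f"
proof -
  have "derivs_bounded 2 (3 * (0 * K)) (\<lambda>y. f (0 + y) - f (0 + y))"
    by (rule derivs_bounded_shift_diff) (use assms in \<open>simp_all add: numeral_3_eq_3 numeral_2_eq_2\<close>)
  then show ?thesis using assms by (simp add: near_fields_def)
qed

lemma near_pointsD:
  assumes "near_points H h e a b a' b'"
  shows "1 \<le> H" "0 \<le> h" "0 \<le> e" "\<bar>a $ k - a' $ k\<bar> \<le> H * e"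
    "\<bar>b $ k - a $ k\<bar> \<le> H * h" "\<bar>b' $ k - a' $ k\<bar> \<le> H * h"
    "\<bar>(b $ k - a $ k) - (b' $ k - a' $ k)\<bar> \<le> H * h * e"
  using assms unfolding near_points_def near_def by auto

lemma near_partial_deriv:
  assumes f: "near_fields K e f f'" and H: "1 \<le> H" "0 \<le> e" "\<And>k. \<bar>u $ k - u' $ k\<bar> \<le> H * e"
  shows "near (4 * K * H) e (partial_deriv l f u) (partial_deriv l f' u')"
proof -
  note f3 = near_fieldsD[OF f] and K = near_fields_nonneg[OF f]
  note d = near_fields_partial_deriv_diff[OF f]
  have 1: "\<bar>partial_deriv l f u' - partial_deriv l f' u'\<bar> \<le> K * e"
    using derivs_bounded_bound[OF f3(3), of l u'] by (simp add: d)
  have 2: "\<bar>partial_deriv l f u - partial_deriv l f u'\<bar> \<le> 3 * (H * e * K)"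
    by (rule increment_bound[OF derivs_bounded_partial_deriv[OF f3(1)]]) (rule H)
  have "0 \<le> K * e" "K * e \<le> K * e * H" "K \<le> K * H" using K H by (auto intro!: le_mult_right)
  then show ?thesis
    using 1 2 derivs_bounded_bound[OF f3(1), of l u] derivs_bounded_bound[OF f3(2), of l u'] K
    unfolding near_def by (simp add: algebra_simps)
qed

lemma near_partial_deriv_increment:
  assumes f: "near_fields K e f f'" and p: "near_points H h e a b a' b'"
  shows "near (15 * K * (H * H) * h) e (partial_deriv l f b - partial_deriv l f a)
    (partial_deriv l f' b' - partial_deriv l f' a')"
proof -
  note f3 = near_fieldsD[OF f] and K = near_fields_nonneg[OF f]
  note P = near_pointsD[OF p]
  note g = derivs_bounded_partial_deriv[OF f3(1), of l] derivs_bounded_partial_deriv[OF f3(2), of l]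
  note d = near_fields_partial_deriv_diff[OF f]
  have 1: "\<bar>(partial_deriv l f b' - partial_deriv l f' b') - (partial_deriv l f a' - partial_deriv l f' a')\<bar>
      \<le> 3 * (H * h * (K * e))"
    using increment_bound[OF derivs_bounded_partial_deriv[OF f3(3), of l] P(6)] by (simp add: d)
  have 2: "\<bar>(partial_deriv l f b - partial_deriv l f a) - (partial_deriv l f b' - partial_deriv l f a')\<bar>
      \<le> 3 * (H * h * e * K) + 9 * (H * e * (H * h) * K)"
    by (rule four_point_bound[OF g(1) P(5,6,4,7)])
  have 3: "\<bar>partial_deriv l f b - partial_deriv l f a\<bar> \<le> 3 * (H * h * K)"
    "\<bar>partial_deriv l f' b' - partial_deriv l f' a'\<bar> \<le> 3 * (H * h * K)"
    by (rule increment_bound[OF g(1) P(5)], rule increment_bound[OF g(2) P(6)])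
  define X where "X = K * h * H"
  have X: "0 \<le> X" "X \<le> X * H" using K P unfolding X_def by (auto intro!: le_mult_right mult_nonneg_nonneg)
  then have Xe: "0 \<le> X * e" "X * e \<le> X * H * e" using P(3) by (auto intro!: mult_right_mono)
  have "15 * K * (H * H) * h = 15 * (X * H)" "3 * (H * h * K) = 3 * X" "3 * (H * h * (K * e)) = 3 * (X * e)"
    "3 * (H * h * e * K) + 9 * (H * e * (H * h) * K) = 3 * (X * e) + 9 * (X * H * e)"
    by (simp_all add: X_def algebra_simps)
  then show ?thesis using 1 2 3 X Xe unfolding near_def by (simp only: mult.assoc) linarith
qed

lemma near_taylor_rem:
  assumes f: "near_fields K e f f'" and p: "near_points H h e a b a' b'"
  shows "near (45 * K * (H * H * H) * (h * h)) e (taylor_rem f a b) (taylor_rem f' a' b')"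
proof -
  note f3 = near_fieldsD[OF f] and K = near_fields_nonneg[OF f]
  note P = near_pointsD[OF p]
  note d = near_fields_partial_deriv_diff[OF f]
  have "taylor_rem (\<lambda>y. f y - f' y) a' b' = taylor_rem f a' b' - taylor_rem f' a' b'"
    unfolding taylor_rem_def d right_diff_distrib sum_subtractf by simp
  then have 1: "\<bar>taylor_rem f a' b' - taylor_rem f' a' b'\<bar> \<le> 9 * (H * h * (H * h) * (K * e))"
    using taylor_rem_bound[OF f3(3) P(6)] by simp
  have 2: "\<bar>taylor_rem f a b - taylor_rem f a' b'\<bar>
      \<le> 9 * (H * h * e * (H * h) * K) + 27 * (H * e * (H * h) * (H * h) * K)"
    by (rule taylor_rem_difference_bound[OF f3(1) P(5,6,4,7)])
  have 3: "\<bar>taylor_rem f a b\<bar> \<le> 9 * (H * h * (H * h) * K)" "\<bar>taylor_rem f' a' b'\<bar> \<le> 9 * (H * h * (H * h) * K)"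
    by (rule taylor_rem_bound[OF f3(1) P(5)], rule taylor_rem_bound[OF f3(2) P(6)])
  define X where "X = K * (h * h) * (H * H)"
  have X: "0 \<le> X" "X \<le> X * H" using K P unfolding X_def by (auto intro!: le_mult_right mult_nonneg_nonneg)
  then have Xe: "0 \<le> X * e" "X * e \<le> X * H * e" using P(3) by (auto intro!: mult_right_mono)
  have "45 * K * (H * H * H) * (h * h) = 45 * (X * H)" "9 * (H * h * (H * h) * K) = 9 * X"
    "9 * (H * h * (H * h) * (K * e)) = 9 * (X * e)"
    "9 * (H * h * e * (H * h) * K) + 27 * (H * e * (H * h) * (H * h) * K) = 9 * (X * e) + 27 * (X * H * e)"
    by (simp_all add: X_def algebra_simps)
  then show ?thesis using 1 2 3 X Xe unfolding near_def by (simp only: mult.assoc) linarith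
qed

lemma near_fields_shift:
  assumes f: "derivs_bounded 3 K f" and H: "1 \<le> H" "0 \<le> e" "\<And>k. \<bar>a $ k - a' $ k\<bar> \<le> H * e"
  shows "near_fields (3 * K * H) e (\<lambda>y. f (a + y)) (\<lambda>y. f (a' + y))"
proof -
  have f': "derivs_bounded (Suc 2) K f" using f by simp
  have K: "0 \<le> K" using derivs_bounded_nonneg[OF f'] .
  then have "K \<le> K * H" using H by (intro le_mult_right) auto
  then have "K \<le> 3 * K * H" using K by linarith
  then show ?thesis
    unfolding near_fields_def
    using derivs_bounded_mono[OF derivs_bounded_shift[OF f] order_refl]
      derivs_bounded_shift_diff[OF f', of a a' "H * e", OF H(3)] by (simp add: mult_ac)
qed

lemma near_fields_shift_diff:
  assumes f: "derivs_bounded 4 K f" and p: "near_points H h e a b a' b'"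
  shows "near_fields (12 * K * (H * H) * h) e (\<lambda>y. f (b + y) - f (a + y)) (\<lambda>y. f (b' + y) - f (a' + y))"
proof -
  have f': "derivs_bounded (Suc (Suc 2)) K f" "derivs_bounded (Suc 3) K f" using f by simp_all
  have K: "0 \<le> K" using derivs_bounded_nonneg[OF f'(2)] .
  note P = near_pointsD[OF p]
  define X where "X = K * h * H"
  have X: "0 \<le> X" "X \<le> X * H" using K P unfolding X_def by (auto intro!: le_mult_right mult_nonneg_nonneg)
  then have Xe: "0 \<le> X * e" "X * e \<le> X * H * e" using P(3) by (auto intro!: mult_right_mono)
  have "3 * (H * h * K) \<le> 12 * K * (H * H) * h"
    using X by (simp add: X_def algebra_simps)
  moreover have "3 * (H * h * e * K) + 9 * (H * e * (H * h) * K) \<le> 12 * K * (H * H) * h * e"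
    using Xe by (simp add: X_def algebra_simps)
  ultimately show ?thesis
    unfolding near_fields_def
    using derivs_bounded_mono[OF derivs_bounded_shift_diff[OF f'(2) P(5)]]
      derivs_bounded_mono[OF derivs_bounded_shift_diff[OF f'(2) P(6)]]
      derivs_bounded_mono[OF derivs_bounded_four_point[OF f'(1) P(5,6,4,7)]] by blast
qed

text \<open>All five derivatives are used here: the third derivatives of a Taylor remainder, which are of
  order \<open>h * h\<close>, take \<open>3 + 2\<close> of them, and the second derivatives of the difference of two Taylor
  remainders take \<open>2 + 3\<close>.\<close>

lemma near_fields_taylor_rem:
  assumes f: "derivs_bounded 5 K f" and p: "near_points H h e a b a' b'"
  shows "near_fields (36 * K * (H * H * H) * (h * h)) e
    (\<lambda>y. taylor_rem f (a + y) (b + y)) (\<lambda>y. taylor_rem f (a' + y) (b' + y))"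
proof -
  have f': "derivs_bounded (2 + 3) K f" "derivs_bounded (3 + 2) K f" "derivs_bounded (Suc 4) K f" using f by simp_all
  have K: "0 \<le> K" using derivs_bounded_nonneg[OF f'(3)] .
  note P = near_pointsD[OF p]
  define X where "X = K * (h * h) * (H * H)"
  have X: "0 \<le> X" "X \<le> X * H" using K P unfolding X_def by (auto intro!: le_mult_right mult_nonneg_nonneg)
  then have Xe: "0 \<le> X * e" "X * e \<le> X * H * e" using P(3) by (auto intro!: mult_right_mono)
  have "9 * (H * h * (H * h) * K) \<le> 36 * K * (H * H * H) * (h * h)"
    using X by (simp add: X_def algebra_simps)
  moreover have "9 * (H * h * e * (H * h) * K) + 27 * (H * e * (H * h) * (H * h) * K)
      \<le> 36 * K * (H * H * H) * (h * h) * e"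
    using Xe by (simp add: X_def algebra_simps)
  ultimately show ?thesis
    unfolding near_fields_def
    using derivs_bounded_mono[OF derivs_bounded_taylor_rem[OF f'(2) P(5)]]
      derivs_bounded_mono[OF derivs_bounded_taylor_rem[OF f'(2) P(6)]]
      derivs_bounded_mono[OF derivs_bounded_taylor_rem_diff[OF f'(1) P(5,6,4,7)]] by blast
qed

section \<open>Controlled paths and their rough integrals\<close>

definition chen_relation :: "curve \<Rightarrow> (real \<Rightarrow> real \<Rightarrow> mat3) \<Rightarrow> bool" where
  "chen_relation X W \<longleftrightarrow> (\<forall>\<xi>\<in>{0..1}. \<forall>\<eta>\<in>{0..1}. \<forall>\<rho>\<in>{0..1}. \<forall>i j.
     W \<xi> \<rho> $ i $ j - W \<xi> \<eta> $ i $ j - W \<eta> \<rho> $ i $ j = (X \<xi> $ i - X \<eta> $ i) * (X \<eta> $ j - X \<rho> $ j))"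

text \<open>Only increments of the paths are compared, as in the distance of rough paths.\<close>

definition near_rough_paths :: "real \<Rightarrow> real \<Rightarrow> real \<Rightarrow> curve \<Rightarrow> (real \<Rightarrow> real \<Rightarrow> mat3)
    \<Rightarrow> curve \<Rightarrow> (real \<Rightarrow> real \<Rightarrow> mat3) \<Rightarrow> bool" where
  "near_rough_paths \<gamma> M e X W X' W' \<longleftrightarrow> 1 \<le> M \<and> 0 \<le> e \<and> chen_relation X W \<and> chen_relation X' W' \<and>
     (\<forall>a\<in>{0..1}. \<forall>b\<in>{0..1}. \<forall>i j.
        near (M * \<bar>b - a\<bar> powr \<gamma>) e (X b $ i - X a $ i) (X' b $ i - X' a $ i) \<and>
        near (M * \<bar>b - a\<bar> powr (2 * \<gamma>)) e (W a b $ i $ j) (W' a b $ i $ j))"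

text \<open>The remainder of a real-valued controlled path, base point first.\<close>

definition ctrl_rem :: "curve \<Rightarrow> (real \<Rightarrow> real) \<Rightarrow> (real \<Rightarrow> vec3) \<Rightarrow> real \<Rightarrow> real \<Rightarrow> real" where
  "ctrl_rem X F G a b = F b - F a - (\<Sum>k\<in>UNIV. G a $ k * (X b $ k - X a $ k))"

definition near_controlled :: "real \<Rightarrow> real \<Rightarrow> real \<Rightarrow> curve \<Rightarrow> curve \<Rightarrow> (real \<Rightarrow> real) \<Rightarrow> (real \<Rightarrow> vec3)
    \<Rightarrow> (real \<Rightarrow> real) \<Rightarrow> (real \<Rightarrow> vec3) \<Rightarrow> bool" where
  "near_controlled \<gamma> N e X X' F G F' G' \<longleftrightarrow> (\<forall>a\<in>{0..1}. \<forall>b\<in>{0..1}. \<forall>k.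
     near N e (G a $ k) (G' a $ k) \<and>
     near (N * \<bar>b - a\<bar> powr \<gamma>) e (G b $ k - G a $ k) (G' b $ k - G' a $ k) \<and>
     near (N * \<bar>b - a\<bar> powr (2 * \<gamma>)) e (ctrl_rem X F G a b) (ctrl_rem X' F' G' a b))"

lemma near_rough_paths_sym: "near_rough_paths \<gamma> M e X W X' W' \<Longrightarrow> near_rough_paths \<gamma> M e X' W' X W"
  unfolding near_rough_paths_def using near_sym by blast

lemma near_rough_paths_self: "near_rough_paths \<gamma> M e X W X' W' \<Longrightarrow> near_rough_paths \<gamma> M 0 X W X W"
  unfolding near_rough_paths_def using near_self by blast

lemma near_rough_paths_larger:
  assumes "near_rough_paths \<gamma> M d X W U V" "d \<le> e"
  shows "near_rough_paths \<gamma> M e X W U V"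
  using assms near_larger[OF _ assms(2)] unfolding near_rough_paths_def by (meson order_trans)

lemma near_controlled_sym:
  "near_controlled \<gamma> N e X X' F G F' G' \<Longrightarrow> near_controlled \<gamma> N e X' X F' G' F G"
  unfolding near_controlled_def using near_sym by blast

lemma near_controlled_self:
  "near_controlled \<gamma> N e X X' F G F' G' \<Longrightarrow> near_controlled \<gamma> N 0 X X F G F G"
  unfolding near_controlled_def using near_self by blast

lemma powr_double: "x powr (2 * \<gamma>) = x powr \<gamma> * x powr (\<gamma>::real)"
  and powr_triple: "x powr (3 * \<gamma>) = x powr \<gamma> * x powr \<gamma> * x powr (\<gamma>::real)"
  by (simp_all add: powr_add[symmetric])

definition germ :: "(real \<Rightarrow> real \<Rightarrow> mat3) \<Rightarrow> (real \<Rightarrow> real) \<Rightarrow> (real \<Rightarrow> vec3) \<Rightarrow> (real \<Rightarrow> real)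
    \<Rightarrow> (real \<Rightarrow> vec3) \<Rightarrow> real \<Rightarrow> real \<Rightarrow> real" where
  "germ W F G Z H a b = F a * (Z b - Z a) + (\<Sum>i\<in>UNIV. \<Sum>j\<in>UNIV. G a $ i * H a $ j * W a b $ i $ j)"

lemma rough_sum_eq_chain_sum: "rough_sum W F G Z H = chain_sum (germ W F G Z H)"
  by (auto simp: rough_sum_def chain_sum_def germ_def fun_eq_iff)

lemma near_controlledD:
  assumes "near_controlled \<gamma> N e X X' F G F' G'" "0 < \<gamma>" "0 \<le> e"
    and "a \<in> {0..1}" "b \<in> {0..1}" "\<bar>b - a\<bar> \<le> h"
  shows "near N e (G a $ k) (G' a $ k)"
    and "near (N * h powr \<gamma>) e (G b $ k - G a $ k) (G' b $ k - G' a $ k)"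
    and "near (N * (h powr \<gamma> * h powr \<gamma>)) e (ctrl_rem X F G a b) (ctrl_rem X' F' G' a b)"
proof -
  have n: "near N e (G a $ k) (G' a $ k)" "near (N * \<bar>b - a\<bar> powr \<gamma>) e (G b $ k - G a $ k) (G' b $ k - G' a $ k)"
     "near (N * \<bar>b - a\<bar> powr (2 * \<gamma>)) e (ctrl_rem X F G a b) (ctrl_rem X' F' G' a b)"
    using assms unfolding near_controlled_def by blast+
  have N: "0 \<le> N" using n(1) by (rule near_bound_nonneg)
  show "near N e (G a $ k) (G' a $ k)" by (rule n(1))
  show "near (N * h powr \<gamma>) e (G b $ k - G a $ k) (G' b $ k - G' a $ k)"
    using N assms by (intro near_weaken[OF n(2)] mult_left_mono powr_mono2) auto
  show "near (N * (h powr \<gamma> * h powr \<gamma>)) e (ctrl_rem X F G a b) (ctrl_rem X' F' G' a b)"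
    unfolding powr_double[symmetric]
    using N assms by (intro near_weaken[OF n(3)] mult_left_mono powr_mono2) auto
qed

lemma near_controlled_nonneg: "near_controlled \<gamma> N e X X' F G F' G' \<Longrightarrow> 0 \<le> N"
  unfolding near_controlled_def
  by (drule bspec[of _ _ 0], simp, drule bspec[of _ _ 0], simp) (blast intro: near_bound_nonneg)

lemma near_rough_pathsD:
  assumes "near_rough_paths \<gamma> M e X W X' W'" "0 < \<gamma>"
    and "a \<in> {0..1}" "b \<in> {0..1}" "\<bar>b - a\<bar> \<le> h"
  shows "near (M * h powr \<gamma>) e (X b $ i - X a $ i) (X' b $ i - X' a $ i)"
    and "near (M * (h powr \<gamma> * h powr \<gamma>)) e (W a b $ i $ j) (W' a b $ i $ j)"
proof -
  have n: "near (M * \<bar>b - a\<bar> powr \<gamma>) e (X b $ i - X a $ i) (X' b $ i - X' a $ i)"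
     "near (M * \<bar>b - a\<bar> powr (2 * \<gamma>)) e (W a b $ i $ j) (W' a b $ i $ j)" "1 \<le> M" "0 \<le> e"
    using assms unfolding near_rough_paths_def by blast+
  show "near (M * h powr \<gamma>) e (X b $ i - X a $ i) (X' b $ i - X' a $ i)"
    using n(3,4) assms by (intro near_weaken[OF n(1)] mult_left_mono powr_mono2) auto
  show "near (M * (h powr \<gamma> * h powr \<gamma>)) e (W a b $ i $ j) (W' a b $ i $ j)"
    unfolding powr_double[symmetric]
    using n(3,4) assms by (intro near_weaken[OF n(2)] mult_left_mono powr_mono2) auto
qed

lemma near_controlled_increment:
  assumes c: "near_controlled \<gamma> N e X X' F G F' G'" and r: "near_rough_paths \<gamma> M e X W X' W'"
    and "0 < \<gamma>" "a \<in> {0..1}" "b \<in> {0..1}" "\<bar>b - a\<bar> \<le> h" "h \<le> 1"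
  shows "near (7 * N * M * h powr \<gamma>) e (F b - F a) (F' b - F' a)"
proof -
  have M: "1 \<le> M" "0 \<le> e" using r by (auto simp: near_rough_paths_def)
  note cD = near_controlledD[OF c \<open>0 < \<gamma>\<close> M(2) assms(4,5,6)]
  note rD = near_rough_pathsD[OF r \<open>0 < \<gamma>\<close> assms(4,5,6)]
  have N: "0 \<le> N" using cD(1) by (rule near_bound_nonneg)
  define s where "s = h powr \<gamma>"
  have s: "0 \<le> s" "s \<le> 1" using assms by (auto simp: s_def intro: powr_le1)
  have "near (3 * (2 * N * (M * s)) + N * (s * s)) e
     ((\<Sum>k\<in>UNIV. G a $ k * (X b $ k - X a $ k)) + ctrl_rem X F G a b)
     ((\<Sum>k\<in>UNIV. G' a $ k * (X' b $ k - X' a $ k)) + ctrl_rem X' F' G' a b)"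
    unfolding s_def by (intro near_add near_sum3 near_mult cD rD)
  moreover have "3 * (2 * N * (M * s)) + N * (s * s) \<le> 7 * N * M * s"
  proof -
    have "N * s * s \<le> N * s * M" using N s M by (intro mult_left_mono) auto
    then show ?thesis by (simp add: algebra_simps)
  qed
  ultimately show ?thesis
    using near_weaken M unfolding ctrl_rem_def s_def by fastforce
qed

text \<open>Chen's relation cancels the products of first-order increments. Each term that is left has a factor
  of order \<open>2\<gamma>\<close> and another of order \<open>\<gamma>\<close>.\<close>

lemma germ_defect:
  assumes "chen_relation X W" "a \<in> {0..1}" "u \<in> {0..1}" "b \<in> {0..1}"
  shows "germ W F G Z H a b - germ W F G Z H a u - germ W F G Z H u b =
    - (ctrl_rem X F G a u * (Z b - Z u)
       + (\<Sum>k\<in>UNIV. G a $ k * (X u $ k - X a $ k))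
         * ((\<Sum>k\<in>UNIV. (H u $ k - H a $ k) * (X b $ k - X u $ k)) + ctrl_rem X Z H u b)
       + (\<Sum>i\<in>UNIV. \<Sum>j\<in>UNIV. ((G u $ i - G a $ i) * H u $ j + G a $ i * (H u $ j - H a $ j)) * W u b $ i $ j))"
proof -
  \<comment> \<open>First-order increments of \<open>F\<close> and \<open>Z\<close>, both frozen at the left end point \<open>a\<close>.\<close>
  define gx where "gx = (\<Sum>k\<in>UNIV. G a $ k * (X u $ k - X a $ k))"
  define hx where "hx = (\<Sum>k\<in>UNIV. H a $ k * (X b $ k - X u $ k))"
  define S where "S = (\<Sum>i\<in>UNIV. \<Sum>j\<in>UNIV. ((G u $ i - G a $ i) * H u $ j + G a $ i * (H u $ j - H a $ j)) * W u b $ i $ j)"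
  have W: "W a b $ i $ j = W a u $ i $ j + W u b $ i $ j + (X a $ i - X u $ i) * (X u $ j - X b $ j)" for i j
  proof -
    have "W a b $ i $ j - W a u $ i $ j - W u b $ i $ j = (X a $ i - X u $ i) * (X u $ j - X b $ j)"
      using assms unfolding chen_relation_def by blast
    then show ?thesis by linarith
  qed
  have "(\<Sum>i\<in>UNIV. \<Sum>j\<in>UNIV. G a $ i * H a $ j * W a b $ i $ j)
      - (\<Sum>i\<in>UNIV. \<Sum>j\<in>UNIV. G a $ i * H a $ j * W a u $ i $ j)
      - (\<Sum>i\<in>UNIV. \<Sum>j\<in>UNIV. G u $ i * H u $ j * W u b $ i $ j)
      = (\<Sum>i\<in>UNIV. \<Sum>j\<in>UNIV. (G a $ i * (X u $ i - X a $ i)) * (H a $ j * (X b $ j - X u $ j))) - S"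
    unfolding S_def sum_subtractf[symmetric] W by (intro sum.cong refl) (simp add: algebra_simps)
  also have "\<dots> = gx * hx - S"
    unfolding gx_def hx_def by (simp add: sum_product)
  finally have 1: "germ W F G Z H a b - germ W F G Z H a u - germ W F G Z H u b
     = F a * (Z b - Z a) - F a * (Z u - Z a) - F u * (Z b - Z u) + gx * hx - S"
    unfolding germ_def by linarith
  have 2: "F u = F a + gx + ctrl_rem X F G a u" by (simp add: ctrl_rem_def gx_def)
  have 3: "(\<Sum>k\<in>UNIV. (H u $ k - H a $ k) * (X b $ k - X u $ k)) + ctrl_rem X Z H u b = Z b - Z u - hx"
    unfolding ctrl_rem_def hx_def left_diff_distrib sum_subtractf by simp
  show ?thesis
    unfolding 1 3 gx_def[symmetric] S_def[symmetric] by (subst 2) (simp add: algebra_simps)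
qed

lemma germ_defect_near:
  assumes r: "near_rough_paths \<gamma> M e X W X' W'"
    and F: "near_controlled \<gamma> N e X X' F G F' G'" and Z: "near_controlled \<gamma> L e X X' Z H Z' H'"
    and "0 < \<gamma>" "0 \<le> a" "a \<le> u" "u \<le> b" "b \<le> 1"
  shows "near (170 * (N * L * (M * M)) * (b - a) powr (3 * \<gamma>)) e
    (germ W F G Z H a b - germ W F G Z H a u - germ W F G Z H u b)
    (germ W' F' G' Z' H' a b - germ W' F' G' Z' H' a u - germ W' F' G' Z' H' u b)"
proof -
  have M: "1 \<le> M" "0 \<le> e" and chen: "chen_relation X W" "chen_relation X' W'"
    using r by (auto simp: near_rough_paths_def)
  have I: "a \<in> {0..1}" "u \<in> {0..1}" "b \<in> {0..1}" "\<bar>u - a\<bar> \<le> b - a" "\<bar>b - u\<bar> \<le> b - a" "b - a \<le> 1"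
    using assms by auto
  define s where "s = (b - a) powr \<gamma>"
  have s: "0 \<le> s" by (auto simp: s_def)
  note Fau = near_controlledD[OF F \<open>0 < \<gamma>\<close> M(2) I(1,2,4), folded s_def]
  note Zau = near_controlledD[OF Z \<open>0 < \<gamma>\<close> M(2) I(1,2,4), folded s_def]
  note Zub = near_controlledD[OF Z \<open>0 < \<gamma>\<close> M(2) I(2,3,5), folded s_def]
  note rau = near_rough_pathsD[OF r \<open>0 < \<gamma>\<close> I(1,2,4), folded s_def]
  note rub = near_rough_pathsD[OF r \<open>0 < \<gamma>\<close> I(2,3,5), folded s_def]
  note Zinc = near_controlled_increment[OF Z r \<open>0 < \<gamma>\<close> I(2,3,5,6), folded s_def]
  have NL: "0 \<le> N" "0 \<le> L" using Fau(1) Zau(1) near_bound_nonneg by blast+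
  have LM: "L * (s * s) \<le> L * M * (s * s)"
    using NL M s by (intro mult_right_mono) (auto simp: le_mult_right)
  have rest: "near (7 * L * M * (s * s)) e
     ((\<Sum>k\<in>UNIV. (H u $ k - H a $ k) * (X b $ k - X u $ k)) + ctrl_rem X Z H u b)
     ((\<Sum>k\<in>UNIV. (H' u $ k - H' a $ k) * (X' b $ k - X' u $ k)) + ctrl_rem X' Z' H' u b)"
    by (rule near_weaken[OF near_add[OF near_sum3[OF near_mult[OF Zau(2) rub(1)]] Zub(3)] _ M(2)])
       (use LM in \<open>simp add: algebra_simps\<close>)
  have "near (2 * (N * (s * s)) * (7 * L * M * s)
      + 2 * (3 * (2 * N * (M * s))) * (7 * L * M * (s * s))
      + 3 * (3 * (2 * (2 * (N * s) * L + 2 * N * (L * s)) * (M * (s * s))))) e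
    (germ W F G Z H a b - germ W F G Z H a u - germ W F G Z H u b)
    (germ W' F' G' Z' H' a b - germ W' F' G' Z' H' a u - germ W' F' G' Z' H' u b)"
    unfolding germ_defect[OF chen(1) I(1,2,3)] germ_defect[OF chen(2) I(1,2,3)]
    by (intro near_uminus near_add near_sum3 near_mult Fau Zau Zub rau rub Zinc rest)
  moreover have "2 * (N * (s * s)) * (7 * L * M * s)
      + 2 * (3 * (2 * N * (M * s))) * (7 * L * M * (s * s))
      + 3 * (3 * (2 * (2 * (N * s) * L + 2 * N * (L * s)) * (M * (s * s)))) = N * L * M * (s * s * s) * (86 + 84 * M)"
    by (simp add: algebra_simps)
  moreover have "N * L * M * (s * s * s) * (86 + 84 * M) \<le> N * L * M * (s * s * s) * (170 * M)"
    using NL M s by (intro mult_left_mono) auto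
  ultimately show ?thesis
    using near_weaken M unfolding powr_triple s_def by (fastforce simp: mult_ac)
qed

lemma rough_integral_near_germ:
  assumes r: "near_rough_paths \<gamma> M e X W X' W'"
    and F: "near_controlled \<gamma> N e X X' F G F' G'" and Z: "near_controlled \<gamma> L e X X' Z H Z' H'"
    and "1 / 3 < \<gamma>" "0 \<le> a" "a \<le> b" "b \<le> 1"
  shows "near (sewing_const (3 * \<gamma>) * (170 * (N * L * (M * M))) * (b - a) powr (3 * \<gamma>)) e
    (rough_integral W F G Z H a b - germ W F G Z H a b)
    (rough_integral W' F' G' Z' H' a b - germ W' F' G' Z' H' a b)"
proof -
  have "0 \<le> e" "1 \<le> M" using r by (auto simp: near_rough_paths_def)
  moreover have "0 \<le> N" "0 \<le> L" using F Z near_controlled_nonneg by blast+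
  ultimately show ?thesis
    using assms(4-) unfolding rough_integral_def rough_sum_eq_chain_sum
    by (simp, intro sewing_near germ_defect_near[OF r F Z]) auto
qed

lemma germ_defect_bound:
  assumes r: "near_rough_paths \<gamma> M e X W X' W'"
    and F: "near_controlled \<gamma> N e X X' F G F' G'" and Z: "near_controlled \<gamma> L e X X' Z H Z' H'"
    and "1 / 3 < \<gamma>"
  shows "\<exists>K\<ge>0. defect_bound (3 * \<gamma>) K (germ W F G Z H)"
proof (intro exI conjI)
  have "0 \<le> N" "0 \<le> L" using F Z near_controlled_nonneg by blast+
  then show "0 \<le> 170 * (N * L * (M * M))" by simp
  show "defect_bound (3 * \<gamma>) (170 * (N * L * (M * M))) (germ W F G Z H)"
    unfolding defect_bound_def
    using germ_defect_near[OF r F Z] \<open>1 / 3 < \<gamma>\<close> by (auto simp: near_def)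
qed

lemma rough_sum_tendsto:
  assumes "near_rough_paths \<gamma> M e X W X' W'"
    and "near_controlled \<gamma> N e X X' F G F' G'" and "near_controlled \<gamma> L e X X' Z H Z' H'"
    and "1 / 3 < \<gamma>" "0 \<le> a" "a \<le> b" "b \<le> 1"
  shows "(rough_sum W F G Z H \<longlongrightarrow> rough_integral W F G Z H a b) (mesh_to_0 a b)"
proof -
  obtain K where "K \<ge> 0" "defect_bound (3 * \<gamma>) K (germ W F G Z H)" using germ_defect_bound[OF assms(1-4)] by blast
  from sewing_converges[OF this(2) _ this(1) assms(5-7)] show ?thesis
    using assms by (simp add: rough_integral_def rough_sum_eq_chain_sum)
qed

lemma rough_integral_additive:
  assumes "near_rough_paths \<gamma> M e X W X' W'"
    and "near_controlled \<gamma> N e X X' F G F' G'" and "near_controlled \<gamma> L e X X' Z H Z' H'"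
    and "1 / 3 < \<gamma>" "0 \<le> a" "a \<le> c" "c \<le> b" "b \<le> 1"
  shows "rough_integral W F G Z H a b = rough_integral W F G Z H a c + rough_integral W F G Z H c b"
proof -
  obtain K where "K \<ge> 0" "defect_bound (3 * \<gamma>) K (germ W F G Z H)" using germ_defect_bound[OF assms(1-4)] by blast
  from sewing_additive[OF this(2) _ this(1) assms(5-8)] show ?thesis
    using assms by (simp add: rough_integral_def rough_sum_eq_chain_sum)
qed

abbreviation coord :: "cpath \<Rightarrow> 3 \<Rightarrow> real \<Rightarrow> real" where
  "coord Y i \<equiv> \<lambda>\<eta>. fst Y \<eta> $ i"

abbreviation dcoord :: "cpath \<Rightarrow> 3 \<Rightarrow> real \<Rightarrow> vec3" where
  "dcoord Y i \<equiv> \<lambda>\<eta>. snd Y \<eta> $ i"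

definition near_closed_paths :: "real \<Rightarrow> real \<Rightarrow> real \<Rightarrow> curve \<Rightarrow> curve \<Rightarrow> cpath \<Rightarrow> cpath \<Rightarrow> bool" where
  "near_closed_paths \<gamma> M e X X' Y Y' \<longleftrightarrow> fst Y 0 = fst Y 1 \<and> fst Y' 0 = fst Y' 1 \<and>
     (\<forall>i. near_controlled \<gamma> M e X X' (coord Y i) (dcoord Y i) (coord Y' i) (dcoord Y' i))"

lemma near_closed_paths_sym: "near_closed_paths \<gamma> M e X X' Y Y' \<Longrightarrow> near_closed_paths \<gamma> M e X' X Y' Y"
  unfolding near_closed_paths_def using near_controlled_sym by blast

lemma near_closed_paths_self: "near_closed_paths \<gamma> M e X X' Y Y' \<Longrightarrow> near_closed_paths \<gamma> M 0 X X Y Y"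
  unfolding near_closed_paths_def using near_controlled_self by blast

lemma near_closed_paths_larger:
  assumes "near_closed_paths \<gamma> M d X U Y Z" "d \<le> e"
  shows "near_closed_paths \<gamma> M e X U Y Z"
  using assms near_larger[OF _ assms(2)] unfolding near_closed_paths_def near_controlled_def by meson

lemma near_closed_pathsD:
  "near_closed_paths \<gamma> M e X X' Y Y' \<Longrightarrow> near_controlled \<gamma> M e X X' (coord Y i) (dcoord Y i) (coord Y' i) (dcoord Y' i)"
  by (simp add: near_closed_paths_def)

text \<open>The derivative, with respect to the driving path, of \<open>\<eta> \<mapsto> f (Y\<^sub>0 - Y\<^sub>\<eta>)\<close>.\<close>

definition pullback_deriv :: "cpath \<Rightarrow> (vec3 \<Rightarrow> real) \<Rightarrow> real \<Rightarrow> vec3" where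
  "pullback_deriv Y f \<eta> = (\<chi> a. - (\<Sum>b\<in>UNIV. partial_deriv b f (fst Y 0 - fst Y \<eta>) * snd Y \<eta> $ b $ a))"

text \<open>Evaluating \<open>f\<close> at \<open>Y\<^sub>0 - Y\<^sub>\<eta>\<close> instead of \<open>- Y\<^sub>\<eta>\<close> makes the integral a function of the increments
  of \<open>Y\<close> alone.\<close>

definition loop_integral :: "(real \<Rightarrow> real \<Rightarrow> mat3) \<Rightarrow> cpath \<Rightarrow> 3 \<Rightarrow> (vec3 \<Rightarrow> real) \<Rightarrow> real" where
  "loop_integral W Y j f = rough_integral W (\<lambda>\<eta>. f (fst Y 0 - fst Y \<eta>)) (pullback_deriv Y f)
     (coord Y j) (dcoord Y j) 0 1"

lemma near_increment_points:
  assumes r: "near_rough_paths \<gamma> M e X W X' W'" and Y: "near_closed_paths \<gamma> M e X X' Y Y'"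
    and "0 < \<gamma>" "a \<in> {0..1}" "b \<in> {0..1}"
  shows "near_points (7 * M * M) (\<bar>b - a\<bar> powr \<gamma>) e (fst Y a - fst Y 0) (fst Y b - fst Y 0)
     (fst Y' a - fst Y' 0) (fst Y' b - fst Y' 0)"
    and "near_points (7 * M * M) (\<bar>b - a\<bar> powr \<gamma>) e (fst Y 0 - fst Y a) (fst Y 0 - fst Y b)
     (fst Y' 0 - fst Y' a) (fst Y' 0 - fst Y' b)"
proof -
  have M: "1 \<le> M" "0 \<le> e" using r by (auto simp: near_rough_paths_def)
  have "1 \<le> M * M" using M le_mult_right[of M M] by linarith
  then have H: "1 \<le> 7 * M * M" by simp
  have inc: "near (7 * M * M * h powr \<gamma>) e (fst Y d $ k - fst Y c $ k) (fst Y' d $ k - fst Y' c $ k)"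
    if "c \<in> {0..1}" "d \<in> {0..1}" "\<bar>d - c\<bar> \<le> h" "h \<le> 1" for c d h k
    using near_controlled_increment[OF _ r \<open>0 < \<gamma>\<close> that] Y unfolding near_closed_paths_def by blast
  have 1: "near (7 * M * M * \<bar>b - a\<bar> powr \<gamma>) e (fst Y b $ k - fst Y a $ k) (fst Y' b $ k - fst Y' a $ k)" for k
    using assms by (intro inc) auto
  then have neg1: "near (7 * M * M * \<bar>b - a\<bar> powr \<gamma>) e (fst Y a $ k - fst Y b $ k) (fst Y' a $ k - fst Y' b $ k)" for k
    using near_uminus[OF 1[of k]] by simp
  have "near (7 * M * M * 1 powr \<gamma>) e (fst Y a $ k - fst Y 0 $ k) (fst Y' a $ k - fst Y' 0 $ k)" for k
    using assms by (intro inc) auto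
  then have 2: "\<bar>fst Y a $ k - fst Y 0 $ k - (fst Y' a $ k - fst Y' 0 $ k)\<bar> \<le> 7 * M * M * e" for k
    by (simp add: near_def)
  then have neg2: "\<bar>fst Y 0 $ k - fst Y a $ k - (fst Y' 0 $ k - fst Y' a $ k)\<bar> \<le> 7 * M * M * e" for k
    using 2[of k] by linarith
  show "near_points (7 * M * M) (\<bar>b - a\<bar> powr \<gamma>) e (fst Y a - fst Y 0) (fst Y b - fst Y 0)
     (fst Y' a - fst Y' 0) (fst Y' b - fst Y' 0)"
    using H M 1 2 by (simp add: near_points_def)
  show "near_points (7 * M * M) (\<bar>b - a\<bar> powr \<gamma>) e (fst Y 0 - fst Y a) (fst Y 0 - fst Y b)
     (fst Y' 0 - fst Y' a) (fst Y' 0 - fst Y' b)"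
    using H M neg1 neg2 by (simp add: near_points_def)
qed

text \<open>Up to sign, the remainder of \<open>f (Y\<^sub>0 - Y\<^sub>\<eta>)\<close> is made of a Taylor remainder of \<open>f\<close> and of the
  gradient of \<open>f\<close> applied to the remainder of \<open>Y\<close>.\<close>

lemma near_controlled_pullback:
  assumes r: "near_rough_paths \<gamma> M e X W X' W'" and Y: "near_closed_paths \<gamma> M e X X' Y Y'"
    and f: "near_fields K e f f'" and "0 < \<gamma>" and H: "H = 7 * M * M"
  shows "near_controlled \<gamma> (114 * K * (H * H * H) * M) e X X' (\<lambda>\<eta>. f (fst Y 0 - fst Y \<eta>)) (pullback_deriv Y f)
     (\<lambda>\<eta>. f' (fst Y' 0 - fst Y' \<eta>)) (pullback_deriv Y' f')"
  unfolding near_controlled_def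
proof (intro ballI allI conjI)
  fix a b :: real and k assume I: "a \<in> {0..1}" "b \<in> {0..1}"
  define u where "u \<eta> = fst Y 0 - fst Y \<eta>" for \<eta>
  define u' where "u' \<eta> = fst Y' 0 - fst Y' \<eta>" for \<eta>
  define s where "s = \<bar>b - a\<bar> powr \<gamma>"
  have s: "0 \<le> s" by (simp add: s_def)
  have M: "1 \<le> M" "0 \<le> e" using r by (auto simp: near_rough_paths_def)
  have K: "0 \<le> K" using near_fields_nonneg[OF f] .
  have pts: "near_points H s e (u c) (u b) (u' c) (u' b)" if "c = a" for c
    using near_increment_points(2)[OF r Y \<open>0 < \<gamma>\<close> I] that unfolding H u_def u'_def s_def by simp
  have ptsb: "\<And>k. \<bar>u b $ k - u' b $ k\<bar> \<le> H * e"
    using near_increment_points(2)[OF r Y \<open>0 < \<gamma>\<close> I(2,2)] unfolding near_points_def H u_def u'_def by blast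
  have H1: "1 \<le> H" and ptsa: "\<And>k. \<bar>u a $ k - u' a $ k\<bar> \<le> H * e"
    using pts[OF refl] by (auto simp: near_points_def)
  have ctrl: "near_controlled \<gamma> M e X X' (coord Y i) (dcoord Y i) (coord Y' i) (dcoord Y' i)" for i
    using near_closed_pathsD[OF Y] .
  note D = near_controlledD[OF ctrl \<open>0 < \<gamma>\<close> M(2) I order_refl, folded s_def]
  note fa = near_partial_deriv[OF f H1 M(2) ptsa] and fb = near_partial_deriv[OF f H1 M(2) ptsb]
  note fab = near_partial_deriv_increment[OF f pts[OF refl]]
  note tay = near_taylor_rem[OF f pts[OF refl]]
  define Q where "Q = K * H * M"
  have KHM: "0 \<le> K * M" using K M by simp
  have Q0: "0 \<le> Q" using K H1 M by (simp add: Q_def)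
  have Q1: "Q \<le> Q * H" "Q * H \<le> Q * H * H" using Q0 H1 by (auto intro!: le_mult_right)
  have QM: "K * (H * H * H) \<le> Q * H * H"
    using le_mult_right[OF _ M(1), of "K * (H * H * H)"] K H1 by (simp add: Q_def mult_ac)
  have c: "114 * K * (H * H * H) * M = 114 * (Q * H * H)" by (simp add: Q_def algebra_simps)
  have pull: "pullback_deriv Y f \<eta> $ k = - (\<Sum>b\<in>UNIV. partial_deriv b f (u \<eta>) * snd Y \<eta> $ b $ k)"
    "pullback_deriv Y' f' \<eta> $ k = - (\<Sum>b\<in>UNIV. partial_deriv b f' (u' \<eta>) * snd Y' \<eta> $ b $ k)" for \<eta> k
    by (simp_all add: pullback_deriv_def u_def u'_def)
  have "near (3 * (2 * (4 * K * H) * M)) e (pullback_deriv Y f a $ k) (pullback_deriv Y' f' a $ k)"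
    unfolding pull by (intro near_uminus near_sum3 near_mult fa D(1))
  then show "near (114 * K * (H * H * H) * M) e (pullback_deriv Y f a $ k) (pullback_deriv Y' f' a $ k)"
    unfolding c by (rule near_weaken) (use Q0 Q1 M in \<open>simp_all add: Q_def algebra_simps\<close>)
  have eq: "pullback_deriv Y f b $ k - pullback_deriv Y f a $ k
      = - (\<Sum>l\<in>UNIV. partial_deriv l f (u b) * (snd Y b $ l $ k - snd Y a $ l $ k)
             + (partial_deriv l f (u b) - partial_deriv l f (u a)) * snd Y a $ l $ k)"
    "pullback_deriv Y' f' b $ k - pullback_deriv Y' f' a $ k
      = - (\<Sum>l\<in>UNIV. partial_deriv l f' (u' b) * (snd Y' b $ l $ k - snd Y' a $ l $ k)
             + (partial_deriv l f' (u' b) - partial_deriv l f' (u' a)) * snd Y' a $ l $ k)"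
    unfolding pull by (simp_all add: sum_subtractf sum.distrib algebra_simps)
  have "near (3 * (2 * (4 * K * H) * (M * s) + 2 * (15 * K * (H * H) * s) * M)) e
      (pullback_deriv Y f b $ k - pullback_deriv Y f a $ k) (pullback_deriv Y' f' b $ k - pullback_deriv Y' f' a $ k)"
    unfolding eq by (intro near_uminus near_sum3 near_add near_mult fb fab D(1,2))
  moreover have "3 * (2 * (4 * K * H) * (M * s) + 2 * (15 * K * (H * H) * s) * M) = (24 * Q + 90 * (Q * H)) * s"
    by (simp add: Q_def algebra_simps)
  moreover have "(24 * Q + 90 * (Q * H)) * s \<le> (114 * (Q * H * H)) * s"
    using Q1 s by (intro mult_right_mono) auto
  ultimately show "near (114 * K * (H * H * H) * M * \<bar>b - a\<bar> powr \<gamma>) e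
      (pullback_deriv Y f b $ k - pullback_deriv Y f a $ k) (pullback_deriv Y' f' b $ k - pullback_deriv Y' f' a $ k)"
    unfolding c s_def[symmetric] using near_weaken M(2) by fastforce
  have rem: "ctrl_rem X (\<lambda>\<eta>. f (u \<eta>)) (pullback_deriv Y f) a b
      = taylor_rem f (u a) (u b) - (\<Sum>l\<in>UNIV. partial_deriv l f (u a) * ctrl_rem X (coord Y l) (dcoord Y l) a b)"
    if u: "\<And>\<eta>. u \<eta> = fst Y 0 - fst Y \<eta>" for X u Y f
  proof -
    have "(\<Sum>k\<in>UNIV. pullback_deriv Y f a $ k * (X b $ k - X a $ k))
        = (\<Sum>k\<in>UNIV. \<Sum>l\<in>UNIV. - (partial_deriv l f (u a) * (snd Y a $ l $ k * (X b $ k - X a $ k))))"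
      by (simp add: pullback_deriv_def u sum_distrib_left sum_distrib_right sum_negf mult_ac)
    also have "\<dots> = (\<Sum>l\<in>UNIV. \<Sum>k\<in>UNIV. - (partial_deriv l f (u a) * (snd Y a $ l $ k * (X b $ k - X a $ k))))"
      by (rule sum.swap)
    also have "\<dots> = - (\<Sum>l\<in>UNIV. partial_deriv l f (u a) * (\<Sum>k\<in>UNIV. snd Y a $ l $ k * (X b $ k - X a $ k)))"
      by (simp add: sum_negf sum_distrib_left)
    finally show ?thesis
      unfolding ctrl_rem_def taylor_rem_def right_diff_distrib sum_subtractf
      by (simp add: u algebra_simps sum_subtractf)
  qed
  have "near (45 * K * (H * H * H) * (s * s) + 3 * (2 * (4 * K * H) * (M * (s * s)))) e
      (ctrl_rem X (\<lambda>\<eta>. f (u \<eta>)) (pullback_deriv Y f) a b) (ctrl_rem X' (\<lambda>\<eta>. f' (u' \<eta>)) (pullback_deriv Y' f') a b)"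
    unfolding rem[OF u_def] rem[OF u'_def]
    by (intro near_diff near_sum3 near_mult tay fa D(3))
  moreover have "45 * K * (H * H * H) * (s * s) + 3 * (2 * (4 * K * H) * (M * (s * s)))
      = (45 * (K * (H * H * H)) + 24 * Q) * (s * s)"
    by (simp add: Q_def algebra_simps)
  moreover have "(45 * (K * (H * H * H)) + 24 * Q) * (s * s) \<le> (114 * (Q * H * H)) * (s * s)"
    using Q1 QM Q0 s by (intro mult_right_mono) auto
  ultimately show "near (114 * K * (H * H * H) * M * \<bar>b - a\<bar> powr (2 * \<gamma>)) e
      (ctrl_rem X (\<lambda>\<eta>. f (fst Y 0 - fst Y \<eta>)) (pullback_deriv Y f) a b)
      (ctrl_rem X' (\<lambda>\<eta>. f' (fst Y' 0 - fst Y' \<eta>)) (pullback_deriv Y' f') a b)"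
    unfolding c powr_double s_def[symmetric] u_def[symmetric] u'_def[symmetric] using near_weaken M(2) by fastforce
qed

text \<open>The germ over \<open>[0, 1]\<close> contributes \<open>36\<close>, the sewing error \<open>170\<close>; the last factor is the constant of
  \<open>near_controlled_pullback\<close>.\<close>

definition loop_const :: "real \<Rightarrow> real \<Rightarrow> real" where
  "loop_const \<gamma> M = (36 + sewing_const (3 * \<gamma>) * 170 * M) * (M * M * M) * (114 * (7 * M * M * (7 * M * M) * (7 * M * M)))"

lemma loop_const_nonneg: "1 / 3 < \<gamma> \<Longrightarrow> 1 \<le> M \<Longrightarrow> 0 \<le> loop_const \<gamma> M"
  using sewing_const_fixpoint[of "3 * \<gamma>"] by (simp add: loop_const_def)

text \<open>The first-order term \<open>f(0) (Y\<^sub>1 - Y\<^sub>0)\<close> of the germ over \<open>[0, 1]\<close> vanishes on a closed curve. What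
  remains involves \<open>f\<close> through its derivatives only.\<close>

lemma loop_integral_near:
  assumes r: "near_rough_paths \<gamma> M e X W X' W'" and Y: "near_closed_paths \<gamma> M e X X' Y Y'"
    and f: "near_fields K e f f'" and "1 / 3 < \<gamma>"
  shows "near (loop_const \<gamma> M * K) e (loop_integral W Y j f) (loop_integral W' Y' j f')"
proof -
  have M: "1 \<le> M" "0 \<le> e" using r by (auto simp: near_rough_paths_def)
  define N where "N = 114 * K * (7 * M * M * (7 * M * M) * (7 * M * M)) * M"
  have ctrl: "near_controlled \<gamma> M e X X' (coord Y j) (dcoord Y j) (coord Y' j) (dcoord Y' j)"
    and closed: "fst Y 1 $ j - fst Y 0 $ j = 0" "fst Y' 1 $ j - fst Y' 0 $ j = 0"
    using Y by (simp_all add: near_closed_paths_def)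
  have pull: "near_controlled \<gamma> N e X X' (\<lambda>\<eta>. f (fst Y 0 - fst Y \<eta>)) (pullback_deriv Y f)
     (\<lambda>\<eta>. f' (fst Y' 0 - fst Y' \<eta>)) (pullback_deriv Y' f')"
    unfolding N_def by (rule near_controlled_pullback[OF r Y f _ refl]) (use assms(4) in auto)
  have g: "0 < \<gamma>" using assms(4) by simp
  have I: "0 \<in> {0..1::real}" "1 \<in> {0..1::real}" "\<bar>1 - 0\<bar> \<le> (1::real)" by auto
  have "near (3 * (3 * (2 * (2 * N * M) * (M * (1 powr \<gamma> * 1 powr \<gamma>))))) e
    (germ W (\<lambda>\<eta>. f (fst Y 0 - fst Y \<eta>)) (pullback_deriv Y f) (coord Y j) (dcoord Y j) 0 1)
    (germ W' (\<lambda>\<eta>. f' (fst Y' 0 - fst Y' \<eta>)) (pullback_deriv Y' f') (coord Y' j) (dcoord Y' j) 0 1)"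
    unfolding germ_def closed mult_zero_right add_0
    by (intro near_sum3 near_mult near_controlledD(1)[OF pull g M(2) I]
       near_controlledD(1)[OF ctrl g M(2) I] near_rough_pathsD(2)[OF r g I])
  from near_add[OF rough_integral_near_germ[OF r pull ctrl assms(4), of 0 1] this]
  have "near (sewing_const (3 * \<gamma>) * (170 * (N * M * (M * M))) + 36 * N * (M * M)) e
      (loop_integral W Y j f) (loop_integral W' Y' j f')"
    by (simp add: loop_integral_def mult_ac)
  moreover have "sewing_const (3 * \<gamma>) * (170 * (N * M * (M * M))) + 36 * N * (M * M) = loop_const \<gamma> M * K"
    by (simp add: loop_const_def N_def algebra_simps)
  ultimately show ?thesis by simp
qed

section \<open>The velocity field along a controlled path\<close>

lemma loop_integral_bound:
  assumes "near_rough_paths \<gamma> M 0 X W X W" "near_closed_paths \<gamma> M 0 X X Y Y" "derivs_bounded 3 K f" "1 / 3 < \<gamma>"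
  shows "\<bar>loop_integral W Y j f\<bar> \<le> loop_const \<gamma> M * K"
  using loop_integral_near[OF assms(1,2) near_fields_self[OF assms(3)] assms(4)] by (simp add: near_def)

lemma loop_sum_tendsto:
  assumes r: "near_rough_paths \<gamma> M 0 X W X W" and Y: "near_closed_paths \<gamma> M 0 X X Y Y"
    and f: "derivs_bounded 3 K f" and "1 / 3 < \<gamma>"
  shows "(rough_sum W (\<lambda>\<eta>. f (fst Y 0 - fst Y \<eta>)) (pullback_deriv Y f) (coord Y j) (dcoord Y j)
     \<longlongrightarrow> loop_integral W Y j f) (mesh_to_0 0 1)"
  unfolding loop_integral_def
proof (rule rough_sum_tendsto[OF r near_controlled_pullback[OF r Y near_fields_self[OF f] _ refl]])
  show "near_controlled \<gamma> M 0 X X (coord Y j) (dcoord Y j) (coord Y j) (dcoord Y j)"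
    using Y by (simp add: near_closed_paths_def)
qed (use assms in auto)

lemma rough_sum_diff:
  "rough_sum W (\<lambda>\<eta>. F \<eta> - F' \<eta>) (\<lambda>\<eta>. G \<eta> - G' \<eta>) Z H p = rough_sum W F G Z H p - rough_sum W F' G' Z H p"
  unfolding rough_sum_def sum_subtractf[symmetric]
  by (intro sum.cong refl) (simp add: left_diff_distrib sum_subtractf)

lemma rough_sum_sum:
  "rough_sum W (\<lambda>\<eta>. \<Sum>i\<in>I. c i * F i \<eta>) (\<lambda>\<eta>. \<Sum>i\<in>I. c i *\<^sub>R G i \<eta>) Z H p = (\<Sum>i\<in>I. c i * rough_sum W (F i) (G i) Z H p)"
proof (induction I rule: infinite_finite_induct)
  case (insert i I)
  have add: "rough_sum W (\<lambda>\<eta>. c i * F i \<eta> + F' \<eta>) (\<lambda>\<eta>. c i *\<^sub>R G i \<eta> + G' \<eta>) Z H p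
      = c i * rough_sum W (F i) (G i) Z H p + rough_sum W F' G' Z H p" for F' G'
    unfolding rough_sum_def sum_distrib_left sum.distrib[symmetric]
    by (intro sum.cong refl) (simp add: distrib_left distrib_right sum.distrib sum_distrib_left mult_ac)
  show ?case using insert by (simp add: add)
qed (simp_all add: rough_sum_def)

lemma loop_integral_diff:
  assumes r: "near_rough_paths \<gamma> M 0 X W X W" and Y: "near_closed_paths \<gamma> M 0 X X Y Y"
    and f: "derivs_bounded 3 K f" and g: "derivs_bounded 3 K g" and "1 / 3 < \<gamma>"
  shows "loop_integral W Y j (\<lambda>y. f y - g y) = loop_integral W Y j f - loop_integral W Y j g"
proof -
  have d: "f differentiable at y" "g differentiable at y" for y
    using f g derivs_bounded_differentiable by (auto simp: numeral_3_eq_3)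
  have "partial_deriv b (\<lambda>y. f y - g y) y = partial_deriv b f y - partial_deriv b g y" for b y
    by (subst gradient_field_partial_deriv[OF gradient_field_diff[OF gradient_fieldI gradient_fieldI]]) (use d in auto)
  then have "pullback_deriv Y (\<lambda>y. f y - g y) = (\<lambda>\<eta>. pullback_deriv Y f \<eta> - pullback_deriv Y g \<eta>)"
    by (auto simp: pullback_deriv_def vec_eq_iff sum_subtractf left_diff_distrib)
  then have "(\<lambda>p. rough_sum W (\<lambda>\<eta>. f (fst Y 0 - fst Y \<eta>)) (pullback_deriv Y f) (coord Y j) (dcoord Y j) p
        - rough_sum W (\<lambda>\<eta>. g (fst Y 0 - fst Y \<eta>)) (pullback_deriv Y g) (coord Y j) (dcoord Y j) p)
      = rough_sum W (\<lambda>\<eta>. f (fst Y 0 - fst Y \<eta>) - g (fst Y 0 - fst Y \<eta>)) (pullback_deriv Y (\<lambda>y. f y - g y)) (coord Y j) (dcoord Y j)"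
    by (auto simp: rough_sum_diff)
  from tendsto_diff[OF loop_sum_tendsto[OF r Y f assms(5)] loop_sum_tendsto[OF r Y g assms(5)], of j j, unfolded this]
  show ?thesis
    using tendsto_unique[OF mesh_to_0_neq_bot loop_sum_tendsto[OF r Y derivs_bounded_diff[OF f g] assms(5)]] by simp
qed

text \<open>Taylor remainders depend linearly on shifts of the field and of its derivatives, and so do the sums
  over each partition, with the derivatives of the integrand transforming accordingly.\<close>

lemma loop_integral_taylor_rem:
  assumes r: "near_rough_paths \<gamma> M 0 X W X W" and Y: "near_closed_paths \<gamma> M 0 X X Y Y"
    and f: "derivs_bounded 5 K f" and "1 / 3 < \<gamma>"
  shows "loop_integral W Y j (\<lambda>y. taylor_rem f (p + y) (q + y))
    = loop_integral W Y j (\<lambda>y. f (q + y)) - loop_integral W Y j (\<lambda>y. f (p + y))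
      - (\<Sum>k\<in>UNIV. (q $ k - p $ k) * loop_integral W Y j (\<lambda>y. partial_deriv k f (p + y)))"
proof -
  let ?S = "\<lambda>f. rough_sum W (\<lambda>\<eta>. f (fst Y 0 - fst Y \<eta>)) (pullback_deriv Y f) (coord Y j) (dcoord Y j)"
  have f3: "derivs_bounded (Suc (Suc (Suc 2))) K f" using f by simp
  note g = derivs_bounded_partial_deriv[OF f3]
  have f': "derivs_bounded 3 K f" by (rule derivs_bounded_mono[OF f]) auto
  have g': "derivs_bounded 3 K (partial_deriv k f)" for k by (rule derivs_bounded_mono[OF g]) auto
  have "derivs_bounded (3 + 2) K f" using f by simp
  from derivs_bounded_taylor_rem[OF this, of q p "norm (q - p)"]
  have t: "derivs_bounded 3 (9 * (norm (q - p) * norm (q - p) * K)) (\<lambda>y. taylor_rem f (p + y) (q + y))"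
    using component_le_norm_cart[of "q - p"] by simp
  have tend: "(?S (\<lambda>y. f (a + y)) \<longlongrightarrow> loop_integral W Y j (\<lambda>y. f (a + y))) (mesh_to_0 0 1)"
    "(?S (\<lambda>y. partial_deriv k f (a + y)) \<longlongrightarrow> loop_integral W Y j (\<lambda>y. partial_deriv k f (a + y))) (mesh_to_0 0 1)" for a k
    using loop_sum_tendsto[OF r Y derivs_bounded_shift[OF f'] assms(4)]
      loop_sum_tendsto[OF r Y derivs_bounded_shift[OF g'] assms(4)] by blast+
  have shift: "partial_deriv b (\<lambda>y. f (a + y)) y = partial_deriv b f (a + y)"
    "partial_deriv b (\<lambda>y. partial_deriv k f (a + y)) y = partial_deriv b (partial_deriv k f) (a + y)" for a b k y
    by (subst gradient_field_partial_deriv[OF gradient_field_shift[OF gradient_fieldI]],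
        use derivs_bounded_differentiable[OF f3] derivs_bounded_differentiable[OF g] in auto)+
  have tay: "partial_deriv b (\<lambda>y. taylor_rem f (p + y) (q + y)) y = taylor_rem (partial_deriv b f) (p + y) (q + y)" for b y
    by (subst gradient_field_partial_deriv[OF gradient_field_taylor_rem[OF f3]]) simp
  have G: "pullback_deriv Y (\<lambda>y. taylor_rem f (p + y) (q + y))
     = (\<lambda>\<eta>. pullback_deriv Y (\<lambda>y. f (q + y)) \<eta> - pullback_deriv Y (\<lambda>y. f (p + y)) \<eta>
          - (\<Sum>k\<in>UNIV. (q $ k - p $ k) *\<^sub>R pullback_deriv Y (\<lambda>y. partial_deriv k f (p + y)) \<eta>))"
  proof (rule ext, subst vec_eq_iff, rule allI)
    fix \<eta> a
    let ?y = "fst Y 0 - fst Y \<eta>" and ?D = "\<lambda>b. snd Y \<eta> $ b $ a"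
    have "(\<Sum>b\<in>UNIV. taylor_rem (partial_deriv b f) (p + ?y) (q + ?y) * ?D b)
       = (\<Sum>b\<in>UNIV. partial_deriv b f (q + ?y) * ?D b) - (\<Sum>b\<in>UNIV. partial_deriv b f (p + ?y) * ?D b)
         - (\<Sum>b\<in>UNIV. \<Sum>k\<in>UNIV. (q $ k - p $ k) * (partial_deriv b (partial_deriv k f) (p + ?y) * ?D b))"
      unfolding sum_subtractf[symmetric] taylor_rem_def partial_deriv_commute[OF f3, of _ _ "p + ?y"]
      by (intro sum.cong refl) (simp add: algebra_simps sum_distrib_left sum_distrib_right sum_subtractf)
    also have "(\<Sum>b\<in>UNIV. \<Sum>k\<in>UNIV. (q $ k - p $ k) * (partial_deriv b (partial_deriv k f) (p + ?y) * ?D b))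
        = (\<Sum>k\<in>UNIV. (q $ k - p $ k) * (\<Sum>b\<in>UNIV. partial_deriv b (partial_deriv k f) (p + ?y) * ?D b))"
      by (subst sum.swap) (simp add: sum_distrib_left)
    finally show "pullback_deriv Y (\<lambda>y. taylor_rem f (p + y) (q + y)) \<eta> $ a
      = (pullback_deriv Y (\<lambda>y. f (q + y)) \<eta> - pullback_deriv Y (\<lambda>y. f (p + y)) \<eta>
          - (\<Sum>k\<in>UNIV. (q $ k - p $ k) *\<^sub>R pullback_deriv Y (\<lambda>y. partial_deriv k f (p + y)) \<eta>)) $ a"
      by (simp add: pullback_deriv_def tay shift sum_negf)
  qed
  have "?S (\<lambda>y. taylor_rem f (p + y) (q + y))
    = (\<lambda>P. ?S (\<lambda>y. f (q + y)) P - ?S (\<lambda>y. f (p + y)) P - (\<Sum>k\<in>UNIV. (q $ k - p $ k) * ?S (\<lambda>y. partial_deriv k f (p + y)) P))"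
    unfolding G rough_sum_diff[symmetric] rough_sum_sum[symmetric] by (simp add: taylor_rem_def)
  moreover have "((\<lambda>P. ?S (\<lambda>y. f (q + y)) P - ?S (\<lambda>y. f (p + y)) P - (\<Sum>k\<in>UNIV. (q $ k - p $ k) * ?S (\<lambda>y. partial_deriv k f (p + y)) P))
     \<longlongrightarrow> loop_integral W Y j (\<lambda>y. f (q + y)) - loop_integral W Y j (\<lambda>y. f (p + y))
      - (\<Sum>k\<in>UNIV. (q $ k - p $ k) * loop_integral W Y j (\<lambda>y. partial_deriv k f (p + y)))) (mesh_to_0 0 1)"
    by (intro tendsto_diff tendsto_sum tendsto_mult tendsto_const tend)
  ultimately show ?thesis
    using tendsto_unique[OF mesh_to_0_neq_bot loop_sum_tendsto[OF r Y t assms(4)]] by simp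
qed

definition velocity_grad :: "(vec3 \<Rightarrow> mat3) \<Rightarrow> (real \<Rightarrow> real \<Rightarrow> mat3) \<Rightarrow> cpath \<Rightarrow> vec3 \<Rightarrow> mat3" where
  "velocity_grad A W Y x = (\<chi> i k. \<Sum>j\<in>UNIV.
     loop_integral W Y j (\<lambda>y. partial_deriv k (\<lambda>z. A z $ i $ j) (x - fst Y 0 + y)))"

lemma velocity_eq_loop_integral:
  assumes A: "\<And>i j. derivs_bounded 5 K (\<lambda>z. A z $ i $ j)"
  shows "velocity A W Y x $ i = (\<Sum>j\<in>UNIV. loop_integral W Y j (\<lambda>y. A (x - fst Y 0 + y) $ i $ j))"
proof -
  have "gradient_field (\<lambda>z. A z $ i $ j) (\<lambda>k. partial_deriv k (\<lambda>z. A z $ i $ j))" for j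
    by (rule gradient_fieldI derivs_bounded_differentiable)+ (use A[of i j] in \<open>simp add: eval_nat_numeral\<close>)
  from gradient_field_partial_deriv[OF gradient_field_shift[OF this]]
  have "partial_deriv b (\<lambda>y. A (x - fst Y 0 + y) $ i $ j) = (\<lambda>y. partial_deriv b (\<lambda>z. A z $ i $ j) (x - fst Y 0 + y))" for b j
    by simp
  then show ?thesis
    by (simp add: velocity_def loop_integral_def pullback_deriv_def[abs_def] case_prod_unfold)
qed

lemma has_derivativeI_quadratic:
  fixes f :: "vec3 \<Rightarrow> real"
  assumes "bounded_linear L" "\<And>h. \<bar>f (x + h) - f x - L h\<bar> \<le> C * (norm h * norm h)"
  shows "(f has_derivative L) (at x)"
  unfolding has_derivative_at
proof (intro conjI)
  show "(\<lambda>h. norm (f (x + h) - f x - L h) / norm h) \<midarrow>0\<rightarrow> 0"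
  proof (rule tendsto_sandwich)
    show "(\<lambda>h::vec3. 0::real) \<midarrow>0\<rightarrow> 0" by simp
    show "(\<lambda>h::vec3. C * norm h) \<midarrow>0\<rightarrow> 0" by (auto intro!: tendsto_eq_intros)
    show "\<forall>\<^sub>F h in at 0. norm (f (x + h) - f x - L h) / norm h \<le> C * norm h"
      unfolding eventually_at_filter using assms(2) by (intro always_eventually) (auto simp: field_simps)
  qed auto
qed fact

text \<open>This one identity serves twice: with the remainder of order \<open>norm h * norm h\<close> it identifies the
  gradient of the velocity, and along \<open>Y\<close> it is the remainder of the velocity as a controlled path.\<close>

lemma velocity_taylor:
  assumes r: "near_rough_paths \<gamma> M 0 X W X W" and Y: "near_closed_paths \<gamma> M 0 X X Y Y"
    and A: "\<And>i j. derivs_bounded 5 K (\<lambda>z. A z $ i $ j)" and "1 / 3 < \<gamma>"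
  shows "velocity A W Y q $ i - velocity A W Y p $ i - (\<Sum>k\<in>UNIV. (q $ k - p $ k) * velocity_grad A W Y p $ i $ k)
    = (\<Sum>j\<in>UNIV. loop_integral W Y j (\<lambda>y. taylor_rem (\<lambda>z. A z $ i $ j) (p - fst Y 0 + y) (q - fst Y 0 + y)))"
proof -
  have "(\<Sum>k\<in>UNIV. (q $ k - p $ k) * velocity_grad A W Y p $ i $ k)
      = (\<Sum>j\<in>UNIV. \<Sum>k\<in>UNIV. (q $ k - p $ k) * loop_integral W Y j (\<lambda>y. partial_deriv k (\<lambda>z. A z $ i $ j) (p - fst Y 0 + y)))"
    by (subst sum.swap) (simp add: velocity_grad_def sum_distrib_left)
  then show ?thesis
    unfolding velocity_eq_loop_integral[OF A]
    by (simp add: loop_integral_taylor_rem[OF r Y A assms(4)] sum_subtractf)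
qed

lemma grad_velocity:
  assumes r: "near_rough_paths \<gamma> M 0 X W X W" and Y: "near_closed_paths \<gamma> M 0 X X Y Y"
    and A: "\<And>i j. derivs_bounded 5 K (\<lambda>z. A z $ i $ j)" and "1 / 3 < \<gamma>"
  shows "grad (velocity A W Y) x = velocity_grad A W Y x"
proof -
  have "((\<lambda>z. velocity A W Y z $ i) has_derivative (\<lambda>h. \<Sum>k\<in>UNIV. h $ k * velocity_grad A W Y x $ i $ k)) (at x)" for i
  proof (rule has_derivativeI_quadratic)
    show "bounded_linear (\<lambda>h. \<Sum>k\<in>UNIV. h $ k * velocity_grad A W Y x $ i $ k)"
      by (intro bounded_linear_sum bounded_linear_mult_const bounded_linear_vec_nth)
    fix h :: vec3
    have "\<bar>loop_integral W Y j (\<lambda>y. taylor_rem (\<lambda>z. A z $ i $ j) (x - fst Y 0 + y) ((x + h) - fst Y 0 + y))\<bar>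
        \<le> loop_const \<gamma> M * (9 * (norm h * norm h * K))" for j
      by (rule loop_integral_bound[OF r Y derivs_bounded_taylor_rem assms(4)])
         (use A[of i j] component_le_norm_cart[of h] in auto)
    then have "\<bar>\<Sum>j\<in>UNIV. loop_integral W Y j (\<lambda>y. taylor_rem (\<lambda>z. A z $ i $ j) (x - fst Y 0 + y) ((x + h) - fst Y 0 + y))\<bar>
        \<le> 3 * (loop_const \<gamma> M * (9 * (norm h * norm h * K)))"
      by (rule abs_sum3_le)
    then show "\<bar>velocity A W Y (x + h) $ i - velocity A W Y x $ i - (\<Sum>k\<in>UNIV. h $ k * velocity_grad A W Y x $ i $ k)\<bar>
        \<le> (27 * loop_const \<gamma> M * K) * (norm h * norm h)"
      using velocity_taylor[OF r Y A assms(4), of "x + h" i x] by (simp add: mult_ac)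
  qed
  from partial_deriv_eqI[OF this] have "partial_deriv k (\<lambda>z. velocity A W Y z $ i) x = velocity_grad A W Y x $ i $ k" for i k
    by (simp add: axis_def if_distrib[of "\<lambda>c. c * _"] cong: if_cong)
  then show ?thesis by (simp add: grad_def vec_eq_iff)
qed

definition velocity_const :: "real \<Rightarrow> real \<Rightarrow> real \<Rightarrow> real" where
  "velocity_const \<gamma> M K = 270 * loop_const \<gamma> M * K * (7 * M * M * (7 * M * M) * (7 * M * M)) * M"

lemma velocity_const_nonneg: "1 / 3 < \<gamma> \<Longrightarrow> 1 \<le> M \<Longrightarrow> 0 \<le> K \<Longrightarrow> 0 \<le> velocity_const \<gamma> M K"
  using loop_const_nonneg[of \<gamma> M] by (simp add: velocity_const_def)

text \<open>The velocity along \<open>Y\<close> is controlled with derivative \<open>\<nabla>V(Y) Y'\<close>: its remainder is the Taylor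
  remainder of \<open>V\<close> plus \<open>\<nabla>V(Y)\<close> applied to the remainder of \<open>Y\<close>. By linearity all these quantities
  are loop integrals of shifts, increments and Taylor remainders of \<open>A\<close>.\<close>

lemma near_velocity:
  assumes r: "near_rough_paths \<gamma> M e X W X' W'" and Y: "near_closed_paths \<gamma> M e X X' Y Y'"
    and A: "\<And>i j. derivs_bounded 5 K (\<lambda>z. A z $ i $ j)" and g: "1 / 3 < \<gamma>"
  shows "near_controlled \<gamma> (velocity_const \<gamma> M K) e X X'
    (\<lambda>\<xi>. velocity A W Y (fst Y \<xi>) $ i) (\<lambda>\<xi>. (grad (velocity A W Y) (fst Y \<xi>) ** snd Y \<xi>) $ i)
    (\<lambda>\<xi>. velocity A W' Y' (fst Y' \<xi>) $ i) (\<lambda>\<xi>. (grad (velocity A W' Y') (fst Y' \<xi>) ** snd Y' \<xi>) $ i)"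
  unfolding near_controlled_def
proof (intro ballI allI conjI)
  note r1 = near_rough_paths_self[OF r] and r2 = near_rough_paths_self[OF near_rough_paths_sym[OF r]]
  note Y1 = near_closed_paths_self[OF Y] and Y2 = near_closed_paths_self[OF near_closed_paths_sym[OF Y]]
  fix a b :: real and k assume I: "a \<in> {0..1}" "b \<in> {0..1}"
  define H where "H = 7 * M * M"
  define s where "s = \<bar>b - a\<bar> powr \<gamma>"
  define \<Lambda> where "\<Lambda> = loop_const \<gamma> M"
  have s: "0 \<le> s" by (simp add: s_def)
  have g0: "0 < \<gamma>" using g by simp
  have M: "1 \<le> M" "0 \<le> e" using r by (auto simp: near_rough_paths_def)
  have A5: "derivs_bounded (Suc 4) K (\<lambda>z. A z $ i $ j)" for i j using A[of i j] by simp
  have A4: "derivs_bounded 4 K (partial_deriv l (\<lambda>z. A z $ i $ j))" for i j l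
    by (rule derivs_bounded_partial_deriv[OF A5])
  have A3: "derivs_bounded 3 K (partial_deriv l (\<lambda>z. A z $ i $ j))" for i j l
    by (rule derivs_bounded_mono[OF A4]) auto
  have K: "0 \<le> K" using derivs_bounded_nonneg[OF A5] .
  have pts: "near_points H s e (fst Y a - fst Y 0) (fst Y b - fst Y 0) (fst Y' a - fst Y' 0) (fst Y' b - fst Y' 0)"
    using near_increment_points(1)[OF r Y g0 I] by (simp add: H_def s_def)
  have H1: "1 \<le> H" and
    diff: "\<bar>(fst Y c - fst Y 0) $ k - (fst Y' c - fst Y' 0) $ k\<bar> \<le> H * e" if "c \<in> {0..1}" for c k
    using near_increment_points(1)[OF r Y g0 that that] by (auto simp: H_def near_points_def)
  have H1: "1 \<le> H" using H1[OF I(1)] .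
  let ?G = "\<lambda>c l. velocity_grad A W Y (fst Y c) $ i $ l"
  let ?G' = "\<lambda>c l. velocity_grad A W' Y' (fst Y' c) $ i $ l"
  have G: "near (3 * (\<Lambda> * (3 * K * H))) e (?G c l) (?G' c l)" if "c \<in> {0..1}" for c l
    unfolding velocity_grad_def vec_lambda_beta \<Lambda>_def
    by (intro near_sum3 loop_integral_near[OF r Y _ g] near_fields_shift[OF A3 H1 M(2)] diff[OF that])
  have Gdiff: "near (3 * (\<Lambda> * (12 * K * (H * H) * s))) e (?G b l - ?G a l) (?G' b l - ?G' a l)" for l
  proof -
    have "?G b l - ?G a l = (\<Sum>j\<in>UNIV. loop_integral W Y j (\<lambda>y. partial_deriv l (\<lambda>z. A z $ i $ j) (fst Y b - fst Y 0 + y)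
         - partial_deriv l (\<lambda>z. A z $ i $ j) (fst Y a - fst Y 0 + y)))"
      "?G' b l - ?G' a l = (\<Sum>j\<in>UNIV. loop_integral W' Y' j (\<lambda>y. partial_deriv l (\<lambda>z. A z $ i $ j) (fst Y' b - fst Y' 0 + y)
         - partial_deriv l (\<lambda>z. A z $ i $ j) (fst Y' a - fst Y' 0 + y)))"
      by (simp_all add: velocity_grad_def sum_subtractf
          loop_integral_diff[OF r1 Y1 derivs_bounded_shift[OF A3] derivs_bounded_shift[OF A3] g]
          loop_integral_diff[OF r2 Y2 derivs_bounded_shift[OF A3] derivs_bounded_shift[OF A3] g])
    then show ?thesis
      unfolding \<Lambda>_def
      by (simp only:) (intro near_sum3 loop_integral_near[OF r Y _ g] near_fields_shift_diff[OF A4 pts])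
  qed
  have ctrl: "near_controlled \<gamma> M e X X' (coord Y i) (dcoord Y i) (coord Y' i) (dcoord Y' i)" for i
    using near_closed_pathsD[OF Y] .
  note D = near_controlledD[OF ctrl g0 M(2) I order_refl, folded s_def]
  have mm: "(grad (velocity A W Y) x ** B) $ i $ k = (\<Sum>l\<in>UNIV. velocity_grad A W Y x $ i $ l * B $ l $ k)"
    "(grad (velocity A W' Y') x ** B) $ i $ k = (\<Sum>l\<in>UNIV. velocity_grad A W' Y' x $ i $ l * B $ l $ k)" for x B k
    unfolding grad_velocity[OF r1 Y1 A g] grad_velocity[OF r2 Y2 A g] by (simp_all add: matrix_matrix_mult_def)
  define Q where "Q = \<Lambda> * K * H * M"
  have L: "0 \<le> \<Lambda>" using loop_const_nonneg[OF g M(1)] by (simp add: \<Lambda>_def)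
  have Q0: "0 \<le> Q" using L K H1 M by (simp add: Q_def)
  have Q1: "Q \<le> Q * H" "Q * H \<le> Q * H * H" using Q0 H1 by (auto intro!: le_mult_right)
  have QM: "\<Lambda> * K * (H * H * H) \<le> Q * H * H"
    using le_mult_right[OF _ M(1), of "\<Lambda> * K * (H * H * H)"] L K H1 by (simp add: Q_def mult_ac)
  have c: "velocity_const \<gamma> M K = 270 * (Q * H * H)"
    by (simp add: Q_def H_def \<Lambda>_def velocity_const_def algebra_simps)
  let ?w = "\<lambda>c. (grad (velocity A W Y) (fst Y c) ** snd Y c) $ i"
  let ?w' = "\<lambda>c. (grad (velocity A W' Y') (fst Y' c) ** snd Y' c) $ i"
  have "near (3 * (2 * (3 * (\<Lambda> * (3 * K * H))) * M)) e (?w a $ k) (?w' a $ k)"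
    unfolding mm by (intro near_sum3 near_mult G D(1) I)
  then show "near (velocity_const \<gamma> M K) e (?w a $ k) (?w' a $ k)"
    unfolding c by (rule near_weaken) (use Q0 Q1 M in \<open>simp_all add: Q_def algebra_simps\<close>)
  have eq: "?w b $ k - ?w a $ k = (\<Sum>l\<in>UNIV. ?G b l * (snd Y b $ l $ k - snd Y a $ l $ k) + (?G b l - ?G a l) * snd Y a $ l $ k)"
    "?w' b $ k - ?w' a $ k = (\<Sum>l\<in>UNIV. ?G' b l * (snd Y' b $ l $ k - snd Y' a $ l $ k) + (?G' b l - ?G' a l) * snd Y' a $ l $ k)"
    unfolding mm by (simp_all add: sum_subtractf sum.distrib algebra_simps)
  have "near (3 * (2 * (3 * (\<Lambda> * (3 * K * H))) * (M * s) + 2 * (3 * (\<Lambda> * (12 * K * (H * H) * s))) * M)) e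
      (?w b $ k - ?w a $ k) (?w' b $ k - ?w' a $ k)"
    unfolding eq by (intro near_sum3 near_add near_mult G Gdiff D(1,2) I)
  moreover have "3 * (2 * (3 * (\<Lambda> * (3 * K * H))) * (M * s) + 2 * (3 * (\<Lambda> * (12 * K * (H * H) * s))) * M) = (54 * Q + 216 * (Q * H)) * s"
    by (simp add: Q_def algebra_simps)
  moreover have "(54 * Q + 216 * (Q * H)) * s \<le> (270 * (Q * H * H)) * s"
    using Q1 s by (intro mult_right_mono) auto
  ultimately show "near (velocity_const \<gamma> M K * \<bar>b - a\<bar> powr \<gamma>) e (?w b $ k - ?w a $ k) (?w' b $ k - ?w' a $ k)"
    unfolding c s_def[symmetric] using near_weaken M(2) by fastforce
  have rem: "ctrl_rem X (\<lambda>\<xi>. velocity A W Y (fst Y \<xi>) $ i) (\<lambda>c. (velocity_grad A W Y (fst Y c) ** snd Y c) $ i) a b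
     = (\<Sum>j\<in>UNIV. loop_integral W Y j (\<lambda>y. taylor_rem (\<lambda>z. A z $ i $ j) (fst Y a - fst Y 0 + y) (fst Y b - fst Y 0 + y)))
       + (\<Sum>l\<in>UNIV. velocity_grad A W Y (fst Y a) $ i $ l * ctrl_rem X (coord Y l) (dcoord Y l) a b)"
    if "near_rough_paths \<gamma> M 0 X W X W" "near_closed_paths \<gamma> M 0 X X Y Y" for X W Y
  proof -
    have "(\<Sum>k\<in>UNIV. (velocity_grad A W Y (fst Y a) ** snd Y a) $ i $ k * (X b $ k - X a $ k))
       = (\<Sum>k\<in>UNIV. \<Sum>l\<in>UNIV. velocity_grad A W Y (fst Y a) $ i $ l * (snd Y a $ l $ k * (X b $ k - X a $ k)))"
      by (simp add: matrix_matrix_mult_def sum_distrib_left sum_distrib_right mult_ac)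
    also have "\<dots> = (\<Sum>l\<in>UNIV. \<Sum>k\<in>UNIV. velocity_grad A W Y (fst Y a) $ i $ l * (snd Y a $ l $ k * (X b $ k - X a $ k)))"
      by (rule sum.swap)
    also have "\<dots> = (\<Sum>l\<in>UNIV. velocity_grad A W Y (fst Y a) $ i $ l * (\<Sum>k\<in>UNIV. snd Y a $ l $ k * (X b $ k - X a $ k)))"
      by (simp add: sum_distrib_left)
    finally show ?thesis
      unfolding ctrl_rem_def velocity_taylor[OF that A g, symmetric] right_diff_distrib sum_subtractf
      by (simp add: sum_subtractf algebra_simps)
  qed
  have rem': "ctrl_rem X (\<lambda>\<xi>. velocity A W Y (fst Y \<xi>) $ i) ?w a b
     = (\<Sum>j\<in>UNIV. loop_integral W Y j (\<lambda>y. taylor_rem (\<lambda>z. A z $ i $ j) (fst Y a - fst Y 0 + y) (fst Y b - fst Y 0 + y)))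
       + (\<Sum>l\<in>UNIV. ?G a l * ctrl_rem X (coord Y l) (dcoord Y l) a b)"
    "ctrl_rem X' (\<lambda>\<xi>. velocity A W' Y' (fst Y' \<xi>) $ i) ?w' a b
     = (\<Sum>j\<in>UNIV. loop_integral W' Y' j (\<lambda>y. taylor_rem (\<lambda>z. A z $ i $ j) (fst Y' a - fst Y' 0 + y) (fst Y' b - fst Y' 0 + y)))
       + (\<Sum>l\<in>UNIV. ?G' a l * ctrl_rem X' (coord Y' l) (dcoord Y' l) a b)"
    using rem[OF r1 Y1] rem[OF r2 Y2] unfolding grad_velocity[OF r1 Y1 A g] grad_velocity[OF r2 Y2 A g] by simp_all
  have "near (3 * (\<Lambda> * (36 * K * (H * H * H) * (s * s))) + 3 * (2 * (3 * (\<Lambda> * (3 * K * H))) * (M * (s * s)))) e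
     (ctrl_rem X (\<lambda>\<xi>. velocity A W Y (fst Y \<xi>) $ i) ?w a b) (ctrl_rem X' (\<lambda>\<xi>. velocity A W' Y' (fst Y' \<xi>) $ i) ?w' a b)"
    unfolding rem' \<Lambda>_def
    by (intro near_add near_sum3 near_mult D(3) G[unfolded \<Lambda>_def] I loop_integral_near[OF r Y _ g] near_fields_taylor_rem[OF A pts])
  moreover have "3 * (\<Lambda> * (36 * K * (H * H * H) * (s * s))) + 3 * (2 * (3 * (\<Lambda> * (3 * K * H))) * (M * (s * s)))
      = (108 * (\<Lambda> * K * (H * H * H)) + 54 * Q) * (s * s)"
    by (simp add: Q_def algebra_simps)
  moreover have "(108 * (\<Lambda> * K * (H * H * H)) + 54 * Q) * (s * s) \<le> (270 * (Q * H * H)) * (s * s)"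
    using Q1 QM Q0 s by (intro mult_right_mono) auto
  ultimately show "near (velocity_const \<gamma> M K * \<bar>b - a\<bar> powr (2 * \<gamma>)) e
     (ctrl_rem X (\<lambda>\<xi>. velocity A W Y (fst Y \<xi>) $ i) ?w a b) (ctrl_rem X' (\<lambda>\<xi>. velocity A W' Y' (fst Y' \<xi>) $ i) ?w' a b)"
    unfolding c powr_double s_def[symmetric] using near_weaken M(2) by fastforce
qed

section \<open>Lifting a controlled path to a rough path\<close>

lemma rough_integral_flip:
  assumes c: "near_rough_paths \<gamma> M e X W X' W'"
    "near_controlled \<gamma> N e X X' F G F' G'" "near_controlled \<gamma> L e X X' Z H Z' H'" "1 / 3 < \<gamma>"
    and "a \<in> {0..1}" "b \<in> {0..1}"
  shows "rough_integral W F G Z H b a = - rough_integral W F G Z H a b"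
proof (cases "a = b")
  case True
  then show ?thesis using rough_integral_additive[OF c, of a a a] assms by simp
qed (auto simp: rough_integral_def)

lemma rough_integral_additive_any_order:
  assumes c: "near_rough_paths \<gamma> M e X W X' W'"
    "near_controlled \<gamma> N e X X' F G F' G'" "near_controlled \<gamma> L e X X' Z H Z' H'" "1 / 3 < \<gamma>"
    and I: "a \<in> {0..1}" "b \<in> {0..1}" "d \<in> {0..1}"
  shows "rough_integral W F G Z H a b = rough_integral W F G Z H a d + rough_integral W F G Z H d b"
proof -
  note add = rough_integral_additive[OF c]
  note flip = rough_integral_flip[OF c]
  consider "a \<le> d" "d \<le> b" | "a \<le> b" "b \<le> d" | "d \<le> a" "a \<le> b" | "b \<le> a" "a \<le> d" | "b \<le> d" "d \<le> a" | "d \<le> b" "b \<le> a"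
    by linarith
  then show ?thesis
  proof cases
    case 1
    then show ?thesis using add[of a d b] I by simp
  next
    case 2
    then show ?thesis using add[of a b d] flip[of b d] I by simp
  next
    case 3
    then show ?thesis using add[of d a b] flip[of d a] I by simp
  next
    case 4
    then show ?thesis using add[of b a d] flip[of b a] flip[of b d] I by simp
  next
    case 5
    then show ?thesis using add[of b d a] flip[of b a] flip[of b d] flip[of d a] I by simp
  next
    case 6
    then show ?thesis using add[of d b a] flip[of b a] flip[of d a] I by simp
  qed
qed

lemma chain_sum_telescope: "p \<in> partitions a b \<Longrightarrow> chain_sum (\<lambda>x y. Z y - Z x) p = Z b - Z a"
proof (induction p arbitrary: a rule: induct_list012)
  case (3 x y p)
  then have "x = a" by (simp add: partitions_def)
  then show ?case using "3.IH"(2)[of y] "3.prems" partitions_Cons_Cons[of a y p b] by simp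
qed (auto simp: partitions_def)

lemma rough_integral_minus_const:
  assumes c: "near_rough_paths \<gamma> M e X W X' W'"
    "near_controlled \<gamma> N e X X' F G F' G'" "near_controlled \<gamma> L e X X' Z H Z' H'" "1 / 3 < \<gamma>"
    and I: "a \<in> {0..1}" "b \<in> {0..1}"
  shows "rough_integral W (\<lambda>\<eta>. F \<eta> - k) G Z H a b = rough_integral W F G Z H a b - k * (Z b - Z a)"
proof -
  have le: "Lim (mesh_to_0 a b) (rough_sum W (\<lambda>\<eta>. F \<eta> - k) G Z H) = Lim (mesh_to_0 a b) (rough_sum W F G Z H) - k * (Z b - Z a)"
    if ab: "0 \<le> a" "a \<le> b" "b \<le> 1" for a b
  proof -
    have eq: "rough_sum W (\<lambda>\<eta>. F \<eta> - k) G Z H p = rough_sum W F G Z H p - k * (Z b - Z a)"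
      if p: "p \<in> partitions a b" for p
    proof -
      have "rough_sum W (\<lambda>\<eta>. F \<eta> - k) G Z H p = rough_sum W F G Z H p - k * chain_sum (\<lambda>x y. Z y - Z x) p"
        unfolding rough_sum_def chain_sum_def sum_distrib_left sum_subtractf[symmetric]
        by (intro sum.cong refl) (simp add: algebra_simps)
      then show ?thesis using chain_sum_telescope[OF p] by simp
    qed
    have "(rough_sum W F G Z H \<longlongrightarrow> Lim (mesh_to_0 a b) (rough_sum W F G Z H)) (mesh_to_0 a b)"
      using rough_sum_tendsto[OF c ab] ab by (simp add: rough_integral_def)
    then have "((\<lambda>p. rough_sum W F G Z H p - k * (Z b - Z a)) \<longlongrightarrow> Lim (mesh_to_0 a b) (rough_sum W F G Z H) - k * (Z b - Z a)) (mesh_to_0 a b)"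
      by (intro tendsto_diff tendsto_const)
    moreover have "\<forall>\<^sub>F p in mesh_to_0 a b. rough_sum W F G Z H p - k * (Z b - Z a) = rough_sum W (\<lambda>\<eta>. F \<eta> - k) G Z H p"
      unfolding eventually_mesh_to_0 using eq by (intro exI[of _ 1]) auto
    ultimately have "(rough_sum W (\<lambda>\<eta>. F \<eta> - k) G Z H \<longlongrightarrow> Lim (mesh_to_0 a b) (rough_sum W F G Z H) - k * (Z b - Z a)) (mesh_to_0 a b)"
      by (rule Lim_transform_eventually)
    then show ?thesis using tendsto_Lim[OF mesh_to_0_neq_bot[OF ab(2)]] by blast
  qed
  show ?thesis
  proof (cases "a \<le> b")
    case True
    then show ?thesis using le[of a b] I by (simp add: rough_integral_def)
  next
    case False
    then show ?thesis using le[of b a] I by (simp add: rough_integral_def algebra_simps)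
  qed
qed

definition lift_area :: "(real \<Rightarrow> real \<Rightarrow> mat3) \<Rightarrow> cpath \<Rightarrow> real \<Rightarrow> real \<Rightarrow> mat3" where
  "lift_area W Y = snd (lift_cpath W Y)"

lemma lift_cpath_eq: "lift_cpath W Y = (fst Y, lift_area W Y)"
  by (simp add: lift_area_def lift_cpath_def case_prod_unfold)

lemma lift_area_component:
  "lift_area W Y \<rho> \<xi> $ i $ j = rough_integral W (\<lambda>\<eta>. fst Y \<eta> $ i - fst Y \<rho> $ i) (dcoord Y i)
     (coord Y j) (dcoord Y j) \<rho> \<xi>"
  by (simp add: lift_area_def lift_cpath_def case_prod_unfold)

text \<open>The integral with integrand \<open>Y\<^sup>i - Y\<^sup>i\<^sub>\<rho>\<close> is \<open>\<integral> Y\<^sup>i dY\<^sup>j\<close>, which is additive, minus the elementary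
  integral of a constant.\<close>

lemma chen_relation_lift_area:
  assumes r: "near_rough_paths \<gamma> M e X W X' W'" and Y: "near_closed_paths \<gamma> M e X X' Y Y'" and g: "1 / 3 < \<gamma>"
  shows "chen_relation (fst Y) (lift_area W Y)"
  unfolding chen_relation_def
proof (intro ballI allI)
  fix \<xi> \<eta> \<rho> :: real and i j assume I: "\<xi> \<in> {0..1}" "\<eta> \<in> {0..1}" "\<rho> \<in> {0..1}"
  have c: "near_controlled \<gamma> M e X X' (coord Y i) (dcoord Y i) (coord Y' i) (dcoord Y' i)" for i
    using near_closed_pathsD[OF Y] .
  define J where "J = rough_integral W (coord Y i) (dcoord Y i) (coord Y j) (dcoord Y j)"
  have area: "lift_area W Y a b $ i $ j = J a b - fst Y a $ i * (fst Y b $ j - fst Y a $ j)"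
    if "a \<in> {0..1}" "b \<in> {0..1}" for a b
    unfolding lift_area_component J_def by (rule rough_integral_minus_const[OF r c c g that])
  have "J \<xi> \<rho> = J \<xi> \<eta> + J \<eta> \<rho>"
    unfolding J_def by (rule rough_integral_additive_any_order[OF r c c g I(1,3,2)])
  then show "lift_area W Y \<xi> \<rho> $ i $ j - lift_area W Y \<xi> \<eta> $ i $ j - lift_area W Y \<eta> \<rho> $ i $ j
      = (fst Y \<xi> $ i - fst Y \<eta> $ i) * (fst Y \<eta> $ j - fst Y \<rho> $ j)"
    unfolding area[OF I(1,3)] area[OF I(1,2)] area[OF I(2,3)] by (simp add: algebra_simps)
qed

lemma chen_relation_diagonal:
  assumes "chen_relation X W" "a \<in> {0..1}"
  shows "W a a $ i $ j = 0"
proof -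
  have "W a a $ i $ j - W a a $ i $ j - W a a $ i $ j = (X a $ i - X a $ i) * (X a $ j - X a $ j)"
    using assms unfolding chen_relation_def by blast
  then show ?thesis by simp
qed

lemma chen_relation_reverse:
  assumes "chen_relation X W" "a \<in> {0..1}" "b \<in> {0..1}"
  shows "W b a $ i $ j = (X b $ i - X a $ i) * (X b $ j - X a $ j) - W a b $ i $ j"
proof -
  have "W b b $ i $ j - W b a $ i $ j - W a b $ i $ j = (X b $ i - X a $ i) * (X a $ j - X b $ j)"
    using assms unfolding chen_relation_def by blast
  then show ?thesis using chen_relation_diagonal[OF assms(1,3)] by (simp add: algebra_simps)
qed

definition lift_const :: "real \<Rightarrow> real \<Rightarrow> real" where
  "lift_const \<gamma> M = sewing_const (3 * \<gamma>) * (170 * (M * M * (M * M))) + 36 * M * M * M + 98 * (M * M * (M * M))"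

lemma lift_const_pos: "1 / 3 < \<gamma> \<Longrightarrow> 1 \<le> M \<Longrightarrow> 0 < lift_const \<gamma> M"
  using sewing_const_fixpoint(1)[of "3 * \<gamma>"] by (simp add: lift_const_def add_pos_pos)

text \<open>For \<open>a \<le> b\<close> the integrand \<open>Y - Y\<^sub>a\<close> vanishes at \<open>a\<close>, so the germ has order \<open>2\<gamma>\<close> and sewing adds order
  \<open>3\<gamma>\<close>. For \<open>b < a\<close> the bound follows by reversing the two parameters with Chen's relation.\<close>

lemma near_lift:
  assumes r: "near_rough_paths \<gamma> M e X W X' W'" and Y: "near_closed_paths \<gamma> M e X X' Y Y'" and g: "1 / 3 < \<gamma>"
  shows "near_rough_paths \<gamma> (lift_const \<gamma> M) e (fst Y) (lift_area W Y) (fst Y') (lift_area W' Y')"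
proof -
  have M: "1 \<le> M" "0 \<le> e" using r by (auto simp: near_rough_paths_def)
  have g0: "0 < \<gamma>" using g by simp
  let ?C = "sewing_const (3 * \<gamma>) * (170 * (M * M * (M * M)))"
  have C0: "0 \<le> ?C" using sewing_const_fixpoint(1)[of "3 * \<gamma>"] g M by simp
  have MM: "M \<le> M * M" "M * M \<le> M * M * (M * M)" "0 \<le> M * M * M"
    using M le_mult_right[of M M] le_mult_right[of "M * M" "M * M"] mult_mono[of 1 M 1 M] by auto
  then have L1: "1 \<le> lift_const \<gamma> M" and L7: "7 * M * M \<le> lift_const \<gamma> M"
    unfolding lift_const_def using M C0 by linarith+
  have ctrl: "near_controlled \<gamma> M e X X' (coord Y i) (dcoord Y i) (coord Y' i) (dcoord Y' i)" for i
    using near_closed_pathsD[OF Y] .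
  have ctrl': "near_controlled \<gamma> M e X X' (\<lambda>\<eta>. fst Y \<eta> $ i - k) (dcoord Y i) (\<lambda>\<eta>. fst Y' \<eta> $ i - k') (dcoord Y' i)" for i k k'
    using ctrl[of i] by (simp add: near_controlled_def ctrl_rem_def)
  note chen = chen_relation_lift_area[OF r Y g]
    chen_relation_lift_area[OF near_rough_paths_sym[OF r] near_closed_paths_sym[OF Y] g]
  have forward: "near ((?C + 36 * M * M * M) * (\<bar>b - a\<bar> powr \<gamma> * \<bar>b - a\<bar> powr \<gamma>)) e (lift_area W Y a b $ i $ j) (lift_area W' Y' a b $ i $ j)"
    if I: "a \<in> {0..1}" "b \<in> {0..1}" "a \<le> b" for a b i j
  proof -
    define s where "s = \<bar>b - a\<bar> powr \<gamma>"
    have s: "0 \<le> s" "s \<le> 1" using I g0 by (auto simp: s_def intro!: powr_le1)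
    have ba: "(b - a) powr \<gamma> = s" using I by (simp add: s_def)
    note D = near_controlledD(1)[OF ctrl g0 M(2) I(1,2) order_refl]
    note R = near_rough_pathsD(2)[OF r g0 I(1,2) order_refl, folded s_def]
    let ?g = "germ W (\<lambda>\<eta>. fst Y \<eta> $ i - fst Y a $ i) (dcoord Y i) (coord Y j) (dcoord Y j) a b"
    let ?g' = "germ W' (\<lambda>\<eta>. fst Y' \<eta> $ i - fst Y' a $ i) (dcoord Y' i) (coord Y' j) (dcoord Y' j) a b"
    have "near (3 * (3 * (2 * (2 * M * M) * (M * (s * s))))) e ?g ?g'"
      unfolding germ_def diff_self mult_zero_left add_0 by (intro near_sum3 near_mult D R)
    moreover have "near (?C * (s * s * s)) e (lift_area W Y a b $ i $ j - ?g) (lift_area W' Y' a b $ i $ j - ?g')"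
      unfolding lift_area_component
      by (rule rough_integral_near_germ[OF r ctrl' ctrl g, of a b, unfolded powr_triple ba]) (use I in auto)
    ultimately have "near (?C * (s * s * s) + 36 * M * M * M * (s * s)) e (lift_area W Y a b $ i $ j) (lift_area W' Y' a b $ i $ j)"
      using near_add by (fastforce simp: mult_ac)
    moreover have "?C * (s * s * s) \<le> ?C * (s * s)"
      using C0 s mult_left_mono[of s 1 "s * s"] by (intro mult_left_mono) auto
    ultimately show ?thesis
      using near_weaken[OF _ _ M(2)] unfolding s_def[symmetric] distrib_right by fastforce
  qed
  show ?thesis
    unfolding near_rough_paths_def
  proof (intro conjI ballI allI L1 M(2) chen)
    fix a b :: real and i j assume I: "a \<in> {0..1}" "b \<in> {0..1}"
    define s where "s = \<bar>b - a\<bar> powr \<gamma>"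
    have s: "0 \<le> s" "\<bar>a - b\<bar> powr \<gamma> = s" by (auto simp: s_def abs_minus_commute)
    have inc: "near (7 * M * M * s) e (fst Y b $ i - fst Y a $ i) (fst Y' b $ i - fst Y' a $ i)"
      "near (7 * M * M * s) e (fst Y a $ i - fst Y b $ i) (fst Y' a $ i - fst Y' b $ i)" for i
      using near_controlled_increment[OF ctrl r g0 I order_refl] near_controlled_increment[OF ctrl r g0 I(2,1) order_refl] I s
      by (auto simp: s_def)
    show "near (lift_const \<gamma> M * \<bar>b - a\<bar> powr \<gamma>) e (fst Y b $ i - fst Y a $ i) (fst Y' b $ i - fst Y' a $ i)"
      unfolding s_def[symmetric] using L7 s by (intro near_weaken[OF inc(1)] mult_right_mono M(2)) auto
    have c: "lift_const \<gamma> M * (s * s) = (?C + 36 * M * M * M) * (s * s) + 2 * (7 * M * M * s) * (7 * M * M * s)"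
      by (simp add: lift_const_def algebra_simps)
    show "near (lift_const \<gamma> M * \<bar>b - a\<bar> powr (2 * \<gamma>)) e (lift_area W Y a b $ i $ j) (lift_area W' Y' a b $ i $ j)"
    proof (cases "a \<le> b")
      case True
      then show ?thesis using s M
        unfolding powr_double s_def[symmetric] c by (intro near_weaken[OF forward[OF I, folded s_def]]) auto
    next
      case False
      have "near (2 * (7 * M * M * s) * (7 * M * M * s) + (?C + 36 * M * M * M) * (s * s)) e
          (lift_area W Y a b $ i $ j) (lift_area W' Y' a b $ i $ j)"
        unfolding chen_relation_reverse[OF chen(1) I(2,1)] chen_relation_reverse[OF chen(2) I(2,1)]
        using forward[OF I(2,1)] False s by (intro near_diff near_mult inc) auto
      then show ?thesis unfolding powr_double s_def[symmetric] c by (simp add: add.commute)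
    qed
  qed
qed

section \<open>Norms\<close>

lemma tensor_norm_real: "tensor_norm (x::real) = \<bar>x\<bar>"
  by (simp add: tensor_norm_def)

lemma tensor_norm_vec: "tensor_norm (v::'a::euclidean_space^'n) = (\<Sum>i\<in>UNIV. tensor_norm (v $ i))"
proof -
  have B: "(Basis :: ('a^'n) set) = (\<lambda>(i, u). axis i u) ` (UNIV \<times> Basis)"
    by (auto simp: Basis_vec_def)
  have inj: "inj_on (\<lambda>(i::'n, u::'a). axis i u) (UNIV \<times> Basis)"
    by (auto simp: inj_on_def axis_eq_axis)
  have "tensor_norm v = (\<Sum>(i, u)\<in>UNIV \<times> Basis. \<bar>v \<bullet> axis i u\<bar>)"
    unfolding tensor_norm_def B by (subst sum.reindex[OF inj]) (auto intro!: sum.cong)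
  also have "\<dots> = (\<Sum>i\<in>UNIV. \<Sum>u\<in>Basis. \<bar>v $ i \<bullet> u\<bar>)"
    by (simp add: sum.cartesian_product inner_axis)
  finally show ?thesis by (simp add: tensor_norm_def)
qed

lemma tensor_norm_nonneg: "0 \<le> tensor_norm v"
  by (simp add: tensor_norm_def sum_nonneg)

lemma component_le_tensor_norm:
  fixes v :: vec3 and m :: mat3
  shows "\<bar>v $ i\<bar> \<le> tensor_norm v" "\<bar>m $ i $ j\<bar> \<le> tensor_norm m"
proof -
  have v: "\<bar>v $ i\<bar> \<le> tensor_norm v" for v :: vec3 and i
    unfolding tensor_norm_vec tensor_norm_real by (rule member_le_sum) auto
  then show "\<bar>v $ i\<bar> \<le> tensor_norm v" .
  have "tensor_norm (m $ i) \<le> tensor_norm m"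
    unfolding tensor_norm_vec[of m] by (rule member_le_sum) (auto simp: tensor_norm_nonneg)
  then show "\<bar>m $ i $ j\<bar> \<le> tensor_norm m" using v[of "m $ i" j] by linarith
qed

lemma tensor_norm_le:
  fixes v :: vec3 and m :: mat3
  shows "(\<And>i. \<bar>v $ i\<bar> \<le> c) \<Longrightarrow> tensor_norm v \<le> 3 * c"
    and "(\<And>i j. \<bar>m $ i $ j\<bar> \<le> c) \<Longrightarrow> tensor_norm m \<le> 9 * c"
proof -
  have v: "tensor_norm v \<le> 3 * c" if "\<And>i. \<bar>v $ i\<bar> \<le> c" for v :: vec3 and c
    using sum_bounded_above[of UNIV "\<lambda>i. \<bar>v $ i\<bar>" c] that by (simp add: tensor_norm_vec tensor_norm_real)
  then show "(\<And>i. \<bar>v $ i\<bar> \<le> c) \<Longrightarrow> tensor_norm v \<le> 3 * c" .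
  show "tensor_norm m \<le> 9 * c" if "\<And>i j. \<bar>m $ i $ j\<bar> \<le> c"
    using sum_bounded_above[of UNIV "\<lambda>i. tensor_norm (m $ i)" "3 * c"] v[of "m $ _" c] that
    by (simp add: tensor_norm_vec[of m])
qed

lemma holder2_norm_leI:
  assumes "\<And>\<xi> \<eta>. \<xi> \<in> {0..1} \<Longrightarrow> \<eta> \<in> {0..1} \<Longrightarrow> \<xi> \<noteq> \<eta> \<Longrightarrow> tensor_norm (R \<xi> \<eta>) \<le> c * \<bar>\<xi> - \<eta>\<bar> powr \<alpha>"
  shows "holder2_norm \<alpha> R \<le> ennreal c"
  unfolding holder2_norm_def
proof (rule SUP_least, clarify)
  fix \<xi> \<eta> :: real assume I: "\<xi> \<in> {0..1}" "\<eta> \<in> {0..1}" "\<xi> \<noteq> \<eta>"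
  then have "tensor_norm (R \<xi> \<eta>) / \<bar>\<xi> - \<eta>\<bar> powr \<alpha> \<le> c"
    using assms[OF I] by (simp add: divide_le_eq)
  then show "ennreal (tensor_norm (R \<xi> \<eta>) / \<bar>\<xi> - \<eta>\<bar> powr \<alpha>) \<le> ennreal c" by (rule ennreal_leI)
qed

lemma holder2_norm_leD:
  assumes "holder2_norm \<alpha> R \<le> ennreal c" "0 \<le> c" "\<xi> \<in> {0..1}" "\<eta> \<in> {0..1}" "\<xi> \<noteq> \<eta>"
  shows "tensor_norm (R \<xi> \<eta>) \<le> c * \<bar>\<xi> - \<eta>\<bar> powr \<alpha>"
proof -
  have "ennreal (tensor_norm (R \<xi> \<eta>) / \<bar>\<xi> - \<eta>\<bar> powr \<alpha>) \<le> holder2_norm \<alpha> R"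
    unfolding holder2_norm_def using assms by (intro SUP_upper2[of "(\<xi>, \<eta>)"]) auto
  then have "tensor_norm (R \<xi> \<eta>) / \<bar>\<xi> - \<eta>\<bar> powr \<alpha> \<le> c"
    using assms(1,2) by (metis ennreal_le_iff order_trans)
  then show ?thesis using assms(5) by (simp add: divide_le_eq)
qed

lemma sup_norm_leD:
  assumes "sup_norm f \<le> ennreal c" "0 \<le> c" "\<xi> \<in> {0..1}"
  shows "tensor_norm (f \<xi>) \<le> c"
proof -
  have "ennreal (tensor_norm (f \<xi>)) \<le> sup_norm f"
    unfolding sup_norm_def using assms by (intro SUP_upper) auto
  then show ?thesis using assms(1,2) by (metis ennreal_le_iff order_trans)
qed

lemma add_leD_ennreal: "a + b \<le> (c::ennreal) \<Longrightarrow> a \<le> c \<and> b \<le> c"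
  by (meson add_increasing add_increasing2 dual_order.trans le_add_same_cancel1 order_refl zero_le add_mono)

lemma rough_dist_leD:
  assumes "rough_dist \<gamma> (X, W) (Z, V) \<le> ennreal c" "0 \<le> c" "a \<in> {0..1}" "b \<in> {0..1}" "a \<noteq> b"
  shows "\<bar>(X b $ i - X a $ i) - (Z b $ i - Z a $ i)\<bar> \<le> c * \<bar>b - a\<bar> powr \<gamma>"
    and "\<bar>W a b $ i $ j - V a b $ i $ j\<bar> \<le> c * \<bar>b - a\<bar> powr (2 * \<gamma>)"
proof -
  have h: "holder2_norm \<gamma> (\<lambda>\<xi> \<eta>. (X \<xi> - Z \<xi>) - (X \<eta> - Z \<eta>)) \<le> ennreal c"
    "holder2_norm (2 * \<gamma>) (\<lambda>\<xi> \<eta>. W \<xi> \<eta> - V \<xi> \<eta>) \<le> ennreal c"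
    using add_leD_ennreal[OF assms(1)[unfolded rough_dist_def, simplified]] by (simp_all add: holder_norm_def)
  show "\<bar>(X b $ i - X a $ i) - (Z b $ i - Z a $ i)\<bar> \<le> c * \<bar>b - a\<bar> powr \<gamma>"
    using holder2_norm_leD[OF h(1) assms(2,4,3)] component_le_tensor_norm(1)[of "(X b - Z b) - (X a - Z a)" i] assms(5)
    by (simp add: algebra_simps)
  show "\<bar>W a b $ i $ j - V a b $ i $ j\<bar> \<le> c * \<bar>b - a\<bar> powr (2 * \<gamma>)"
    using holder2_norm_leD[OF h(2) assms(2,3,4,5)] component_le_tensor_norm(2)[of "W a b - V a b" i j]
    by (simp add: abs_minus_commute)
qed

lemma near_rough_paths_of_ball:
  assumes X: "(X, W) \<in> rough_ball \<gamma> r" and Z: "(Z, V) \<in> rough_ball \<gamma> r"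
    and d: "rough_dist \<gamma> (X, W) (Z, V) \<le> ennreal e" and M: "1 \<le> M" "r \<le> M" "0 \<le> e"
  shows "near_rough_paths \<gamma> M e X W Z V"
proof -
  have chen: "chen_relation X W" "chen_relation Z V"
    using X Z unfolding rough_ball_def rough_paths_def chen_relation_def by blast+
  have b: "rough_dist \<gamma> (X, W) (\<lambda>_. 0, \<lambda>_ _. 0) \<le> ennreal M" "rough_dist \<gamma> (Z, V) (\<lambda>_. 0, \<lambda>_ _. 0) \<le> ennreal M"
    using X Z ennreal_leI[OF M(2)] unfolding rough_ball_def by auto
  have M0: "0 \<le> M" using M by simp
  show ?thesis
    unfolding near_rough_paths_def
  proof (intro conjI ballI allI chen M)
    fix a b :: real and i j assume I: "a \<in> {0..1}" "b \<in> {0..1}"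
    have c: "c \<le> M * c" if "0 \<le> c" for c using mult_right_mono[of 1 M c] M that by simp
    have e: "e * x \<le> M * x * e" if "0 \<le> x" for x
      using c[of "e * x"] that M by (simp add: mult_ac)
    show "near (M * \<bar>b - a\<bar> powr \<gamma>) e (X b $ i - X a $ i) (Z b $ i - Z a $ i)"
    proof (cases "a = b")
      case False
      then show ?thesis
        using rough_dist_leD(1)[OF b(1) M0 I, of i] rough_dist_leD(1)[OF b(2) M0 I, of i]
          rough_dist_leD(1)[OF d M(3) I, of i] e[of "\<bar>b - a\<bar> powr \<gamma>"]
        unfolding near_def by simp
    qed (use M in simp)
    show "near (M * \<bar>b - a\<bar> powr (2 * \<gamma>)) e (W a b $ i $ j) (V a b $ i $ j)"
    proof (cases "a = b")
      case False
      then show ?thesis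
        using rough_dist_leD(2)[OF b(1) M0 I, of i j] rough_dist_leD(2)[OF b(2) M0 I, of i j]
          rough_dist_leD(2)[OF d M(3) I, of i j] e[of "\<bar>b - a\<bar> powr (2 * \<gamma>)"]
        unfolding near_def by simp
    qed (use M I chen_relation_diagonal[OF chen(1)] chen_relation_diagonal[OF chen(2)] in simp)
  qed
qed

lemma rough_dist_le_of_near:
  assumes n: "near_rough_paths \<gamma> L e X W Z V"
  shows "rough_dist \<gamma> (X, W) (Z, V) \<le> ennreal (12 * L * e)"
proof -
  have L: "1 \<le> L" "0 \<le> e" using n by (auto simp: near_rough_paths_def)
  have "near (L * \<bar>b - a\<bar> powr \<gamma>) e (X b $ i - X a $ i) (Z b $ i - Z a $ i)"
     "near (L * \<bar>b - a\<bar> powr (2 * \<gamma>)) e (W a b $ i $ j) (V a b $ i $ j)"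
    if "a \<in> {0..1}" "b \<in> {0..1}" for a b i j
    using n that unfolding near_rough_paths_def by blast+
  then have b: "\<bar>(X b - Z b - (X a - Z a)) $ i\<bar> \<le> L * \<bar>b - a\<bar> powr \<gamma> * e"
     "\<bar>(W a b - V a b) $ i $ j\<bar> \<le> L * \<bar>b - a\<bar> powr (2 * \<gamma>) * e"
    if "a \<in> {0..1}" "b \<in> {0..1}" for a b i j
    using that by (simp_all add: near_def algebra_simps)
  have "holder_norm \<gamma> (\<lambda>\<xi>. X \<xi> - Z \<xi>) \<le> ennreal (3 * L * e)"
    unfolding holder_norm_def
    using tensor_norm_le(1)[OF b(1)] by (intro holder2_norm_leI) (simp add: mult_ac)
  moreover have "holder2_norm (2 * \<gamma>) (\<lambda>\<xi> \<eta>. W \<xi> \<eta> - V \<xi> \<eta>) \<le> ennreal (9 * L * e)"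
    using tensor_norm_le(2)[OF b(2)] by (intro holder2_norm_leI) (simp add: mult_ac abs_minus_commute)
  ultimately have "rough_dist \<gamma> (X, W) (Z, V) \<le> ennreal (3 * L * e) + ennreal (9 * L * e)"
    unfolding rough_dist_def by (auto intro: add_mono)
  also have "\<dots> = ennreal (12 * L * e)"
    using L by (subst ennreal_plus[symmetric]) auto
  finally show ?thesis .
qed

lemma tendsto_abs_powr_0:
  assumes "(f \<longlongrightarrow> (c::real)) F" "0 < \<gamma>"
  shows "((\<lambda>x. \<bar>f x - c\<bar> powr \<gamma>) \<longlongrightarrow> 0) F"
proof -
  have "((\<lambda>x. \<bar>f x - c\<bar>) \<longlongrightarrow> 0) F"
    using tendsto_rabs[OF tendsto_diff[OF assms(1) tendsto_const[of c]]] by simp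
  from tendsto_powr2[OF this tendsto_const[of \<gamma>]] show ?thesis using assms(2) by simp
qed

text \<open>Joint continuity of \<open>W\<close> comes for free: by Chen's relation moving either parameter changes \<open>W\<close> by
  quantities that are small by the Hoelder bounds.\<close>

lemma rough_paths_of_near:
  assumes n: "near_rough_paths \<gamma> L 0 X W X W" and X: "X \<in> closed_curves" and g: "0 < \<gamma>"
  shows "(X, W) \<in> rough_paths \<gamma>"
proof -
  have L: "1 \<le> L" and chen: "chen_relation X W" using n by (auto simp: near_rough_paths_def)
  have b: "\<bar>X b $ i - X a $ i\<bar> \<le> L * \<bar>b - a\<bar> powr \<gamma>" "\<bar>W a b $ i $ j\<bar> \<le> L * \<bar>b - a\<bar> powr (2 * \<gamma>)"
    if "a \<in> {0..1}" "b \<in> {0..1}" for a b i j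
    using n that unfolding near_rough_paths_def near_def by blast+
  have b1: "\<bar>X b $ i - X a $ i\<bar> \<le> L" if "a \<in> {0..1}" "b \<in> {0..1}" for a b i
  proof -
    have "\<bar>b - a\<bar> powr \<gamma> \<le> 1" using that g by (intro powr_le1) auto
    then have "L * \<bar>b - a\<bar> powr \<gamma> \<le> L * 1" using L by (intro mult_left_mono) auto
    then show ?thesis using b(1)[OF that, of i] by linarith
  qed
  have h: "holder_norm \<gamma> X \<le> ennreal (3 * L)"
    unfolding holder_norm_def
    by (rule holder2_norm_leI, subst mult.assoc, rule tensor_norm_le(1)) (use b(1) in simp)
  have h2: "holder2_norm (2 * \<gamma>) W \<le> ennreal (9 * L)"
    by (rule holder2_norm_leI, subst mult.assoc, rule tensor_norm_le(2)) (use b(2) in \<open>simp add: abs_minus_commute\<close>)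
  have s: "sup_norm X \<le> ennreal (3 * (tensor_norm (X 0) + L))"
    unfolding sup_norm_def
  proof (rule SUP_least, rule ennreal_leI, rule tensor_norm_le(1))
    fix \<xi> :: real and i assume "\<xi> \<in> {0..1}"
    then show "\<bar>X \<xi> $ i\<bar> \<le> tensor_norm (X 0) + L"
      using b1[of 0 \<xi> i] component_le_tensor_norm(1)[of "X 0" i] by auto
  qed
  have "continuous_on ({0..1} \<times> {0..1}) (\<lambda>(\<xi>, \<eta>). W \<xi> \<eta>)"
    unfolding continuous_on_def
  proof (intro ballI vec_tendstoI)
    fix z :: "real \<times> real" and i j assume "z \<in> {0..1} \<times> {0..1}"
    then obtain x y where z: "z = (x, y)" and I: "x \<in> {0..1}" "y \<in> {0..1}" by auto
    let ?F = "at z within {0..1} \<times> {0..1}"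
    let ?g = "\<lambda>p. L * \<bar>fst p - x\<bar> powr (2 * \<gamma>) + L * \<bar>snd p - y\<bar> powr (2 * \<gamma>) + (L * \<bar>fst p - x\<bar> powr \<gamma>) * L
          + L * (L * \<bar>snd p - y\<bar> powr \<gamma>)"
    have fst: "((\<lambda>p. \<bar>fst p - x\<bar> powr \<alpha>) \<longlongrightarrow> 0) ?F" and snd: "((\<lambda>p. \<bar>snd p - y\<bar> powr \<alpha>) \<longlongrightarrow> 0) ?F"
      if "0 < \<alpha>" for \<alpha>
      using that by (auto intro!: tendsto_abs_powr_0 tendsto_eq_intros simp: z)
    have "((\<lambda>p. (case p of (\<xi>, \<eta>) \<Rightarrow> W \<xi> \<eta>) $ i $ j - W x y $ i $ j) \<longlongrightarrow> 0) ?F"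
    proof (rule Lim_null_comparison)
      show "(?g \<longlongrightarrow> 0) ?F"
        using g by (auto intro!: tendsto_eq_intros fst snd simp: z)
      show "\<forall>\<^sub>F p in ?F. norm ((case p of (\<xi>, \<eta>) \<Rightarrow> W \<xi> \<eta>) $ i $ j - W x y $ i $ j)
          \<le> ?g p"
        unfolding eventually_at_filter
      proof (rule always_eventually, intro allI impI)
        fix p :: "real \<times> real" assume "p \<in> {0..1} \<times> {0..1}"
        then obtain u v where p: "p = (u, v)" and J: "u \<in> {0..1}" "v \<in> {0..1}" by auto
        have "W u v $ i $ j - W u x $ i $ j - W x v $ i $ j = (X u $ i - X x $ i) * (X x $ j - X v $ j)"
          "W x v $ i $ j - W x y $ i $ j - W y v $ i $ j = (X x $ i - X y $ i) * (X y $ j - X v $ j)"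
          using chen I J unfolding chen_relation_def by blast+
        then have eq: "W u v $ i $ j - W x y $ i $ j = W u x $ i $ j + W y v $ i $ j
            + (X u $ i - X x $ i) * (X x $ j - X v $ j) + (X x $ i - X y $ i) * (X y $ j - X v $ j)"
          by linarith
        have "\<bar>W u x $ i $ j\<bar> \<le> L * \<bar>u - x\<bar> powr (2 * \<gamma>)" "\<bar>W y v $ i $ j\<bar> \<le> L * \<bar>v - y\<bar> powr (2 * \<gamma>)"
          using b(2)[OF J(1) I(1), of i j] b(2)[OF I(2) J(2), of i j] by (simp_all add: abs_minus_commute)
        moreover have "\<bar>(X u $ i - X x $ i) * (X x $ j - X v $ j)\<bar> \<le> (L * \<bar>u - x\<bar> powr \<gamma>) * L"
          using b(1)[OF I(1) J(1), of i] b1[OF J(2) I(1), of j] by (intro abs_mult_le) auto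
        moreover have "\<bar>(X x $ i - X y $ i) * (X y $ j - X v $ j)\<bar> \<le> L * (L * \<bar>v - y\<bar> powr \<gamma>)"
          using b(1)[OF J(2) I(2), of j] b1[OF I(2,1), of i] by (intro abs_mult_le) (auto simp: abs_minus_commute)
        ultimately show "norm ((case p of (\<xi>, \<eta>) \<Rightarrow> W \<xi> \<eta>) $ i $ j - W x y $ i $ j)
          \<le> ?g p"
          unfolding p prod.case fst_conv snd_conv real_norm_def eq
          by (intro order_trans[OF abs_triangle_ineq] add_mono)
      qed
    qed
    then show "((\<lambda>p. (case p of (\<xi>, \<eta>) \<Rightarrow> W \<xi> \<eta>) $ i $ j) \<longlongrightarrow> (case z of (\<xi>, \<eta>) \<Rightarrow> W \<xi> \<eta>) $ i $ j) ?F"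
      unfolding z by (simp add: LIM_zero_cancel)
  qed
  moreover have "sup_norm X + holder_norm \<gamma> X < \<infinity>" "holder2_norm (2 * \<gamma>) W < \<infinity>"
    using s h h2 by (auto simp: less_top[symmetric] top_unique)
  ultimately show ?thesis
    using X chen unfolding rough_paths_def holder_curves_def chen_relation_def by auto
qed

lemma remainder_component:
  "remainder X Y a b $ i = ctrl_rem X (coord Y i) (dcoord Y i) a b"
  by (simp add: remainder_def ctrl_rem_def case_prod_unfold matrix_vector_mult_def)

lemma D_norm_leD:
  assumes "D_norm \<gamma> X Y \<le> ennreal c" "0 \<le> c" "a \<in> {0..1}" "b \<in> {0..1}"
  shows "\<bar>snd Y a $ i $ k\<bar> \<le> c"
    and "\<bar>snd Y b $ i $ k - snd Y a $ i $ k\<bar> \<le> c * \<bar>b - a\<bar> powr \<gamma>"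
    and "\<bar>ctrl_rem X (coord Y i) (dcoord Y i) a b\<bar> \<le> c * \<bar>b - a\<bar> powr (2 * \<gamma>)"
proof -
  have h: "holder2_norm \<gamma> (\<lambda>\<xi> \<eta>. snd Y \<xi> - snd Y \<eta>) \<le> ennreal c" "holder2_norm (2 * \<gamma>) (remainder X Y) \<le> ennreal c"
    "sup_norm (snd Y) \<le> ennreal c"
    using add_leD_ennreal[of "holder_norm \<gamma> (snd Y) + holder2_norm (2 * \<gamma>) (remainder X Y)" "sup_norm (snd Y)" "ennreal c"]
      add_leD_ennreal[of "holder_norm \<gamma> (snd Y)" "holder2_norm (2 * \<gamma>) (remainder X Y)" "ennreal c"] assms(1)
    by (auto simp: D_norm_def holder_norm_def)
  show "\<bar>snd Y a $ i $ k\<bar> \<le> c"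
    using sup_norm_leD[OF h(3) assms(2,3)] component_le_tensor_norm(2)[of "snd Y a" i k] by simp
  show "\<bar>snd Y b $ i $ k - snd Y a $ i $ k\<bar> \<le> c * \<bar>b - a\<bar> powr \<gamma>"
    using holder2_norm_leD[OF h(1) assms(2,4,3)] component_le_tensor_norm(2)[of "snd Y b - snd Y a" i k]
    by (cases "a = b") auto
  have "\<bar>remainder X Y a b $ i\<bar> \<le> c * \<bar>b - a\<bar> powr (2 * \<gamma>)"
  proof (cases "a = b")
    case True
    then show ?thesis by (simp add: remainder_def case_prod_unfold)
  next
    case False
    then show ?thesis
      using holder2_norm_leD[OF h(2) assms(2,3,4)] component_le_tensor_norm(1)[of "remainder X Y a b" i]
      by (simp add: abs_minus_commute)
  qed
  then show "\<bar>ctrl_rem X (coord Y i) (dcoord Y i) a b\<bar> \<le> c * \<bar>b - a\<bar> powr (2 * \<gamma>)"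
    unfolding remainder_component .
qed

lemma near_closed_paths_of_D_star_norm:
  assumes Y: "Y \<in> controlled_paths \<gamma> X" and Z: "Z \<in> controlled_paths \<gamma> X"
    and b: "D_norm \<gamma> X Y \<le> ennreal M" "D_norm \<gamma> X Z \<le> ennreal M"
    and d: "D_star_norm \<gamma> X (cpath_diff Y Z) \<le> ennreal e" and M: "1 \<le> M" "0 \<le> e"
  shows "near_closed_paths \<gamma> M e X X Y Z"
proof -
  have closed: "fst Y 0 = fst Y 1" "fst Z 0 = fst Z 1"
    using Y Z by (auto simp: controlled_paths_def closed_curves_def)
  have M0: "0 \<le> M" using M by simp
  have d: "D_norm \<gamma> X (cpath_diff Y Z) \<le> ennreal e"
    using d add_leD_ennreal unfolding D_star_norm_def by blast
  have le: "x \<le> M * x" if "0 \<le> x" for x using mult_right_mono[of 1 M x] M that by simp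
  have rem: "ctrl_rem X (coord (cpath_diff Y Z) i) (dcoord (cpath_diff Y Z) i) a b
     = ctrl_rem X (coord Y i) (dcoord Y i) a b - ctrl_rem X (coord Z i) (dcoord Z i) a b" for i a b
    by (simp add: cpath_diff_def ctrl_rem_def left_diff_distrib sum_subtractf)
  show ?thesis
    unfolding near_closed_paths_def near_controlled_def
  proof (intro conjI allI ballI closed)
    fix i k and a b' :: real assume I: "a \<in> {0..1}" "b' \<in> {0..1}"
    note Yb = D_norm_leD[OF b(1) M0 I] and Zb = D_norm_leD[OF b(2) M0 I] and db = D_norm_leD[OF d M(2) I]
    show "near M e (snd Y a $ i $ k) (snd Z a $ i $ k)"
      using Yb(1)[of i k] Zb(1)[of i k] db(1)[of i k] le[OF M(2)] by (simp add: near_def cpath_diff_def)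
    show "near (M * \<bar>b' - a\<bar> powr \<gamma>) e (snd Y b' $ i $ k - snd Y a $ i $ k) (snd Z b' $ i $ k - snd Z a $ i $ k)"
      using Yb(2)[of i k] Zb(2)[of i k] db(2)[of i k] le[of "e * \<bar>b' - a\<bar> powr \<gamma>"] M(2)
      by (simp add: near_def cpath_diff_def algebra_simps)
    show "near (M * \<bar>b' - a\<bar> powr (2 * \<gamma>)) e (ctrl_rem X (coord Y i) (dcoord Y i) a b')
       (ctrl_rem X (coord Z i) (dcoord Z i) a b')"
      using Yb(3)[of i] Zb(3)[of i] db(3)[of i] le[of "e * \<bar>b' - a\<bar> powr (2 * \<gamma>)"] M(2)
      by (simp add: near_def rem mult_ac)
  qed
qed

text \<open>Two bounded quantities always differ by at most twice the bound; this starts the iteration in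
  \<open>solutions_near\<close>.\<close>

lemma near_closed_paths_of_D_norm:
  assumes Y: "Y \<in> controlled_paths \<gamma> X" and Z: "Z \<in> controlled_paths \<gamma> X'"
    and b: "D_norm \<gamma> X Y \<le> ennreal M" "D_norm \<gamma> X' Z \<le> ennreal M" and M: "0 \<le> M"
  shows "near_closed_paths \<gamma> M 2 X X' Y Z"
proof -
  have closed: "fst Y 0 = fst Y 1" "fst Z 0 = fst Z 1"
    using Y Z by (auto simp: controlled_paths_def closed_curves_def)
  have near: "near c 2 x y" if "\<bar>x\<bar> \<le> c" "\<bar>y\<bar> \<le> c" for x y c
    using that unfolding near_def by linarith
  show ?thesis
    unfolding near_closed_paths_def near_controlled_def
    by (intro conjI allI ballI closed near D_norm_leD[OF b(1) M] D_norm_leD[OF b(2) M])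
qed

section \<open>Stability of the flow\<close>

lemma integral_difference_bound:
  fixes f g :: "real \<Rightarrow> real"
  assumes f: "(f has_integral I) {0..t}" and g: "(g has_integral J) {0..t}"
    and b: "\<And>s. s \<in> {0..t} \<Longrightarrow> \<bar>f s - g s\<bar> \<le> N * exp (\<mu> * s)" and "0 < \<mu>" "0 \<le> N" "0 \<le> t"
  shows "\<bar>I - J\<bar> \<le> N * exp (\<mu> * t) / \<mu>"
proof -
  have "((\<lambda>s. N * exp (\<mu> * s)) has_integral N * exp (\<mu> * t) / \<mu> - N * exp (\<mu> * 0) / \<mu>) {0..t}"
    using assms by (intro fundamental_theorem_of_calculus)
      (auto intro!: derivative_eq_intros simp: has_real_derivative_iff_has_vector_derivative[symmetric])
  then have h: "((\<lambda>s. N * exp (\<mu> * s)) has_integral N * exp (\<mu> * t) / \<mu> - N / \<mu>) {0..t}" by simp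
  have "I - J \<le> N * exp (\<mu> * t) / \<mu> - N / \<mu>"
    using b by (intro has_integral_le[OF has_integral_diff[OF f g] h]) (auto simp: abs_le_iff)
  moreover have "J - I \<le> N * exp (\<mu> * t) / \<mu> - N / \<mu>"
    using b by (intro has_integral_le[OF has_integral_diff[OF g f] h]) (auto simp: abs_le_iff)
  moreover have "0 \<le> N / \<mu>" using assms by simp
  ultimately show ?thesis by linarith
qed

text \<open>The initial pair \<open>(X, Id)\<close> has remainder \<open>0\<close>, so the remainder of \<open>Y(t)\<close> is the time integral of the
  remainders of the velocity.\<close>

lemma solution_integrals:
  assumes s: "is_solution \<gamma> A (X, W) T Y" and I: "t \<in> {0..T}" "a \<in> {0..1}" "b \<in> {0..1}"
  defines "v \<equiv> \<lambda>s \<xi>. velocity A W (Y s) (fst (Y s) \<xi>)"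
    and "w \<equiv> \<lambda>s \<xi>. grad (velocity A W (Y s)) (fst (Y s) \<xi>) ** snd (Y s) \<xi>"
  shows "((\<lambda>s. w s a $ i $ k) has_integral snd (Y t) a $ i $ k - mat 1 $ i $ k) {0..t}"
    and "((\<lambda>s. w s b $ i $ k - w s a $ i $ k) has_integral snd (Y t) b $ i $ k - snd (Y t) a $ i $ k) {0..t}"
    and "((\<lambda>s. ctrl_rem X (\<lambda>\<xi>. v s \<xi> $ i) (\<lambda>\<xi>. w s \<xi> $ i) a b) has_integral
      ctrl_rem X (coord (Y t) i) (dcoord (Y t) i) a b) {0..t}"
proof -
  have vi: "((\<lambda>s. v s \<xi> $ i) has_integral fst (Y t) \<xi> $ i - X \<xi> $ i) {0..t}" if "\<xi> \<in> {0..1}" for \<xi> i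
  proof -
    have "((\<lambda>s. v s \<xi>) has_integral (fst (Y t) \<xi> - X \<xi>)) {0..t}"
      using s I that by (simp add: is_solution_def v_def)
    from has_integral_linear[OF this bounded_linear_vec_nth[of i]] show ?thesis by (simp add: o_def)
  qed
  have wi: "((\<lambda>s. w s \<xi> $ i $ k) has_integral snd (Y t) \<xi> $ i $ k - mat 1 $ i $ k) {0..t}" if "\<xi> \<in> {0..1}" for \<xi> i k
  proof -
    have "((\<lambda>s. w s \<xi>) has_integral (snd (Y t) \<xi> - mat 1)) {0..t}"
      using s I that by (simp add: is_solution_def w_def)
    from has_integral_linear[OF has_integral_linear[OF this bounded_linear_vec_nth[of i]] bounded_linear_vec_nth[of k]]
    show ?thesis by (simp add: o_def)
  qed
  show "((\<lambda>s. w s a $ i $ k) has_integral snd (Y t) a $ i $ k - mat 1 $ i $ k) {0..t}" by (rule wi[OF I(2)])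
  show "((\<lambda>s. w s b $ i $ k - w s a $ i $ k) has_integral snd (Y t) b $ i $ k - snd (Y t) a $ i $ k) {0..t}"
    using has_integral_diff[OF wi[OF I(3)] wi[OF I(2)], of i k i k] by simp
  have id: "(\<Sum>k\<in>UNIV. mat 1 $ i $ k * (X b $ k - X a $ k)) = X b $ i - X a $ i"
    by (subst sum.cong[OF refl, of UNIV _ "\<lambda>k. if i = k then X b $ k - X a $ k else 0"]) (auto simp: mat_def)
  have eq: "(fst (Y t) b $ i - X b $ i) - (fst (Y t) a $ i - X a $ i)
      - (\<Sum>k\<in>UNIV. (snd (Y t) a $ i $ k - mat 1 $ i $ k) * (X b $ k - X a $ k))
      = ctrl_rem X (coord (Y t) i) (dcoord (Y t) i) a b"
    unfolding ctrl_rem_def left_diff_distrib[of "snd (Y t) a $ i $ _"] sum_subtractf id by simp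
  have "((\<lambda>s. v s b $ i - v s a $ i - (\<Sum>k\<in>UNIV. w s a $ i $ k * (X b $ k - X a $ k))) has_integral
      (fst (Y t) b $ i - X b $ i) - (fst (Y t) a $ i - X a $ i)
      - (\<Sum>k\<in>UNIV. (snd (Y t) a $ i $ k - mat 1 $ i $ k) * (X b $ k - X a $ k))) {0..t}"
    by (intro has_integral_diff has_integral_sum has_integral_mult_left vi wi I finite)
  then show "((\<lambda>s. ctrl_rem X (\<lambda>\<xi>. v s \<xi> $ i) (\<lambda>\<xi>. w s \<xi> $ i) a b) has_integral
      ctrl_rem X (coord (Y t) i) (dcoord (Y t) i) a b) {0..t}"
    unfolding eq by (simp add: ctrl_rem_def)
qed

text \<open>Integrating \<open>N * c * exp (\<mu> * s)\<close> over \<open>{0..t}\<close> gains the factor \<open>N / \<mu> \<le> 1 / 2\<close>. The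
  hypothesis \<open>\<delta> \<le> c\<close> ensures that \<open>c * exp (\<mu> * s)\<close> also bounds the distance of the rough paths.\<close>

lemma solutions_near_improve:
  assumes Y: "is_solution \<gamma> A (X, W) T Y" and Z: "is_solution \<gamma> A (U, V) T Z"
    and r: "near_rough_paths \<gamma> M \<delta> X W U V"
    and A: "\<And>i j. derivs_bounded 5 K (\<lambda>z. A z $ i $ j)" and g: "1 / 3 < \<gamma>"
    and \<mu>: "\<mu> = 2 * velocity_const \<gamma> M K + 1" and c: "\<delta> \<le> c"
    and near: "\<And>t. t \<in> {0..T} \<Longrightarrow> near_closed_paths \<gamma> M (c * exp (\<mu> * t)) X U (Y t) (Z t)"
    and t: "t \<in> {0..T}"
  shows "near_closed_paths \<gamma> M (c / 2 * exp (\<mu> * t)) X U (Y t) (Z t)"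
proof -
  let ?N = "velocity_const \<gamma> M K"
  have M: "1 \<le> M" "0 \<le> \<delta>" using r by (auto simp: near_rough_paths_def)
  have K: "0 \<le> K" using A[of undefined undefined] derivs_bounded_nonneg[of 4 K] by simp
  have N0: "0 \<le> ?N" using velocity_const_nonneg[OF g M(1) K] .
  then have l0: "0 < \<mu>" by (simp add: \<mu>)
  have c0: "0 \<le> c" using M c by simp
  have rough: "near_rough_paths \<gamma> M (c * exp (\<mu> * s)) X W U V" if "s \<in> {0..T}" for s
  proof -
    have "1 \<le> exp (\<mu> * s)" using l0 that by simp
    then have "\<delta> \<le> c * exp (\<mu> * s)" using c c0 mult_left_mono[of 1 "exp (\<mu> * s)" c] by simp
    then show ?thesis by (rule near_rough_paths_larger[OF r])
  qed
  define v where "v Y W s \<xi> = velocity A W (Y s) (fst (Y s) \<xi>)" for Y :: "real \<Rightarrow> cpath" and W s \<xi>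
  define w where "w Y W s \<xi> = grad (velocity A W (Y s)) (fst (Y s) \<xi>) ** snd (Y s) \<xi>" for Y :: "real \<Rightarrow> cpath" and W s \<xi>
  have vel: "near_controlled \<gamma> ?N (c * exp (\<mu> * s)) X U (\<lambda>\<xi>. v Y W s \<xi> $ i) (\<lambda>\<xi>. w Y W s \<xi> $ i)
      (\<lambda>\<xi>. v Z V s \<xi> $ i) (\<lambda>\<xi>. w Z V s \<xi> $ i)" if "s \<in> {0..T}" for s i
    unfolding v_def w_def by (rule near_velocity[OF rough[OF that] near[OF that] A g])
  note Yint = solution_integrals[OF Y t, folded v_def w_def] and Zint = solution_integrals[OF Z t, folded v_def w_def]
  have t0: "0 \<le> t" using t by simp
  have improve: "\<bar>I - J\<bar> \<le> M * h * (c / 2 * exp (\<mu> * t))"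
    if i: "(f has_integral I) {0..t}" "(g has_integral J) {0..t}" and h: "0 \<le> h"
      and n: "\<And>s. s \<in> {0..T} \<Longrightarrow> near (?N * h) (c * exp (\<mu> * s)) (f s) (g s)" for I J h and f g :: "real \<Rightarrow> real"
  proof -
    have "\<bar>I - J\<bar> \<le> (?N * h * c) * exp (\<mu> * t) / \<mu>"
      by (rule integral_difference_bound[OF i]) (use n t l0 N0 h c0 in \<open>auto simp: near_def mult_ac\<close>)
    also have "\<dots> = (?N / \<mu>) * (h * c * exp (\<mu> * t))" by simp
    also have "\<dots> \<le> (1 / 2) * (h * c * exp (\<mu> * t))"
      using N0 h c0 by (intro mult_right_mono) (auto simp: \<mu> field_simps)
    also have "\<dots> \<le> M * ((1 / 2) * (h * c * exp (\<mu> * t)))"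
      using le_mult_right[OF _ M(1), of "(1 / 2) * (h * c * exp (\<mu> * t))"] h c0 by (simp add: mult_ac)
    finally show ?thesis by (simp add: mult_ac)
  qed
  show ?thesis
    unfolding near_closed_paths_def near_controlled_def
  proof (intro conjI allI ballI)
    show "fst (Y t) 0 = fst (Y t) 1" "fst (Z t) 0 = fst (Z t) 1"
      using near[OF t] by (auto simp: near_closed_paths_def)
  next
    fix i k and a b :: real assume I: "a \<in> {0..1}" "b \<in> {0..1}"
    have old: "near M (c * exp (\<mu> * t)) (snd (Y t) a $ i $ k) (snd (Z t) a $ i $ k)"
      "near (M * \<bar>b - a\<bar> powr \<gamma>) (c * exp (\<mu> * t)) (snd (Y t) b $ i $ k - snd (Y t) a $ i $ k) (snd (Z t) b $ i $ k - snd (Z t) a $ i $ k)"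
      "near (M * \<bar>b - a\<bar> powr (2 * \<gamma>)) (c * exp (\<mu> * t)) (ctrl_rem X (coord (Y t) i) (dcoord (Y t) i) a b)
         (ctrl_rem U (coord (Z t) i) (dcoord (Z t) i) a b)"
      using near[OF t] I unfolding near_closed_paths_def near_controlled_def by blast+
    have new: "near ?N (c * exp (\<mu> * s)) (w Y W s a $ i $ k) (w Z V s a $ i $ k)"
      "near (?N * \<bar>b - a\<bar> powr \<gamma>) (c * exp (\<mu> * s)) (w Y W s b $ i $ k - w Y W s a $ i $ k) (w Z V s b $ i $ k - w Z V s a $ i $ k)"
      "near (?N * \<bar>b - a\<bar> powr (2 * \<gamma>)) (c * exp (\<mu> * s)) (ctrl_rem X (\<lambda>\<xi>. v Y W s \<xi> $ i) (\<lambda>\<xi>. w Y W s \<xi> $ i) a b)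
         (ctrl_rem U (\<lambda>\<xi>. v Z V s \<xi> $ i) (\<lambda>\<xi>. w Z V s \<xi> $ i) a b)" if "s \<in> {0..T}" for s
      using vel[OF that, of i] I unfolding near_controlled_def by blast+
    show "near M (c / 2 * exp (\<mu> * t)) (snd (Y t) a $ i $ k) (snd (Z t) a $ i $ k)"
      using improve[OF Yint(1)[OF I] Zint(1)[OF I], of 1 i k i k] old(1) new(1) by (simp add: near_def)
    show "near (M * \<bar>b - a\<bar> powr \<gamma>) (c / 2 * exp (\<mu> * t)) (snd (Y t) b $ i $ k - snd (Y t) a $ i $ k) (snd (Z t) b $ i $ k - snd (Z t) a $ i $ k)"
      using improve[OF Yint(2)[OF I] Zint(2)[OF I], of "\<bar>b - a\<bar> powr \<gamma>" i k i k] old(2) new(2) by (simp add: near_def)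
    show "near (M * \<bar>b - a\<bar> powr (2 * \<gamma>)) (c / 2 * exp (\<mu> * t)) (ctrl_rem X (coord (Y t) i) (dcoord (Y t) i) a b)
         (ctrl_rem U (coord (Z t) i) (dcoord (Z t) i) a b)"
      using improve[OF Yint(3)[OF I] Zint(3)[OF I], of "\<bar>b - a\<bar> powr (2 * \<gamma>)" i i] old(3) new(3) by (simp add: near_def)
  qed
qed

lemma solutions_near:
  assumes Y: "is_solution \<gamma> A (X, W) T Y" and Z: "is_solution \<gamma> A (U, V) T Z"
    and r: "near_rough_paths \<gamma> M \<delta> X W U V" and \<delta>: "0 < \<delta>"
    and A: "\<And>i j. derivs_bounded 5 K (\<lambda>z. A z $ i $ j)" and g: "1 / 3 < \<gamma>"
    and bY: "\<And>t. t \<in> {0..T} \<Longrightarrow> D_norm \<gamma> X (Y t) \<le> ennreal M" and bZ: "\<And>t. t \<in> {0..T} \<Longrightarrow> D_norm \<gamma> U (Z t) \<le> ennreal M"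
    and t: "t \<in> {0..T}"
  shows "near_closed_paths \<gamma> M (\<delta> * exp ((2 * velocity_const \<gamma> M K + 1) * t)) X U (Y t) (Z t)"
proof -
  define \<mu> where "\<mu> = 2 * velocity_const \<gamma> M K + 1"
  have M: "1 \<le> M" using r by (auto simp: near_rough_paths_def)
  have K: "0 \<le> K" using A[of undefined undefined] derivs_bounded_nonneg[of 4 K] by simp
  have l0: "0 \<le> \<mu>" using velocity_const_nonneg[OF g M K] by (simp add: \<mu>_def)
  have *: "\<forall>t\<in>{0..T}. near_closed_paths \<gamma> M (max \<delta> (2 / 2 ^ n) * exp (\<mu> * t)) X U (Y t) (Z t)" for n
  proof (induction n)
    case 0
    show ?case
    proof
      fix t assume t: "t \<in> {0..T}"
      have "Y t \<in> controlled_paths \<gamma> X" "Z t \<in> controlled_paths \<gamma> U"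
        using Y Z t by (auto simp: is_solution_def cont_controlled_paths_def)
      then have n: "near_closed_paths \<gamma> M 2 X U (Y t) (Z t)"
        using near_closed_paths_of_D_norm bY[OF t] bZ[OF t] M by simp
      have "2 * 1 \<le> max \<delta> (2 / 2 ^ 0) * exp (\<mu> * t)"
        using l0 t by (intro mult_mono) auto
      then show "near_closed_paths \<gamma> M (max \<delta> (2 / 2 ^ 0) * exp (\<mu> * t)) X U (Y t) (Z t)"
        using near_closed_paths_larger[OF n] by simp
    qed
  next
    case (Suc n)
    show ?case
    proof
      fix t assume t: "t \<in> {0..T}"
      have "max \<delta> (2 / 2 ^ n) / 2 \<le> max \<delta> (2 / 2 ^ Suc n)" using \<delta> by (auto simp: max_def)
      moreover have "near_closed_paths \<gamma> M (max \<delta> (2 / 2 ^ n) / 2 * exp (\<mu> * t)) X U (Y t) (Z t)"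
        using Suc by (intro solutions_near_improve[OF Y Z r A g \<mu>_def _ _ t]) auto
      ultimately show "near_closed_paths \<gamma> M (max \<delta> (2 / 2 ^ Suc n) * exp (\<mu> * t)) X U (Y t) (Z t)"
        by (auto elim!: near_closed_paths_larger intro!: mult_right_mono)
    qed
  qed
  obtain n where "(1 / 2) ^ n < \<delta> / 2" using real_arch_pow_inv[of "\<delta> / 2" "1 / 2"] \<delta> by auto
  then have "max \<delta> (2 / 2 ^ n) = \<delta>" by (simp add: power_divide max_def)
  then show ?thesis using *[of n] t unfolding \<mu>_def by auto
qed

lemma derivs_bounded_of_Cn_norm:
  assumes d: "times_differentiable 5 (field_of A)" and b: "Cn_norm 4 (field_grad (field_of A)) < \<infinity>"
  shows "\<exists>K. \<forall>i j. derivs_bounded 5 K (\<lambda>z. A z $ i $ j)"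
proof -
  define K where "K = enn2real (Cn_norm 4 (field_grad (field_of A)))"
  have K: "Cn_norm 4 (field_grad (field_of A)) = ennreal K" using b by (simp add: K_def)
  have K0: "0 \<le> K" by (simp add: K_def)
  have "derivs_bounded 5 K (\<lambda>z. A z $ i $ j)" for i j
    unfolding derivs_bounded_def
  proof (intro conjI allI impI)
    fix ks :: "3 list" and x assume "length ks < 5"
    then show "partial_derivs ks (\<lambda>z. A z $ i $ j) differentiable at x"
      using d[unfolded times_differentiable_def, rule_format, of ks "(i, j)" x] by (simp add: field_of_def)
  next
    fix ks :: "3 list" and x assume l: "1 \<le> length ks \<and> length ks \<le> 5"
    then obtain ls k where ks: "ks = ls @ [k]" by (cases ks rule: rev_cases) auto
    define S where "S x = (\<Sum>c\<in>UNIV. \<Sum>ms\<in>{ms. length ms = length ls}. \<bar>partial_derivs ms (field_grad (field_of A) c) x\<bar>)" for x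
    have fin: "finite {ms :: 3 list. length ms = length ls}"
      using finite_lists_length_eq[of "UNIV :: 3 set" "length ls"] by simp
    have "\<bar>partial_derivs ks (\<lambda>z. A z $ i $ j) x\<bar> = \<bar>partial_derivs ls (field_grad (field_of A) ((i, j), k)) x\<bar>"
      by (simp add: ks partial_derivs_append field_grad_def field_of_def)
    also have "\<dots> \<le> (\<Sum>ms\<in>{ms. length ms = length ls}. \<bar>partial_derivs ms (field_grad (field_of A) ((i, j), k)) x\<bar>)"
      by (rule member_le_sum) (use fin in auto)
    also have "\<dots> \<le> S x"
      unfolding S_def by (rule member_le_sum[where f = "\<lambda>c. \<Sum>ms\<in>{ms. length ms = length ls}. \<bar>partial_derivs ms (field_grad (field_of A) c) x\<bar>"])
        (auto intro: sum_nonneg)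
    finally have 1: "\<bar>partial_derivs ks (\<lambda>z. A z $ i $ j) x\<bar> \<le> S x" .
    have "ennreal (S x) \<le> (SUP x. ennreal (S x))" by (rule SUP_upper) simp
    also have "\<dots> \<le> Cn_norm 4 (field_grad (field_of A))"
      unfolding Cn_norm_def S_def
      by (rule member_le_sum[where f = "\<lambda>k. SUP x. ennreal (\<Sum>c\<in>UNIV. \<Sum>ms\<in>{ms. length ms = k}. \<bar>partial_derivs ms (field_grad (field_of A) c) x\<bar>)"])
        (use l ks in auto)
    finally have "S x \<le> K" using K K0 by simp
    with 1 show "\<bar>partial_derivs ks (\<lambda>z. A z $ i $ j) x\<bar> \<le> K" by simp
  qed
  then show ?thesis by blast
qed

lemma Gamma_map_eq: "Gamma_map \<gamma> A T (X, W) t = (fst (solution \<gamma> A T (X, W) t), lift_area W (solution \<gamma> A T (X, W) t))"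
  by (simp add: Gamma_map_def lift_cpath_eq)

text \<open>Two values of one controlled path lie over the same rough path, so \<open>near_lift\<close> bounds the distance of
  their lifts by their distance as controlled paths.\<close>

lemma lift_continuous_in_time:
  assumes Y: "Y \<in> cont_controlled_paths \<gamma> X T" and r: "near_rough_paths \<gamma> M 0 X W X W" and g: "1 / 3 < \<gamma>"
    and b: "\<And>t. t \<in> {0..T} \<Longrightarrow> D_norm \<gamma> X (Y t) \<le> ennreal M"
  shows "(\<lambda>t. (fst (Y t), lift_area W (Y t))) \<in> cont_rough_paths \<gamma> T"
proof -
  have M: "1 \<le> M" using r by (simp add: near_rough_paths_def)
  define C where "C = 12 * lift_const \<gamma> M"
  have ctrl: "Y t \<in> controlled_paths \<gamma> X" if "t \<in> {0..T}" for t
    using Y that by (simp add: cont_controlled_paths_def)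
  have r': "near_rough_paths \<gamma> M e X W X W" if "0 \<le> e" for e
    using near_rough_paths_larger[OF r that] .
  have lift: "near_rough_paths \<gamma> (lift_const \<gamma> M) e (fst (Y s)) (lift_area W (Y s)) (fst (Y t)) (lift_area W (Y t))"
    if "s \<in> {0..T}" "t \<in> {0..T}" "D_star_norm \<gamma> X (cpath_diff (Y s) (Y t)) \<le> ennreal e" "0 \<le> e" for s t e
    using that M by (intro near_lift[OF r' _ g] near_closed_paths_of_D_star_norm ctrl b)
  have C: "0 < C" using lift_const_pos[OF g M] by (simp add: C_def)
  have dist: "rough_dist \<gamma> (fst (Y s), lift_area W (Y s)) (fst (Y t), lift_area W (Y t))
      \<le> ennreal C * D_star_norm \<gamma> X (cpath_diff (Y s) (Y t))" if st: "s \<in> {0..T}" "t \<in> {0..T}" for s t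
  proof (cases "D_star_norm \<gamma> X (cpath_diff (Y s) (Y t))")
    case (real e)
    then show ?thesis
      using rough_dist_le_of_near[OF lift[OF st, of e]] C by (simp add: C_def ennreal_mult mult_ac)
  qed (use C in \<open>simp add: ennreal_mult_top\<close>)
  have mem: "(fst (Y t), lift_area W (Y t)) \<in> rough_paths \<gamma>" if t: "t \<in> {0..T}" for t
  proof (rule rough_paths_of_near)
    have "near_closed_paths \<gamma> M 2 X X (Y t) (Y t)"
      using near_closed_paths_of_D_norm[OF ctrl[OF t] ctrl[OF t] b[OF t] b[OF t]] M by simp
    from near_lift[OF r near_closed_paths_self[OF this] g]
    show "near_rough_paths \<gamma> (lift_const \<gamma> M) 0 (fst (Y t)) (lift_area W (Y t)) (fst (Y t)) (lift_area W (Y t))" .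
    show "fst (Y t) \<in> closed_curves" using ctrl[OF t] by (auto simp: controlled_paths_def)
  qed (use g in simp)
  show ?thesis
    unfolding cont_rough_paths_def
  proof (intro CollectI conjI ballI mem)
    fix t assume t: "t \<in> {0..T}"
    have "((\<lambda>s. D_star_norm \<gamma> X (cpath_diff (Y s) (Y t))) \<longlongrightarrow> 0) (at t within {0..T})"
      using Y t by (simp add: cont_controlled_paths_def)
    then have lim: "((\<lambda>s. ennreal C * D_star_norm \<gamma> X (cpath_diff (Y s) (Y t))) \<longlongrightarrow> 0) (at t within {0..T})"
      using ennreal_tendsto_cmult[of "ennreal C"] by fastforce
    show "((\<lambda>s. rough_dist \<gamma> (fst (Y s), lift_area W (Y s)) (fst (Y t), lift_area W (Y t))) \<longlongrightarrow> 0) (at t within {0..T})"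
      by (rule tendsto_sandwich[OF _ _ tendsto_const lim])
         (use dist t in \<open>auto simp: eventually_at_filter\<close>)
  qed
qed

theorem theorem4:
  fixes \<gamma> r T\<^sub>0 :: real and A :: "real^3 \<Rightarrow> real^3^3"
  assumes "\<gamma> > 1 / 3"
    and "times_differentiable 5 (field_of A)"
    and "Cn_norm 4 (field_grad (field_of A)) < \<infinity>"
    and "r > 0"
    and "common_existence_time \<gamma> A r T\<^sub>0"
  shows "(\<forall>XX\<in>rough_ball \<gamma> r. Gamma_map \<gamma> A T\<^sub>0 XX \<in> cont_rough_paths \<gamma> T\<^sub>0) \<and>
    (\<exists>L::real. \<forall>XX\<in>rough_ball \<gamma> r. \<forall>ZZ\<in>rough_ball \<gamma> r.
       unif_rough_dist \<gamma> T\<^sub>0 (Gamma_map \<gamma> A T\<^sub>0 XX) (Gamma_map \<gamma> A T\<^sub>0 ZZ)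
         \<le> ennreal L * rough_dist \<gamma> XX ZZ)"
proof -
  obtain K where A: "\<And>i j. derivs_bounded 5 K (\<lambda>z. A z $ i $ j)"
    using derivs_bounded_of_Cn_norm[OF assms(2,3)] by blast
  obtain B where B: "\<And>XX Y t. XX \<in> rough_ball \<gamma> r \<Longrightarrow> is_solution \<gamma> A XX T\<^sub>0 Y \<Longrightarrow> t \<in> {0..T\<^sub>0} \<Longrightarrow> D_norm \<gamma> (fst XX) (Y t) \<le> ennreal B"
    using assms(5) unfolding common_existence_time_def by blast
  \<comment> \<open>One bound for the initial rough paths and for the solutions.\<close>
  define M where "M = Max {1, r, B}"
  have M: "1 \<le> M" "r \<le> M" "B \<le> M" by (auto simp: M_def)
  define \<mu> where "\<mu> = 2 * velocity_const \<gamma> M K + 1"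
  define L where "L = 12 * lift_const \<gamma> M * exp (\<mu> * T\<^sub>0)"
  have "0 \<le> K" using A[of undefined undefined] derivs_bounded_nonneg[of 4 K] by simp
  then have \<mu>0: "0 \<le> \<mu>" using velocity_const_nonneg[OF assms(1) M(1)] by (simp add: \<mu>_def)
  have L0: "0 < L" using lift_const_pos[OF assms(1) M(1)] by (simp add: L_def)
  have sol: "is_solution \<gamma> A XX T\<^sub>0 (solution \<gamma> A T\<^sub>0 XX)" if "XX \<in> rough_ball \<gamma> r" for XX
  proof -
    have "\<exists>Y. is_solution \<gamma> A XX T\<^sub>0 Y"
      using assms(5) that unfolding common_existence_time_def by (elim conjE) (drule (1) bspec, elim conjE)
    then show ?thesis unfolding solution_def by (rule someI_ex)
  qed
  have bound: "D_norm \<gamma> X (solution \<gamma> A T\<^sub>0 (X, W) t) \<le> ennreal M" if "(X, W) \<in> rough_ball \<gamma> r" "t \<in> {0..T\<^sub>0}" for X W t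
    using B[OF that(1) sol[OF that(1)] that(2)] ennreal_leI[OF M(3)] by simp
  have self: "rough_dist \<gamma> (X, W) (X, W) \<le> ennreal 0" for X W
  proof -
    have "holder2_norm \<gamma> (\<lambda>_ _. 0 :: vec3) \<le> ennreal 0" "holder2_norm (2 * \<gamma>) (\<lambda>_ _. 0 :: mat3) \<le> ennreal 0"
      by (rule holder2_norm_leI, simp add: tensor_norm_def)+
    then show ?thesis by (simp add: rough_dist_def holder_norm_def)
  qed
  have cont: "Gamma_map \<gamma> A T\<^sub>0 (X, W) \<in> cont_rough_paths \<gamma> T\<^sub>0" if XW: "(X, W) \<in> rough_ball \<gamma> r" for X W
  proof -
    have "solution \<gamma> A T\<^sub>0 (X, W) \<in> cont_controlled_paths \<gamma> X T\<^sub>0" using sol[OF XW] by (simp add: is_solution_def)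
    from lift_continuous_in_time[OF this near_rough_paths_of_ball[OF XW XW self M(1,2) order_refl] assms(1) bound[OF XW]]
    show ?thesis unfolding Gamma_map_eq[abs_def] .
  qed
  have lip: "unif_rough_dist \<gamma> T\<^sub>0 (Gamma_map \<gamma> A T\<^sub>0 (X, W)) (Gamma_map \<gamma> A T\<^sub>0 (U, V)) \<le> ennreal L * rough_dist \<gamma> (X, W) (U, V)"
    if XW: "(X, W) \<in> rough_ball \<gamma> r" and UV: "(U, V) \<in> rough_ball \<gamma> r" for X W U V
  proof -
    have *: "unif_rough_dist \<gamma> T\<^sub>0 (Gamma_map \<gamma> A T\<^sub>0 (X, W)) (Gamma_map \<gamma> A T\<^sub>0 (U, V)) \<le> ennreal (L * \<delta>)"
      if \<delta>: "0 < \<delta>" "rough_dist \<gamma> (X, W) (U, V) \<le> ennreal \<delta>" for \<delta>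
      unfolding unif_rough_dist_def
    proof (rule SUP_least)
      fix t assume t: "t \<in> {0..T\<^sub>0}"
      have r: "near_rough_paths \<gamma> M \<delta> X W U V"
        using near_rough_paths_of_ball[OF XW UV \<delta>(2) M(1,2)] \<delta>(1) by simp
      have n: "near_closed_paths \<gamma> M (\<delta> * exp (\<mu> * t)) X U (solution \<gamma> A T\<^sub>0 (X, W) t) (solution \<gamma> A T\<^sub>0 (U, V) t)"
        unfolding \<mu>_def
        by (rule solutions_near[OF sol[OF XW] sol[OF UV] r \<delta>(1) A assms(1) bound[OF XW] bound[OF UV] t])
      have "\<delta> \<le> \<delta> * exp (\<mu> * t)" using \<delta>(1) \<mu>0 t by (intro le_mult_right) auto
      note r' = near_rough_paths_larger[OF r this]
      have "12 * lift_const \<gamma> M * (\<delta> * exp (\<mu> * t)) \<le> 12 * lift_const \<gamma> M * (\<delta> * exp (\<mu> * T\<^sub>0))"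
        using lift_const_pos[OF assms(1) M(1)] \<delta>(1) \<mu>0 t by (intro mult_left_mono) (auto intro: mult_left_mono)
      also have "\<dots> = L * \<delta>" by (simp add: L_def)
      finally show "rough_dist \<gamma> (Gamma_map \<gamma> A T\<^sub>0 (X, W) t) (Gamma_map \<gamma> A T\<^sub>0 (U, V) t) \<le> ennreal (L * \<delta>)"
        unfolding Gamma_map_eq
        using order_trans[OF rough_dist_le_of_near[OF near_lift[OF r' n assms(1)]] ennreal_leI] by blast
    qed
    show ?thesis
    proof (cases "rough_dist \<gamma> (X, W) (U, V)")
      case (real d)
      \<comment> \<open>The distance \<open>d\<close> may vanish, whereas \<open>solutions_near\<close> needs a positive scale.\<close>
      show ?thesis
      proof (rule ennreal_le_epsilon)
        fix e :: real assume e: "0 < e"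
        have "unif_rough_dist \<gamma> T\<^sub>0 (Gamma_map \<gamma> A T\<^sub>0 (X, W)) (Gamma_map \<gamma> A T\<^sub>0 (U, V)) \<le> ennreal (L * (d + e / L))"
          by (rule *) (use real e L0 in \<open>auto intro!: ennreal_leI add_nonneg_pos\<close>)
        also have "L * (d + e / L) = L * d + e" using L0 by (simp add: distrib_left)
        also have "ennreal (L * d + e) = ennreal L * rough_dist \<gamma> (X, W) (U, V) + ennreal e"
          using real e L0 by (simp add: ennreal_mult)
        finally show "unif_rough_dist \<gamma> T\<^sub>0 (Gamma_map \<gamma> A T\<^sub>0 (X, W)) (Gamma_map \<gamma> A T\<^sub>0 (U, V))
            \<le> ennreal L * rough_dist \<gamma> (X, W) (U, V) + ennreal e" .
      qed
    qed (use L0 in \<open>simp add: ennreal_mult_top\<close>)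
  qed
  show ?thesis
    using cont lip by (intro conjI exI[of _ L]) auto
qed

end
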